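(* Let $0<p\leq u<\infty$, $0<q\leq\infty$ and $s>\frac pu\,\sigma_p$. Further let $f\in\mathcal{E}^s_{u,p,q}(\mathbb{R}^d)$ and $K\in\{-1\}\cup\mathbb{N}_0$. Then, with constants independent of $f$ (but possibly depending on $K$), there holds $$\|f\mid\mathcal{E}^s_{u,p,q}(\mathbb{R}^d)\|\sim_K\|f\mid\mathcal{E}^s_{u,p,q}(\mathbb{R}^d)\|_K^{\spadesuit}:=\|f\mid\mathcal{M}^u_p(\mathbb{R}^d)\|+|f|_K.$$ If even $s>\sigma_p$, then the implied constants do not depend on $K$ and the assertion remains valid for $K=\infty$.
   Context: $A\sim B$ means that each of $A,B$ is bounded by a constant times the other; the subscript in $\sim_K$ indicates that the constants may depend on $K$ (in addition to $d,s,u,p,q,\varphi_0$). $\sigma_p:=d\max\{0,\frac1p-1\}$. Morrey space: for $0<p\leq u<\infty$, $\mathcal{M}^u_p(\mathbb{R}^d)$ is the set of all (complex-valued) $f\in L_p^{\mathrm{loc}}(\mathbb{R}^d)$ with $$\|f\mid\mathcal{M}^u_p(\mathbb{R}^d)\|:=\sup_{y\in\mathbb{R}^d,R>0}|B(y,R)|^{\frac1u-\frac1p}\Big(\int_{B(y,R)}|f(x)|^p\,dx\Big)^{1/p}<\infty.$$ Fix $1\leq a<b\leq2$ and a non-negative $\varphi_0\in C_0^\infty(\mathbb{R}^d)$ with $\varphi_0(x)=1$ for $|x|\leq a$ and $\varphi_0(x)=0$ for $|x|\geq b$. Put $\psi(x):=\varphi_0(x)-\varphi_0(2x)$, $\psi_k(x):=\psi(2^{-k}x)$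 for $k\in\mathbb{Z}$, and $\varphi_k:=\psi_k$ for $k\in\mathbb{N}$. $\mathcal{F}$ is the Fourier transform on $\mathcal{S}'(\mathbb{R}^d)$; for $\eta\in C_0^\infty(\mathbb{R}^d)$ and $f\in\mathcal{S}'(\mathbb{R}^d)$ the distribution $\mathcal{F}^{-1}[\eta\mathcal{F}f]$ is identified with a smooth function. Triebel-Lizorkin-Morrey space: $\mathcal{E}^s_{u,p,q}(\mathbb{R}^d)$ is the set of all $f\in\mathcal{S}'(\mathbb{R}^d)$ with $$\|f\mid\mathcal{E}^s_{u,p,q}(\mathbb{R}^d)\|:=\Big\|\Big(\sum_{k=0}^\infty2^{ksq}|\mathcal{F}^{-1}[\varphi_k\mathcal{F}f](\cdot)|^q\Big)^{1/q}\ \Big|\ \mathcal{M}^u_p(\mathbb{R}^d)\Big\|<\infty$$ (supremum over $k$ if $q=\infty$). For $s>\frac pu\sigma_p$ one has the continuous embedding $\mathcal{E}^s_{u,p,q}(\mathbb{R}^d)\hookrightarrow\mathcal{M}^u_p(\mathbb{R}^d)$, i.e. every $f\in\mathcal{E}^s_{u,p,q}(\mathbb{R}^d)$ is a regular distribution identified with a function in $\mathcal{M}^u_p(\mathbb{R}^d)$; $\|f\mid\mathcal{M}^u_p(\mathbb{R}^d)\|$ is the Morrey quasi-norm of that function. For $K\in\mathbb{Z}\cup\{\infty\}$ (with supremum over $k$ if $q=\infty$) $$|f|_K:=\Big\|\Big(\sum_{k=-K}^\infty2^{ksq}|\mathcal{F}^{-1}[\psi_k\mathcal{F}f](\cdot)|^q\Big)^{1/q}\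 \Big|\ \mathcal{M}^u_p(\mathbb{R}^d)\Big\|;$$ in particular for $K=-1$ the sum starts at $k=1$, and for $K=\infty$ it runs over all $k\in\mathbb{Z}$. *)

theory Defs
  imports "HOL-Analysis.Analysis"
begin

section \<open>Smooth functions, test functions, Schwartz functions\<close>

text \<open>Iterated partial derivative; the list holds the basis vectors along which one differentiates.\<close>
fun iter_deriv :: "'a list \<Rightarrow> ('a::euclidean_space \<Rightarrow> 'b::real_normed_vector) \<Rightarrow> 'a \<Rightarrow> 'b" where
  "iter_deriv [] f = f"
| "iter_deriv (b # bs) f = (\<lambda>x. frechet_derivative (iter_deriv bs f) (at x) b)"

definition smooth :: "('a::euclidean_space \<Rightarrow> 'b::real_normed_vector) \<Rightarrow> bool" where
  "smooth f \<longleftrightarrow> (\<forall>bs \<in> lists Basis. \<forall>x. iter_deriv bs f differentiable (at x))"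

definition test_fun :: "('a::euclidean_space \<Rightarrow> 'b::real_normed_vector) set" where
  "test_fun = {f. smooth f \<and> compact (closure {x. f x \<noteq> 0})}"

definition schwartz_weight :: "nat \<Rightarrow> ('a::euclidean_space \<Rightarrow> complex) \<Rightarrow> 'a \<Rightarrow> real" where
  "schwartz_weight N f x =
     (1 + norm x) ^ N * (\<Sum>bs | set bs \<subseteq> Basis \<and> length bs \<le> N. norm (iter_deriv bs f x))"

definition schwartz :: "('a::euclidean_space \<Rightarrow> complex) set" where
  "schwartz = {f. smooth f \<and> (\<forall>N. bdd_above (range (schwartz_weight N f)))}"

section \<open>Tempered distributions and the Fourier transform\<close>

text \<open>Distributions are functionals on all functions, but only their values on Schwartz
  functions matter.  Continuity is continuity for the family of seminorms
  \<open>SUP x. schwartz_weight N \<phi> x\<close>, which is increasing in \<open>N\<close>.\<close>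
definition tempered :: "(('a::euclidean_space \<Rightarrow> complex) \<Rightarrow> complex) set" where
  "tempered = {T.
     (\<forall>\<phi>\<in>schwartz. \<forall>\<theta>\<in>schwartz. T (\<lambda>x. \<phi> x + \<theta> x) = T \<phi> + T \<theta>) \<and>
     (\<forall>c. \<forall>\<phi>\<in>schwartz. T (\<lambda>x. c * \<phi> x) = c * T \<phi>) \<and>
     (\<exists>C N. \<forall>\<phi>\<in>schwartz. cmod (T \<phi>) \<le> C * (SUP x. schwartz_weight N \<phi> x))}"

definition fourier :: "('a::euclidean_space \<Rightarrow> complex) \<Rightarrow> 'a \<Rightarrow> complex" where
  "fourier f \<xi> = of_real ((2 * pi) powr (- real DIM('a) / 2)) *
     (LINT x|lborel. cis (- (x \<bullet> \<xi>)) * f x)"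

definition inv_fourier :: "('a::euclidean_space \<Rightarrow> complex) \<Rightarrow> 'a \<Rightarrow> complex" where
  "inv_fourier f x = of_real ((2 * pi) powr (- real DIM('a) / 2)) *
     (LINT \<xi>|lborel. cis (x \<bullet> \<xi>) * f \<xi>)"

definition fourier_dist ::
  "(('a::euclidean_space \<Rightarrow> complex) \<Rightarrow> complex) \<Rightarrow> ('a \<Rightarrow> complex) \<Rightarrow> complex" where
  "fourier_dist T \<phi> = T (fourier \<phi>)"

definition inv_fourier_dist ::
  "(('a::euclidean_space \<Rightarrow> complex) \<Rightarrow> complex) \<Rightarrow> ('a \<Rightarrow> complex) \<Rightarrow> complex" where
  "inv_fourier_dist T \<phi> = T (inv_fourier \<phi>)"

definition mult_dist ::
  "('a::euclidean_space \<Rightarrow> real) \<Rightarrow> (('a \<Rightarrow> complex) \<Rightarrow> complex) \<Rightarrow> ('a \<Rightarrow> complex) \<Rightarrow> complex" where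
  "mult_dist \<eta> T \<phi> = T (\<lambda>x. of_real (\<eta> x) * \<phi> x)"

text \<open>\<open>T\<close> is the regular distribution generated by the locally integrable function \<open>g\<close>.\<close>
definition represents ::
  "('a::euclidean_space \<Rightarrow> complex) \<Rightarrow> (('a \<Rightarrow> complex) \<Rightarrow> complex) \<Rightarrow> bool" where
  "represents g T \<longleftrightarrow> (\<forall>C. compact C \<longrightarrow> set_integrable lebesgue C g) \<and>
     (\<forall>\<phi>\<in>test_fun. T \<phi> = (LINT x|lebesgue. g x * \<phi> x))"

text \<open>The function identified with a regular distribution (unique up to null sets).\<close>
definition fun_of_dist :: "(('a::euclidean_space \<Rightarrow> complex) \<Rightarrow> complex) \<Rightarrow> 'a \<Rightarrow> complex" where
  "fun_of_dist T = (SOME g. represents g T)"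

text \<open>The smooth function identified with the inverse Fourier transform of \<open>\<eta>\<close> times
  the Fourier transform of \<open>f\<close>.\<close>
definition fourier_mult ::
  "('a::euclidean_space \<Rightarrow> real) \<Rightarrow> (('a \<Rightarrow> complex) \<Rightarrow> complex) \<Rightarrow> 'a \<Rightarrow> complex" where
  "fourier_mult \<eta> f =
     (THE g. smooth g \<and> represents g (inv_fourier_dist (mult_dist \<eta> (fourier_dist f))))"

section \<open>Morrey quasi-norms\<close>

text \<open>Only used for \<open>r > 0\<close>.\<close>
definition ennreal_powr :: "ennreal \<Rightarrow> real \<Rightarrow> ennreal" where
  "ennreal_powr x r = (if x = top then top else ennreal (enn2real x powr r))"

text \<open>The Morrey quasi-norm of a function with values in \<open>[0, \<infinity>]\<close>; a complex function
  enters through its modulus.\<close>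
definition morrey_norm :: "real \<Rightarrow> real \<Rightarrow> ('a::euclidean_space \<Rightarrow> ennreal) \<Rightarrow> ennreal" where
  "morrey_norm u p g =
     (SUP y. SUP R\<in>{0<..}. ennreal (measure lebesgue (ball y R) powr (1 / u - 1 / p)) *
        ennreal_powr (\<integral>\<^sup>+ x\<in>ball y R. ennreal_powr (g x) p \<partial>lebesgue) (1 / p))"

definition morrey_norm_dist ::
  "real \<Rightarrow> real \<Rightarrow> (('a::euclidean_space \<Rightarrow> complex) \<Rightarrow> complex) \<Rightarrow> ennreal" where
  "morrey_norm_dist u p f = morrey_norm u p (\<lambda>x. ennreal (cmod (fun_of_dist f x)))"

section \<open>Triebel-Lizorkin-Morrey quasi-norms\<close>

definition sigma_idx :: "nat \<Rightarrow> real \<Rightarrow> real" where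
  "sigma_idx d p = real d * max 0 (1 / p - 1)"

definition psi :: "('a::euclidean_space \<Rightarrow> real) \<Rightarrow> int \<Rightarrow> 'a \<Rightarrow> real" where
  "psi \<phi>\<^sub>0 k x = (let \<psi> = (\<lambda>y. \<phi>\<^sub>0 y - \<phi>\<^sub>0 (2 *\<^sub>R y)) in \<psi> ((2 powi (- k)) *\<^sub>R x))"

definition phi :: "('a::euclidean_space \<Rightarrow> real) \<Rightarrow> int \<Rightarrow> 'a \<Rightarrow> real" where
  "phi \<phi>\<^sub>0 k = (if k = 0 then \<phi>\<^sub>0 else psi \<phi>\<^sub>0 k)"

definition weighted_lq :: "real \<Rightarrow> ereal \<Rightarrow> int set \<Rightarrow> (int \<Rightarrow> complex) \<Rightarrow> ennreal" where
  "weighted_lq s q I c =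
     (if q = \<infinity> then SUP k\<in>I. ennreal (2 powr (of_int k * s) * cmod (c k))
      else ennreal_powr
        (\<Sum>\<^sub>\<infinity>k\<in>I. ennreal (2 powr (of_int k * s * real_of_ereal q) * cmod (c k) powr real_of_ereal q))
        (1 / real_of_ereal q))"

definition tlm_norm :: "('a::euclidean_space \<Rightarrow> real) \<Rightarrow> real \<Rightarrow> real \<Rightarrow> real \<Rightarrow> ereal \<Rightarrow>
    (('a \<Rightarrow> complex) \<Rightarrow> complex) \<Rightarrow> ennreal" where
  "tlm_norm \<phi>\<^sub>0 s u p q f =
     morrey_norm u p (\<lambda>x. weighted_lq s q {0..} (\<lambda>k. fourier_mult (phi \<phi>\<^sub>0 k) f x))"

definition tlm_space :: "('a::euclidean_space \<Rightarrow> real) \<Rightarrow> real \<Rightarrow> real \<Rightarrow> real \<Rightarrow> ereal \<Rightarrow>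
    (('a \<Rightarrow> complex) \<Rightarrow> complex) set" where
  "tlm_space \<phi>\<^sub>0 s u p q = {f \<in> tempered. tlm_norm \<phi>\<^sub>0 s u p q f < \<infinity>}"

text \<open>\<open>|f|\<^sub>K\<close>; the parameter \<open>K\<close> is an integer or \<open>\<infinity>\<close>.\<close>
definition tlm_seminorm :: "('a::euclidean_space \<Rightarrow> real) \<Rightarrow> real \<Rightarrow> real \<Rightarrow> real \<Rightarrow> ereal \<Rightarrow>
    ereal \<Rightarrow> (('a \<Rightarrow> complex) \<Rightarrow> complex) \<Rightarrow> ennreal" where
  "tlm_seminorm \<phi>\<^sub>0 s u p q K f = morrey_norm u p
     (\<lambda>x. weighted_lq s q {k. - K \<le> ereal (of_int k)} (\<lambda>k. fourier_mult (psi \<phi>\<^sub>0 k) f x))"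

definition tlm_norm_spade :: "('a::euclidean_space \<Rightarrow> real) \<Rightarrow> real \<Rightarrow> real \<Rightarrow> real \<Rightarrow> ereal \<Rightarrow>
    ereal \<Rightarrow> (('a \<Rightarrow> complex) \<Rightarrow> complex) \<Rightarrow> ennreal" where
  "tlm_norm_spade \<phi>\<^sub>0 s u p q K f = morrey_norm_dist u p f + tlm_seminorm \<phi>\<^sub>0 s u p q K f"

end

theory Submission
  imports Defs "HOL-Probability.Probability" "HOL-Library.Nat_Bijection"
begin

text \<open>For a symbol \<open>\<eta>\<close> in the class of test functions, \<open>\<F>\<^sup>-\<^sup>1[\<eta> \<F> f](x)\<close> is \<open>f\<close> applied to a translate of a fixed
  Schwartz kernel. With \<open>f\<^sub>k = \<F>\<^sup>-\<^sup>1[\<phi>\<^sub>k \<F> f]\<close> the sum of the \<open>f\<^sub>k\<close> converges to \<open>f\<close>, almost everywhere and as a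
  distribution: for \<open>p \<ge> 1\<close> since \<open>s > 0\<close>, and for \<open>p < 1\<close> by Nikolskij's inequality and
  \<open>s > d (1 - p) / u\<close>. Hence \<open>\<bar>f\<bar> \<le> \<Sum> \<bar>f\<^sub>k\<bar>\<close> and \<open>\<bar>f\<^sub>0\<bar> \<le> \<bar>f\<bar> + \<Sum>\<^sub>k\<^sub>\<ge>\<^sub>1 \<bar>f\<^sub>k\<bar>\<close>, where by \<open>s > 0\<close> the sums are
  bounded by the weighted \<open>\<ell>\<^sub>q\<close> norms; this compares \<open>f\<close> with \<open>f\<^sub>0\<close> pointwise. The pieces with
  \<open>k \<le> 0\<close> are convolutions of \<open>f\<^sub>0 + f\<^sub>1\<close> with kernels dilated by \<open>2\<^sup>k\<close>. By Jensen's inequality for \<open>p \<ge> 1\<close>, and by a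
  Plancherel-Polya argument for \<open>p < 1\<close>, their Morrey norms are at most a constant times \<open>2\<^sup>-\<^sup>k\<^sup>\<sigma>\<close>
  with \<open>\<sigma> = \<sigma>\<^sub>p\<close>, which is summable against \<open>2\<^sup>k\<^sup>s\<close> over all \<open>k \<le> 0\<close> as soon as \<open>s > \<sigma>\<^sub>p\<close>.\<close>

text \<open>Both \<open>fun_of_dist\<close> and \<open>fourier_mult\<close> select a function by a
  choice operator, so uniqueness of representing functions has to be settled before any norm can be
  computed. For \<open>p < 1\<close> the Morrey bound controls only \<open>p\<close>-th powers,
  hence local integrability of the limit must itself be derived. The obstacle there is that an
  average cannot be moved past the power \<open>p\<close>. Band limitation removes it: the product
  \<open>F\<close> of kernel and piece satisfies \<open>|F| <= S * I\<close> with \<open>I\<close>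
  the integral of \<open>|F|\<close>, so \<open>I <= (S * I) powr (1 - p)\<close> times the integral
  of \<open>|F| powr p\<close>, and the finite \<open>I\<close> can be divided out. The low pieces
  are estimated singly in exponent \<open>p\<close> and added in \<open>p\<close>-th powers; passing
  from \<open>q\<close> to \<open>p\<close> costs an arbitrarily small loss \<open>s' < s\<close>.
  For a fixed \<open>K\<close> only finitely many nonpositive indices occur and any
  \<open>s' < s\<close> will do. For all \<open>K\<close> at once \<open>s'\<close> must still
  exceed \<sigma>, which is where the strict inequality is spent.\<close>

abbreviation pd :: "'a \<Rightarrow> ('a::euclidean_space \<Rightarrow> 'b::real_normed_vector) \<Rightarrow> 'a \<Rightarrow> 'b" where
  "pd b f \<equiv> \<lambda>x. frechet_derivative f (at x) b"

section \<open>Calculus of smooth functions\<close>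

lemma iter_deriv_append: "iter_deriv (bs @ cs) f = iter_deriv bs (iter_deriv cs f)"
  by (induction bs) auto

lemma iter_deriv_closed:
  assumes "h \<in> P" "\<And>h b. h \<in> P \<Longrightarrow> b \<in> Basis \<Longrightarrow> pd b h \<in> P" "set bs \<subseteq> Basis"
  shows "iter_deriv bs h \<in> P"
  using assms(3) by (induction bs) (auto intro: assms)

text \<open>Smoothness is the largest property that implies differentiability and is stable under
  partial derivatives. A set \<open>P\<close> of the right shape therefore replaces explicit
  formulas for higher derivatives.\<close>

lemma smooth_coinduct:
  assumes "h \<in> P" "\<And>h x. h \<in> P \<Longrightarrow> h differentiable (at x)"
    "\<And>h b. h \<in> P \<Longrightarrow> b \<in> Basis \<Longrightarrow> pd b h \<in> P"
  shows "smooth h"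
  unfolding smooth_def using iter_deriv_closed[of h P] assms by (auto simp: lists_eq_set)

lemma smooth_iter_differentiable:
  "smooth f \<Longrightarrow> set bs \<subseteq> Basis \<Longrightarrow> iter_deriv bs f differentiable (at x)"
  by (auto simp: smooth_def lists_eq_set)

lemma smooth_differentiable: "smooth f \<Longrightarrow> f differentiable (at x)"
  using smooth_iter_differentiable[of f "[]"] by simp

lemma smooth_has_derivative: "smooth f \<Longrightarrow> (f has_derivative frechet_derivative f (at x)) (at x)"
  using frechet_derivative_works smooth_differentiable by blast

lemma smooth_isCont: "smooth f \<Longrightarrow> isCont f x"
  by (simp add: differentiable_imp_continuous_within smooth_differentiable)

lemma smooth_continuous_on: "smooth f \<Longrightarrow> continuous_on S f"
  by (simp add: continuous_at_imp_continuous_on smooth_isCont)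

lemma smooth_iter_deriv: "smooth f \<Longrightarrow> set bs \<subseteq> Basis \<Longrightarrow> smooth (iter_deriv bs f)"
  by (auto simp: smooth_def lists_eq_set simp flip: iter_deriv_append)

lemma smooth_pd: "smooth f \<Longrightarrow> b \<in> Basis \<Longrightarrow> smooth (pd b f)"
  using smooth_iter_deriv[of f "[b]"] by simp

lemma pd_eqI: "(\<And>x. (f has_derivative f' x) (at x)) \<Longrightarrow> pd b f = (\<lambda>x. f' x b)"
  by (metis frechet_derivative_at)

lemma smooth_const [simp]: "smooth (\<lambda>x. c)"
  by (rule smooth_coinduct[where P="range (\<lambda>c x. c)"]) auto

lemma smooth_bounded_linear: "bounded_linear L \<Longrightarrow> smooth L"
proof (rule smooth_coinduct[where P="insert L (range (\<lambda>c x. c))"], goal_cases)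
  case (2 h x)
  then show ?case by (auto intro: bounded_linear_imp_differentiable)
next
  case (3 h b)
  then show ?case by (auto simp: pd_eqI[OF bounded_linear_imp_has_derivative])
qed auto

lemma smooth_compose_linear:
  assumes "bounded_linear L" "smooth f"
  shows "smooth (\<lambda>x. L (f x))"
proof (rule smooth_coinduct[where P="{\<lambda>x. L (f x) |f. smooth f}"], goal_cases)
  case (2 h x)
  then show ?case
    by (auto simp: differentiable_def dest: smooth_has_derivative intro: bounded_linear.has_derivative[OF assms(1)])
next
  case (3 h b)
  then obtain f where f: "h = (\<lambda>x. L (f x))" "smooth f" by auto
  have "pd b h = (\<lambda>x. L (pd b f x))"
    unfolding f by (rule pd_eqI[OF bounded_linear.has_derivative[OF assms(1) smooth_has_derivative[OF f(2)]]])
  then show ?case using f 3 smooth_pd by (intro CollectI exI[of _ "pd b f"]) auto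
qed (use assms in auto)

lemma pd_affine:
  assumes "smooth f"
  shows "pd b (\<lambda>x. f (r *\<^sub>R x + a)) = (\<lambda>x. r *\<^sub>R pd b f (r *\<^sub>R x + a))"
proof -
  have "((\<lambda>x. f (r *\<^sub>R x + a)) has_derivative (\<lambda>h. frechet_derivative f (at (r *\<^sub>R x + a)) (r *\<^sub>R h))) (at x)" for x
    by (rule has_derivative_compose[OF _ smooth_has_derivative[OF assms]]) (auto intro!: derivative_eq_intros)
  moreover have "linear (frechet_derivative f (at x))" for x
    using linear_frechet_derivative smooth_differentiable[OF assms] by blast
  ultimately show ?thesis
    by (subst pd_eqI) (auto simp: linear_cmul)
qed

lemma smooth_affine:
  assumes "smooth f"
  shows "smooth (\<lambda>x. f (r *\<^sub>R x + a))"
\<comment> \<open>Every derivative of an affine substitution contributes a factor \<open>r\<close>,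
  so the invariant set has to allow a scalar \<open>c\<close> in front.\<close>
proof (rule smooth_coinduct[where P="{\<lambda>x. c *\<^sub>R f (r *\<^sub>R x + a) |c f. smooth f}"], goal_cases)
  case 1
  then show ?case using assms by (auto intro!: exI[of _ 1])
next
  case (2 h x)
  then obtain c f where f: "h = (\<lambda>x. c *\<^sub>R f (r *\<^sub>R x + a))" "smooth f" by auto
  have "(\<lambda>x. f (r *\<^sub>R x + a)) differentiable (at x)"
    by (rule differentiable_compose[of f]) (auto intro: smooth_differentiable f)
  then show ?case unfolding f by (intro differentiable_scaleR) auto
next
  case (3 h b)
  then obtain c f where f: "h = (\<lambda>x. c *\<^sub>R f (r *\<^sub>R x + a))" "smooth f" by auto
  have d: "(\<lambda>x. f (r *\<^sub>R x + a)) differentiable (at x)" for x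
    by (rule differentiable_compose[of f]) (auto intro: smooth_differentiable f)
  have "pd b h = (\<lambda>x. c *\<^sub>R pd b (\<lambda>x. f (r *\<^sub>R x + a)) x)"
    unfolding f by (rule pd_eqI, rule has_derivative_scaleR_right) (use d frechet_derivative_works in blast)
  also have "\<dots> = (\<lambda>x. (c * r) *\<^sub>R pd b f (r *\<^sub>R x + a))"
    using fun_cong[OF pd_affine[OF f(2)]] by simp
  finally show ?case using smooth_pd[OF f(2) 3(2)] by (intro CollectI exI[of _ "c * r"] exI[of _ "pd b f"]) auto
qed

lemma pd_add: "smooth f \<Longrightarrow> smooth g \<Longrightarrow> pd b (\<lambda>x. f x + g x) = (\<lambda>x. pd b f x + pd b g x)"
  by (intro pd_eqI derivative_intros smooth_has_derivative)

lemma pd_cmult: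
  fixes f :: "_ \<Rightarrow> complex"
  shows "smooth f \<Longrightarrow> pd b (\<lambda>x. c * f x) = (\<lambda>x. c * pd b f x)"
  by (intro pd_eqI has_derivative_mult_right smooth_has_derivative)

lemma pd_mult:
  fixes f :: "_ \<Rightarrow> complex"
  shows "smooth f \<Longrightarrow> smooth g \<Longrightarrow> pd b (\<lambda>x. f x * g x) = (\<lambda>x. f x * pd b g x + pd b f x * g x)"
  by (rule pd_eqI) (rule has_derivative_mult[OF smooth_has_derivative smooth_has_derivative])

lemma smooth_add:
  assumes "smooth f" "smooth g"
  shows "smooth (\<lambda>x. f x + g x)"
proof (rule smooth_coinduct[where P="{\<lambda>x. f x + g x |f g. smooth f \<and> smooth g}"], goal_cases)
  case (2 h x)
  then show ?case using differentiable_add smooth_differentiable by blast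
next
  case (3 h b)
  then obtain f g where "h = (\<lambda>x. f x + g x)" "smooth f" "smooth g" by auto
  then show ?case using pd_add[of f g b] smooth_pd 3
    by (intro CollectI exI[of _ "pd b f"] exI[of _ "pd b g"]) auto
qed (use assms in auto)

text \<open>The Leibniz rule turns a product into a sum of two products. Products alone are not
  stable under differentiation, but their closure under addition is, which makes it the invariant
  set for the smoothness of products.\<close>

inductive_set prodspan :: "('a::euclidean_space \<Rightarrow> complex) set" where
  prod: "smooth f \<Longrightarrow> smooth g \<Longrightarrow> (\<lambda>x. f x * g x) \<in> prodspan"
| add: "f \<in> prodspan \<Longrightarrow> g \<in> prodspan \<Longrightarrow> (\<lambda>x. f x + g x) \<in> prodspan"

lemma prodspan_differentiable: "f \<in> prodspan \<Longrightarrow> f differentiable (at x)"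
  by (induction rule: prodspan.induct)
    (auto intro: differentiable_add differentiable_mult[OF smooth_differentiable smooth_differentiable])

lemma prodspan_pd: "f \<in> prodspan \<Longrightarrow> b \<in> Basis \<Longrightarrow> pd b f \<in> prodspan"
proof (induction rule: prodspan.induct)
  case (prod f g)
  then show ?case by (simp add: pd_mult prodspan.intros smooth_pd)
next
  case (add f g)
  have "pd b (\<lambda>x. f x + g x) = (\<lambda>x. pd b f x + pd b g x)"
    using add by (intro pd_eqI derivative_intros) (use prodspan_differentiable frechet_derivative_works in blast)+
  then show ?case using add prodspan.add by auto
qed

lemma smooth_mult:
  fixes f :: "'a::euclidean_space \<Rightarrow> complex"
  assumes "smooth f" "smooth g"
  shows "smooth (\<lambda>x. f x * g x)"
  using smooth_coinduct[of _ prodspan] prodspan.prod[OF assms] prodspan_differentiable prodspan_pd by blast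

lemma smooth_cmult:
  fixes f :: "'a::euclidean_space \<Rightarrow> complex"
  shows "smooth f \<Longrightarrow> smooth (\<lambda>x. c * f x)"
  by (rule smooth_mult) auto

lemma iter_deriv_add:
  assumes "smooth f" "smooth g" "set bs \<subseteq> Basis"
  shows "iter_deriv bs (\<lambda>x. f x + g x) = (\<lambda>x. iter_deriv bs f x + iter_deriv bs g x)"
  using assms(3) by (induction bs) (use assms in \<open>auto simp: pd_add smooth_iter_deriv\<close>)

lemma iter_deriv_cmult:
  fixes f :: "'a::euclidean_space \<Rightarrow> complex"
  assumes "smooth f" "set bs \<subseteq> Basis"
  shows "iter_deriv bs (\<lambda>x. c * f x) = (\<lambda>x. c * iter_deriv bs f x)"
  using assms(2) by (induction bs) (use assms in \<open>auto simp: pd_cmult smooth_iter_deriv\<close>)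

lemma iter_deriv_diff:
  fixes f :: "'a::euclidean_space \<Rightarrow> complex"
  assumes "smooth f" "smooth g" "set bs \<subseteq> Basis"
  shows "iter_deriv bs (\<lambda>x. f x - g x) = (\<lambda>x. iter_deriv bs f x - iter_deriv bs g x)"
  using iter_deriv_add[of f "\<lambda>x. -1 * g x" bs] iter_deriv_cmult[of g bs "-1"] smooth_cmult[of g "-1"] assms by simp

lemma smooth_sum:
  fixes f :: "'i \<Rightarrow> 'a::euclidean_space \<Rightarrow> complex"
  assumes "finite I" "\<And>i. i \<in> I \<Longrightarrow> smooth (f i)"
  shows "smooth (\<lambda>x. \<Sum>i\<in>I. f i x)"
  using assms by (induction I rule: finite_induct) (auto intro: smooth_add)

lemma iter_deriv_sum:
  fixes f :: "'i \<Rightarrow> 'a::euclidean_space \<Rightarrow> complex"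
  assumes "finite I" "\<And>i. i \<in> I \<Longrightarrow> smooth (f i)" "set bs \<subseteq> Basis"
  shows "iter_deriv bs (\<lambda>x. \<Sum>i\<in>I. f i x) = (\<lambda>x. \<Sum>i\<in>I. iter_deriv bs (f i) x)"
  using assms
proof (induction I rule: finite_induct)
  case empty
  have "iter_deriv bs (\<lambda>x::'a. 0::complex) = (\<lambda>x. 0)"
    by (induction bs) auto
  then show ?case by simp
qed (simp add: iter_deriv_add smooth_sum)

lemma iter_deriv_translate:
  assumes "smooth f" "set bs \<subseteq> Basis"
  shows "iter_deriv bs (\<lambda>x. f (x - a)) = (\<lambda>x. iter_deriv bs f (x - a))"
  using assms(2)
proof (induction bs)
  case (Cons b bs)
  then show ?case
    using pd_affine[OF smooth_iter_deriv[OF assms(1), of bs], where b=b and r=1 and a="-a"] by simp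
qed auto

lemma smooth_translate: "smooth f \<Longrightarrow> smooth (\<lambda>x. f (x - a))"
  using smooth_affine[of f 1 "-a"] by simp

section \<open>Schwartz functions\<close>

lemma finite_multi: "finite {bs :: 'a::euclidean_space list. set bs \<subseteq> Basis \<and> length bs \<le> N}"
  by (rule finite_lists_length_le) simp

lemma schwartzI:
  assumes "smooth f" "\<And>N bs. set bs \<subseteq> Basis \<Longrightarrow> \<exists>C. \<forall>x. (1 + norm x) ^ N * norm (iter_deriv bs f x) \<le> C"
  shows "f \<in> schwartz"
  unfolding schwartz_def
proof (intro CollectI conjI allI assms)
  fix N
  obtain C where C: "\<And>bs x. set bs \<subseteq> Basis \<Longrightarrow> (1 + norm x) ^ N * norm (iter_deriv bs f x) \<le> C bs"
    using assms(2)[of _ N] by metis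
  have "schwartz_weight N f x \<le> (\<Sum>bs | set bs \<subseteq> Basis \<and> length bs \<le> N. C bs)" for x
    unfolding schwartz_weight_def sum_distrib_left by (rule sum_mono) (use C in auto)
  then show "bdd_above (range (schwartz_weight N f))" by (auto intro!: bdd_aboveI)
qed

lemma schwartz_smooth: "f \<in> schwartz \<Longrightarrow> smooth f"
  by (auto simp: schwartz_def)

lemma schwartzD:
  assumes "f \<in> schwartz" "set bs \<subseteq> Basis"
  obtains C where "C > 0" "\<And>x. (1 + norm x) ^ N * norm (iter_deriv bs f x) \<le> C"
proof -
  define M where "M = max N (length bs)"
  obtain C where C: "\<And>x. schwartz_weight M f x \<le> C"
    using assms(1) unfolding schwartz_def bdd_above_def by fast
  have "(1 + norm x) ^ N * norm (iter_deriv bs f x) \<le> C" for x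
  proof -
    have "(1 + norm x) ^ N * norm (iter_deriv bs f x) \<le> (1 + norm x) ^ M * norm (iter_deriv bs f x)"
      by (intro mult_right_mono power_increasing) (auto simp: M_def)
    also have "\<dots> \<le> schwartz_weight M f x"
      unfolding schwartz_weight_def
      by (intro mult_left_mono member_le_sum finite_multi) (use assms in \<open>auto simp: M_def\<close>)
    finally show ?thesis using C[of x] by simp
  qed
  then have "(1 + norm x) ^ N * norm (iter_deriv bs f x) \<le> max C 1" for x
    by (meson max.coboundedI1)
  then show ?thesis using that[of "max C 1"] by simp
qed

lemma schwartz_rapid:
  assumes "f \<in> schwartz"
  obtains C where "C > 0" "\<And>x. (1 + norm x) ^ N * norm (f x) \<le> C"
  using schwartzD[OF assms, of "[]"] by auto

lemma schwartz_iter_deriv: "f \<in> schwartz \<Longrightarrow> set bs \<subseteq> Basis \<Longrightarrow> iter_deriv bs f \<in> schwartz"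
proof (rule schwartzI, goal_cases)
  case (2 N cs)
  then show ?case using schwartzD[of f "cs @ bs" N] by (metis iter_deriv_append set_append Un_subset_iff)
qed (auto simp: smooth_iter_deriv schwartz_smooth)

lemma schwartz_pd: "f \<in> schwartz \<Longrightarrow> b \<in> Basis \<Longrightarrow> pd b f \<in> schwartz"
  using schwartz_iter_deriv[of f "[b]"] by simp

lemma schwartz_cmult: "f \<in> schwartz \<Longrightarrow> (\<lambda>x. c * f x) \<in> schwartz"
proof (rule schwartzI, goal_cases)
  case (2 N bs)
  then obtain C where "\<And>x. (1 + norm x) ^ N * norm (iter_deriv bs f x) \<le> C" using schwartzD by metis
  then have "(1 + norm x) ^ N * norm (iter_deriv bs (\<lambda>x. c * f x) x) \<le> norm c * C" for x
    using 2 by (simp add: iter_deriv_cmult schwartz_smooth norm_mult mult.left_commute mult_left_mono)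
  then show ?case by blast
qed (auto simp: smooth_cmult schwartz_smooth)

lemma schwartz_add:
  assumes "f \<in> schwartz" "g \<in> schwartz"
  shows "(\<lambda>x. f x + g x) \<in> schwartz"
proof (rule schwartzI, goal_cases)
  case (2 N bs)
  obtain C where C: "\<And>x. (1 + norm x) ^ N * norm (iter_deriv bs f x) \<le> C"
    using assms 2 schwartzD by metis
  obtain D where D: "\<And>x. (1 + norm x) ^ N * norm (iter_deriv bs g x) \<le> D"
    using assms 2 schwartzD by metis
  have "(1 + norm x) ^ N * norm (iter_deriv bs (\<lambda>x. f x + g x) x) \<le> C + D" for x
  proof -
    have "(1 + norm x) ^ N * norm (iter_deriv bs (\<lambda>x. f x + g x) x) \<le>
      (1 + norm x) ^ N * (norm (iter_deriv bs f x) + norm (iter_deriv bs g x))"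
      using assms 2 by (intro mult_left_mono) (auto simp: iter_deriv_add schwartz_smooth norm_triangle_ineq)
    then show ?thesis using C[of x] D[of x] by (simp add: distrib_left)
  qed
  then show ?case by blast
qed (use assms in \<open>auto simp: smooth_add schwartz_smooth\<close>)

lemma schwartz_diff: "f \<in> schwartz \<Longrightarrow> g \<in> schwartz \<Longrightarrow> (\<lambda>x. f x - g x) \<in> schwartz"
  using schwartz_add[of f "\<lambda>x. -1 * g x"] schwartz_cmult[of g "-1"] by simp

lemma schwartz_zero [simp]: "(\<lambda>x. 0) \<in> schwartz"
proof (rule schwartzI)
  fix N and bs :: "'a list"
  have "iter_deriv bs (\<lambda>x::'a. 0::complex) = (\<lambda>x. 0)"
    by (induction bs) auto
  then show "\<exists>C. \<forall>x. (1 + norm x) ^ N * norm (iter_deriv bs (\<lambda>x::'a. 0::complex) x) \<le> C" by auto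
qed auto

lemma schwartz_sum:
  assumes "finite I" "\<And>i. i \<in> I \<Longrightarrow> f i \<in> schwartz"
  shows "(\<lambda>x. \<Sum>i\<in>I. f i x) \<in> schwartz"
  using assms by (induction I rule: finite_induct) (auto intro: schwartz_add)

text \<open>The elementary form of Peetre's inequality, by which polynomial weights are moved from
  one argument of a convolution to the other.\<close>

lemma one_plus_norm_add: "1 + norm (x + y) \<le> (1 + norm x) * (1 + norm (y::'a::real_normed_vector))"
proof -
  have "norm (x + y) \<le> norm x + norm y" "0 \<le> norm x * norm y"
    by (rule norm_triangle_ineq) simp
  then show ?thesis unfolding distrib_left distrib_right by linarith
qed

lemma one_plus_norm_power_add:
  "(1 + norm (x + y)) ^ N \<le> (1 + norm x) ^ N * (1 + norm (y::'a::real_normed_vector)) ^ N"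
  unfolding power_mult_distrib[symmetric] by (intro power_mono one_plus_norm_add) auto

lemma schwartz_translate: "f \<in> schwartz \<Longrightarrow> (\<lambda>x. f (x - a)) \<in> schwartz"
proof (rule schwartzI, goal_cases)
  case (2 N bs)
  then obtain C where C: "C > 0" "\<And>x. (1 + norm x) ^ N * norm (iter_deriv bs f x) \<le> C" using schwartzD by metis
  have "(1 + norm x) ^ N * norm (iter_deriv bs (\<lambda>x. f (x - a)) x) \<le> (1 + norm a) ^ N * C" for x
  proof -
    have "(1 + norm x) ^ N * norm (iter_deriv bs f (x - a)) \<le>
        ((1 + norm a) ^ N * (1 + norm (x - a)) ^ N) * norm (iter_deriv bs f (x - a))"
      using one_plus_norm_power_add[of a "x - a" N] by (intro mult_right_mono) auto
    also have "\<dots> \<le> (1 + norm a) ^ N * C"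
      unfolding mult.assoc by (intro mult_left_mono C) auto
    finally show ?thesis using 2 by (simp add: iter_deriv_translate schwartz_smooth)
  qed
  then show ?case by blast
qed (auto simp: smooth_translate schwartz_smooth)

lemma linear_basis_expansion:
  fixes L :: "'a::euclidean_space \<Rightarrow> 'b::real_normed_vector"
  assumes "linear L"
  shows "L h = (\<Sum>b\<in>Basis. (h \<bullet> b) *\<^sub>R L b)"
  using linear_componentwise assms by (metis (no_types, lifting) euclidean_representation linear_cmul linear_sum sum.cong)

text \<open>The mean value inequality on the unit ball about \<open>x\<close>. There
  \<open>1 + norm x <= 2 * (1 + norm y)\<close>, so the decay of the partial derivatives at
  \<open>y\<close> is inherited at \<open>x\<close> up to the factor \<open>2 ^ N\<close>.\<close>

lemma schwartz_lipschitz: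
  assumes "k \<in> schwartz"
  obtains C where "C > 0"
    "\<And>x h. norm h \<le> 1 \<Longrightarrow> (1 + norm x) ^ N * norm (k (x + h) - k x) \<le> C * norm h"
proof -
  obtain C where C: "\<And>b x. b \<in> Basis \<Longrightarrow> (1 + norm x) ^ N * norm (pd b k x) \<le> C b" "\<And>b. C b > 0"
  proof -
    have "\<exists>C>0. b \<in> Basis \<longrightarrow> (\<forall>x. (1 + norm x) ^ N * norm (pd b k x) \<le> C)" for b
    proof (cases "b \<in> Basis")
      case True
      then show ?thesis using schwartzD[OF assms, of "[b]" N] by (simp) metis
    qed (auto intro: exI[of _ 1])
    then show ?thesis using that by metis
  qed
  define C' where "C' = (\<Sum>b\<in>Basis. C b)"
  have C'pos: "C' > 0" unfolding C'_def by (rule sum_pos) (auto simp: C)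
  have "(1 + norm x) ^ N * norm (k (x + h) - k x) \<le> (2 ^ N * C') * norm h" if h: "norm h \<le> 1" for x h
  proof -
    have der: "(k has_derivative frechet_derivative k (at y)) (at y within cball x 1)" for y
      using smooth_has_derivative[OF schwartz_smooth[OF assms]] has_derivative_at_withinI by blast
    have on: "onorm (frechet_derivative k (at y)) \<le> 2 ^ N * C' / (1 + norm x) ^ N" if "y \<in> cball x 1" for y
    proof -
      have "norm x \<le> norm y + 1"
        using that norm_triangle_sub[of x y] by (auto simp: dist_norm)
      then have "1 + norm x \<le> 2 * (1 + norm y)" using norm_ge_zero[of y] by argo
      then have le: "(1 + norm x) ^ N \<le> 2 ^ N * (1 + norm y) ^ N"
        unfolding power_mult_distrib[symmetric] by (intro power_mono) auto
      have "onorm (frechet_derivative k (at y)) \<le> (\<Sum>b\<in>Basis. norm (pd b k y))"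
        by (rule onorm_componentwise) (use der has_derivative_bounded_linear in blast)
      then have "(1 + norm x) ^ N * onorm (frechet_derivative k (at y)) \<le>
          (2 ^ N * (1 + norm y) ^ N) * (\<Sum>b\<in>Basis. norm (pd b k y))"
        by (intro mult_mono le onorm_pos_le) (use der has_derivative_bounded_linear in auto)
      also have "\<dots> = 2 ^ N * (\<Sum>b\<in>Basis. (1 + norm y) ^ N * norm (pd b k y))"
        by (simp add: sum_distrib_left mult.assoc)
      also have "\<dots> \<le> 2 ^ N * C'"
        unfolding C'_def by (intro mult_left_mono sum_mono C) auto
      finally show ?thesis by (simp add: pos_le_divide_eq add_pos_nonneg mult.commute)
    qed
    have "norm (k (x + h) - k x) \<le> 2 ^ N * C' / (1 + norm x) ^ N * norm (x + h - x)"
      by (rule differentiable_bound[OF _ der on]) (use h in \<open>auto simp: dist_norm\<close>)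
    then have "norm (k (x + h) - k x) \<le> (2 ^ N * C' * norm h) / (1 + norm x) ^ N" by simp
    then show ?thesis by (simp only: pos_le_divide_eq add_pos_nonneg zero_less_power zero_less_one norm_ge_zero mult.commute)
  qed
  moreover have "2 ^ N * C' > 0" using C'pos by simp
  ultimately show ?thesis using that by blast
qed

text \<open>The mean value inequality applied to \<open>k\<close> minus its linearisation at
  \<open>x\<close>; the derivative of this difference at \<open>y\<close> is
  \<open>k'(y) - k'(x)\<close>, which is small by the Lipschitz bound for each partial derivative.
  The decaying quadratic remainder serves as majorant for differentiation under the
  integral.\<close>

lemma schwartz_taylor:
  assumes "k \<in> schwartz"
  obtains C where "C > 0"
    "\<And>x h. norm h \<le> 1 \<Longrightarrow>
      (1 + norm x) ^ N * norm (k (x + h) - k x - frechet_derivative k (at x) h) \<le> C * (norm h)\<^sup>2"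
proof -
  obtain C where C: "\<And>b x h. b \<in> Basis \<Longrightarrow> norm h \<le> 1 \<Longrightarrow>
      (1 + norm x) ^ N * norm (pd b k (x + h) - pd b k x) \<le> C b * norm h" "\<And>b. C b > 0"
  proof -
    have "\<exists>C>0. b \<in> Basis \<longrightarrow> (\<forall>x h. norm h \<le> 1 \<longrightarrow>
      (1 + norm x) ^ N * norm (pd b k (x + h) - pd b k x) \<le> C * norm h)" for b
    proof (cases "b \<in> Basis")
      case True
      then show ?thesis using schwartz_lipschitz[OF schwartz_pd[OF assms True], of N] by metis
    qed (auto intro: exI[of _ 1])
    then show ?thesis using that by metis
  qed
  define C' where "C' = (\<Sum>b\<in>Basis. C b)"
  have C'pos: "C' > 0" unfolding C'_def by (rule sum_pos) (auto simp: C)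
  have "(1 + norm x) ^ N * norm (k (x + h) - k x - frechet_derivative k (at x) h) \<le> C' * (norm h)\<^sup>2"
    if h: "norm h \<le> 1" for x h
  proof -
    let ?D = "\<lambda>y. frechet_derivative k (at y)"
    have bl: "bounded_linear (?D y)" for y
      using smooth_has_derivative[OF schwartz_smooth[OF assms]] has_derivative_bounded_linear by blast
    have der: "((\<lambda>y. k y - ?D x y) has_derivative (\<lambda>v. ?D y v - ?D x v)) (at y within cball x (norm h))" for y
      by (rule has_derivative_at_withinI)
        (intro has_derivative_diff smooth_has_derivative schwartz_smooth assms
          bounded_linear_imp_has_derivative bl)
    have on: "onorm (\<lambda>v. ?D y v - ?D x v) \<le> C' * norm h / (1 + norm x) ^ N" if "y \<in> cball x (norm h)" for y
    proof -
      have y: "norm (y - x) \<le> norm h" using that by (auto simp: dist_norm norm_minus_commute)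
      have "onorm (\<lambda>v. ?D y v - ?D x v) \<le> (\<Sum>b\<in>Basis. norm (pd b k y - pd b k x))"
        by (rule onorm_componentwise) (intro bounded_linear_sub bl)
      then have "(1 + norm x) ^ N * onorm (\<lambda>v. ?D y v - ?D x v) \<le>
          (\<Sum>b\<in>Basis. (1 + norm x) ^ N * norm (pd b k y - pd b k x))"
        unfolding sum_distrib_left[symmetric] by (intro mult_left_mono) auto
      also have "\<dots> \<le> (\<Sum>b\<in>Basis. C b * norm h)"
      proof (rule sum_mono)
        fix b :: 'a assume b: "b \<in> Basis"
        have "(1 + norm x) ^ N * norm (pd b k y - pd b k x) \<le> C b * norm (y - x)"
          using C(1)[OF b, of "y - x" x] y h by simp
        also have "\<dots> \<le> C b * norm h" using y C(2)[of b] by simp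
        finally show "(1 + norm x) ^ N * norm (pd b k y - pd b k x) \<le> C b * norm h" .
      qed
      finally have "(1 + norm x) ^ N * onorm (\<lambda>v. ?D y v - ?D x v) \<le> C' * norm h"
        by (simp add: C'_def sum_distrib_right)
      then show ?thesis by (simp add: pos_le_divide_eq add_pos_nonneg mult.commute)
    qed
    have "norm ((k (x + h) - ?D x (x + h)) - (k x - ?D x x)) \<le> C' * norm h / (1 + norm x) ^ N * norm (x + h - x)"
      by (rule differentiable_bound[OF _ der on]) (auto simp: dist_norm)
    moreover have "?D x (x + h) = ?D x x + ?D x h" using bl linear_simps(1) by blast
    moreover have "k (x + h) - (a + b) - (k x - a) = k (x + h) - k x - b" for a b by simp
    ultimately have "norm (k (x + h) - k x - ?D x h) \<le> (C' * (norm h)\<^sup>2) / (1 + norm x) ^ N"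
      by (simp add: power2_eq_square)
    then show ?thesis by (simp add: pos_le_divide_eq add_pos_nonneg mult.commute)
  qed
  then show ?thesis using that C'pos by blast
qed

section \<open>Test functions\<close>

lemma iter_deriv_support:
  assumes "closed S" "\<And>x. x \<notin> S \<Longrightarrow> f x = 0" "x \<notin> S"
  shows "iter_deriv bs f x = 0"
  using assms(3)
proof (induction bs arbitrary: x)
  case (Cons b bs)
  have "(iter_deriv bs f has_derivative (\<lambda>h. 0)) (at x)"
    by (rule has_derivative_transform_within_open[of "\<lambda>x. 0" _ _ _ "- S"])
      (use Cons assms(1) in \<open>auto simp: open_Compl\<close>)
  then show ?case by (auto dest: frechet_derivative_at[symmetric])
qed (use assms in auto)

lemma test_fun_smooth: "f \<in> test_fun \<Longrightarrow> smooth f"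
  by (simp add: test_fun_def)

lemma test_funI:
  assumes "smooth f" "\<And>x. norm x > R \<Longrightarrow> f x = 0"
  shows "f \<in> test_fun"
proof -
  have "{x. f x \<noteq> 0} \<subseteq> cball 0 R" using assms(2) by (force simp: not_le[symmetric])
  then have "closure {x. f x \<noteq> 0} \<subseteq> cball 0 R" by (simp add: closure_minimal)
  then have "compact (closure {x. f x \<noteq> 0})"
    by (meson bounded_cball bounded_subset closed_closure compact_eq_bounded_closed)
  then show ?thesis using assms by (simp add: test_fun_def)
qed

lemma test_fun_bounded_support:
  assumes "f \<in> test_fun"
  obtains R where "R > 0" "\<And>x. norm x > R \<Longrightarrow> f x = 0"
proof -
  have "bounded {x. f x \<noteq> 0}"
    using assms bounded_subset[OF compact_imp_bounded closure_subset] by (auto simp: test_fun_def)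
  then obtain R where R: "R > 0" "\<forall>x\<in>{x. f x \<noteq> 0}. norm x \<le> R" by (meson bounded_pos)
  then show ?thesis using that[of R] by force
qed

lemma test_fun_schwartz:
  assumes "f \<in> test_fun"
  shows "f \<in> schwartz"
proof (rule schwartzI)
  show sm: "smooth f" using assms test_fun_smooth by blast
  fix N and bs :: "'a list" assume bs: "set bs \<subseteq> Basis"
  obtain R where R: "R > 0" "\<And>x. norm x > R \<Longrightarrow> f x = 0" using test_fun_bounded_support[OF assms] by metis
  have z: "iter_deriv bs f x = 0" if "norm x > R" for x
    by (rule iter_deriv_support[of "cball 0 R"]) (use R that in auto)
  have "continuous_on (cball 0 R) (\<lambda>x. (1 + norm x) ^ N * norm (iter_deriv bs f x))"
    by (intro continuous_intros smooth_continuous_on smooth_iter_deriv sm bs)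
  then have "bounded ((\<lambda>x. (1 + norm x) ^ N * norm (iter_deriv bs f x)) ` cball 0 R)"
    by (intro compact_imp_bounded compact_continuous_image) auto
  then obtain C where C: "\<And>x. norm x \<le> R \<Longrightarrow> (1 + norm x) ^ N * norm (iter_deriv bs f x) \<le> C"
    unfolding bounded_iff by (force simp: abs_le_iff)
  have "(1 + norm x) ^ N * norm (iter_deriv bs f x) \<le> max C 0" for x
    using C[of x] z[of x] by (cases "norm x \<le> R") auto
  then show "\<exists>C. \<forall>x. (1 + norm x) ^ N * norm (iter_deriv bs f x) \<le> C" by blast
qed

lemma test_fun_mult_smooth:
  fixes f :: "'a::euclidean_space \<Rightarrow> complex"
  assumes "f \<in> test_fun" "smooth g"
  shows "(\<lambda>x. f x * g x) \<in> test_fun"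
proof -
  obtain R where R: "R > 0" "\<And>x. norm x > R \<Longrightarrow> f x = 0" using test_fun_bounded_support[OF assms(1)] by metis
  then show ?thesis
    by (intro test_funI[of _ R]) (use assms in \<open>auto intro: smooth_mult test_fun_smooth\<close>)
qed

lemma test_fun_affine:
  assumes "f \<in> test_fun" "r \<noteq> 0"
  shows "(\<lambda>x. f (r *\<^sub>R x + a)) \<in> test_fun"
proof -
  obtain R where R: "R > 0" "\<And>x. norm x > R \<Longrightarrow> f x = 0" using test_fun_bounded_support[OF assms(1)] by metis
  show ?thesis
  proof (rule test_funI[of _ "(R + norm a) / \<bar>r\<bar>"])
    fix x :: 'a assume "(R + norm a) / \<bar>r\<bar> < norm x"
    then have "R + norm a < norm (r *\<^sub>R x)" using assms by (simp add: field_simps)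
    also have "\<dots> \<le> norm (r *\<^sub>R x + a) + norm a" using norm_triangle_ineq4[of "r *\<^sub>R x + a" a] by simp
    finally show "f (r *\<^sub>R x + a) = 0" using R by auto
  qed (use assms in \<open>auto intro: smooth_affine test_fun_smooth\<close>)
qed

lemma test_fun_of_real:
  fixes f :: "'a::euclidean_space \<Rightarrow> real"
  assumes "f \<in> test_fun"
  shows "(\<lambda>x. complex_of_real (f x)) \<in> test_fun"
proof -
  obtain R where R: "R > 0" "\<And>x. norm x > R \<Longrightarrow> f x = 0" using test_fun_bounded_support[OF assms(1)] by metis
  then show ?thesis
    by (intro test_funI[of _ R] smooth_compose_linear[OF bounded_linear_of_real])
      (use assms in \<open>auto intro: test_fun_smooth\<close>)
qed

section \<open>Integrals of functions with polynomial decay\<close>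

text \<open>Dyadic decomposition into balls of radius \<open>2 ^ j / t\<close> about
  \<open>x\<close>: on the shell belonging to \<open>j\<close> the weight is at most about
  \<open>2 powr (- j * N)\<close>, while \<open>G\<close> has mass at most
  \<open>A * (2 ^ j / t) powr \<delta>\<close>. What remains is a geometric series of ratio
  \<open>2 powr (\<delta> - N)\<close>. This turns growth bounds on balls, as given by Morrey norms,
  into bounds for averages against decaying kernels.\<close>

lemma nn_integral_radial_weight:
  fixes G :: "'a::euclidean_space \<Rightarrow> ennreal"
  assumes [measurable]: "G \<in> borel_measurable borel"
    and G: "\<And>R. R > 0 \<Longrightarrow> (\<integral>\<^sup>+v\<in>ball x R. G v \<partial>lborel) \<le> ennreal (A * R powr \<delta>)"
    and "A \<ge> 0" "real N > \<delta>" "t > 0"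
  shows "(\<integral>\<^sup>+v. ennreal (1 / (1 + t * norm (v - x)) ^ N) * G v \<partial>lborel)
    \<le> ennreal (2 ^ N * A * t powr (- \<delta>) / (1 - 2 powr (\<delta> - N)))"
proof -
  let ?q = "2 powr (\<delta> - N)"
  have q: "0 < ?q" "?q < 1" using assms by (auto simp: powr_less_one)
  have pw: "ennreal (1 / (1 + t * norm (v - x)) ^ N) \<le>
      (\<Sum>j. ennreal (2 ^ N * (1 / 2) ^ (j * N)) * indicator (ball x (2 ^ j / t)) v)" (is "?l \<le> (\<Sum>j. ?f j)") for v
  proof -
    obtain j0 where j0: "t * norm (v - x) < 2 ^ j0"
      using real_arch_pow[of 2 "t * norm (v - x)"] by auto
    \<comment> \<open>Minimality also gives \<open>2 ^ (j - 1) <= t * norm (v - x)\<close> unless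
      \<open>j = 0\<close>. The weight is thus bounded by its value at the inner edge of the shell,
      at the price of the factor \<open>2 ^ N\<close>.\<close>
    define j where "j = (LEAST j. t * norm (v - x) < 2 ^ j)"
    have j: "t * norm (v - x) < 2 ^ j" unfolding j_def by (rule LeastI[of _ j0]) (rule j0)
    have nn: "0 \<le> t * norm (v - x)" using assms by simp
    have "1 / (1 + t * norm (v - x)) ^ N \<le> 2 ^ N * (1 / 2) ^ (j * N)"
    proof (cases j)
      case 0
      have "1 / (1 + t * norm (v - x)) ^ N \<le> 1" using nn by (simp add: one_le_power)
      then show ?thesis using 0 by (simp add: order_trans[OF _ two_realpow_ge_one])
    next
      case (Suc i)
      have "\<not> t * norm (v - x) < 2 ^ i"
        using not_less_Least[of i "\<lambda>j. t * norm (v - x) < 2 ^ j"] Suc by (simp add: j_def)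
      then have "(2 ^ i) ^ N \<le> (1 + t * norm (v - x)) ^ N"
        by (intro power_mono) auto
      then have "1 / (1 + t * norm (v - x)) ^ N \<le> 1 / (2 ^ i) ^ N"
        by (intro divide_left_mono) (use nn in \<open>auto intro!: mult_pos_pos zero_less_power add_pos_nonneg\<close>)
      also have "\<dots> = 2 ^ N * (1 / 2) ^ (j * N)"
        using Suc by (simp add: power_mult[symmetric] power_divide field_simps power_add)
      finally show ?thesis .
    qed
    moreover have "v \<in> ball x (2 ^ j / t)"
      using j assms by (simp add: dist_norm norm_minus_commute field_simps)
    ultimately have "?l \<le> ?f j" by (simp add: ennreal_leI)
    also have "\<dots> \<le> (\<Sum>j. ?f j)"
      using sum_le_suminf[of ?f "{j}"] by (simp del: sum_mult_indicator)
    finally show ?thesis .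
  qed
  have meas: "(\<lambda>v. G v * indicator (ball x r) v) \<in> borel_measurable borel" for r
    by (intro borel_measurable_times_ennreal assms borel_measurable_indicator) simp
  have "(\<integral>\<^sup>+v. ennreal (1 / (1 + t * norm (v - x)) ^ N) * G v \<partial>lborel) \<le>
     (\<integral>\<^sup>+v. (\<Sum>j. ennreal (2 ^ N * (1 / 2) ^ (j * N)) * indicator (ball x (2 ^ j / t)) v) * G v \<partial>lborel)"
    by (intro nn_integral_mono mult_right_mono pw) auto
  also have "\<dots> = (\<integral>\<^sup>+v. (\<Sum>j. ennreal (2 ^ N * (1 / 2) ^ (j * N)) * (G v * indicator (ball x (2 ^ j / t)) v)) \<partial>lborel)"
    unfolding ennreal_suminf_multc[symmetric] by (simp add: mult_ac)
  also have "\<dots> = (\<Sum>j. ennreal (2 ^ N * (1 / 2) ^ (j * N)) * (\<integral>\<^sup>+v\<in>ball x (2 ^ j / t). G v \<partial>lborel))"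
    using meas by (subst nn_integral_suminf) (auto simp: nn_integral_cmult)
  also have "\<dots> \<le> (\<Sum>j. ennreal (2 ^ N * (1 / 2) ^ (j * N)) * ennreal (A * (2 ^ j / t) powr \<delta>))"
    by (intro suminf_le mult_left_mono G) (use assms in auto)
  also have "\<dots> = (\<Sum>j. ennreal (2 ^ N * A * t powr (- \<delta>) * ?q ^ j))"
  proof (rule suminf_cong)
    fix j
    have "(2 ^ j / t) powr \<delta> = (2 powr \<delta>) ^ j * t powr (- \<delta>)"
      using assms by (simp add: powr_divide powr_minus_divide powr_power powr_powr
          flip: powr_realpow) (simp add: mult.commute)
    moreover have "?q ^ j = (2 powr \<delta>) ^ j * (1 / 2) ^ (j * N)"
      by (simp add: powr_diff power_divide powr_realpow power_mult[symmetric] mult.commute)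
    ultimately have "2 ^ N * (1 / 2) ^ (j * N) * (A * (2 ^ j / t) powr \<delta>) = 2 ^ N * A * t powr (- \<delta>) * ?q ^ j"
      by simp
    then show "ennreal (2 ^ N * (1 / 2) ^ (j * N)) * ennreal (A * (2 ^ j / t) powr \<delta>) = ennreal (2 ^ N * A * t powr (- \<delta>) * ?q ^ j)"
      using assms by (subst ennreal_mult[symmetric]) auto
  qed
  also have "\<dots> = ennreal (2 ^ N * A * t powr (- \<delta>) * (1 / (1 - ?q)))"
  proof (rule suminf_ennreal_eq)
    show "(\<lambda>j. 2 ^ N * A * t powr (- \<delta>) * ?q ^ j) sums (2 ^ N * A * t powr (- \<delta>) * (1 / (1 - ?q)))"
      by (intro sums_mult geometric_sums) (use q in simp)
  qed (use q assms in simp)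
  finally show ?thesis by simp
qed

text \<open>The special case of constant \<open>G\<close>, where \<delta> is the dimension and
  \<open>A\<close> the volume of the unit ball.\<close>

lemma integrable_poly_decay:
  assumes "N > DIM('a)"
  shows "integrable lborel (\<lambda>v::'a::euclidean_space. 1 / (1 + norm v) ^ N)"
proof (rule integrableI_bounded)
  have "(\<integral>\<^sup>+v. ennreal (1 / (1 + 1 * norm (v - 0::'a)) ^ N) * 1 \<partial>lborel)
    \<le> ennreal (2 ^ N * unit_ball_vol (DIM('a)) * 1 powr (- real (DIM('a))) / (1 - 2 powr (real (DIM('a)) - N)))"
    by (rule nn_integral_radial_weight)
      (use assms in \<open>auto simp: emeasure_ball powr_realpow\<close>)
  also have "\<dots> < \<infinity>" by simp
  finally show "(\<integral>\<^sup>+v. ennreal (norm (1 / (1 + norm (v::'a)) ^ N)) \<partial>lborel) < \<infinity>" by simp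
qed simp

lemma lborel_integral_translate:
  fixes f :: "'a::euclidean_space \<Rightarrow> 'b::{banach, second_countable_topology}"
  assumes [measurable]: "f \<in> borel_measurable borel"
  shows "(LINT x|lborel. f (a + x)) = (LINT x|lborel. f x)"
    "integrable lborel (\<lambda>x. f (a + x)) \<longleftrightarrow> integrable lborel f"
proof -
  show "(LINT x|lborel. f (a + x)) = (LINT x|lborel. f x)"
    by (subst (2) lborel_distr_plus[of a, symmetric]) (simp add: integral_distr)
  show "integrable lborel (\<lambda>x. f (a + x)) \<longleftrightarrow> integrable lborel f"
    by (subst (2) lborel_distr_plus[of a, symmetric]) (simp add: integrable_distr_eq)
qed

lemma lborel_integral_scale:
  fixes f :: "'a::euclidean_space \<Rightarrow> 'b::{banach, second_countable_topology}"
  assumes [measurable]: "f \<in> borel_measurable borel" and "c \<noteq> 0"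
  shows "(LINT x|lborel. f x) = (\<bar>c\<bar> ^ DIM('a)) *\<^sub>R (LINT x|lborel. f (a + c *\<^sub>R x))"
    "integrable lborel (\<lambda>x. f (a + c *\<^sub>R x)) \<longleftrightarrow> integrable lborel f"
proof -
  show "(LINT x|lborel. f x) = (\<bar>c\<bar> ^ DIM('a)) *\<^sub>R (LINT x|lborel. f (a + c *\<^sub>R x))"
    by (subst lborel_affine[OF assms(2), of a])
      (simp add: integral_density integral_distr ennreal_power)
  have "integrable lborel (\<lambda>x. r *\<^sub>R g x) \<longleftrightarrow> integrable lborel g" if "r \<noteq> 0" for r and g :: "'a \<Rightarrow> 'b"
    using that integrable_scaleR_right[of "inverse r" lborel "\<lambda>x. r *\<^sub>R g x"] by auto
  note eq = this[of "\<bar>c\<bar> ^ DIM('a)"]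
  show "integrable lborel (\<lambda>x. f (a + c *\<^sub>R x)) \<longleftrightarrow> integrable lborel f"
    using assms(2) by (subst (2) lborel_affine[OF assms(2), of a])
      (simp add: integrable_density integrable_distr_eq ennreal_power eq)
qed

lemma lborel_integral_reflect:
  fixes f :: "'a::euclidean_space \<Rightarrow> 'b::{banach, second_countable_topology}"
  assumes [measurable]: "f \<in> borel_measurable borel"
  shows "(LINT x|lborel. f (a - x)) = (LINT x|lborel. f x)"
    "integrable lborel (\<lambda>x. f (a - x)) \<longleftrightarrow> integrable lborel f"
  using lborel_integral_scale[of f "-1" a] by auto

lemma nn_integral_lborel_scale:
  fixes f :: "'a::euclidean_space \<Rightarrow> ennreal"
  assumes [measurable]: "f \<in> borel_measurable borel" and "c \<noteq> 0"
  shows "(\<integral>\<^sup>+x. f x \<partial>lborel) = ennreal (\<bar>c\<bar> ^ DIM('a)) * (\<integral>\<^sup>+x. f (a + c *\<^sub>R x) \<partial>lborel)"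
  by (subst lborel_affine[OF assms(2), of a])
    (simp add: nn_integral_density nn_integral_distr ennreal_power nn_integral_cmult)

lemma integrable_poly_decay_shift:
  fixes f :: "'a::euclidean_space \<Rightarrow> 'b::{banach, second_countable_topology}"
  assumes [measurable]: "f \<in> borel_measurable borel"
    and "\<And>v. (1 + norm (z - v)) ^ N * norm (f v) \<le> C" "N > DIM('a)"
  shows "integrable lborel f"
proof (rule Bochner_Integration.integrable_bound)
  show "integrable lborel (\<lambda>v. C * (1 / (1 + norm (z - v)) ^ N))"
    by (intro integrable_mult_right) (subst lborel_integral_reflect, auto intro: integrable_poly_decay assms)
  have "norm (f v) \<le> C / (1 + norm (z - v)) ^ N" for v
    using assms(2)[of v]
    by (simp only: pos_le_divide_eq add_pos_nonneg zero_less_power zero_less_one norm_ge_zero mult.commute)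
  then have "norm (f v) \<le> norm (C * (1 / (1 + norm (z - v)) ^ N))" for v
    using order_trans[OF _ abs_ge_self] by fastforce
  then show "AE v in lborel. norm (f v) \<le> norm (C * (1 / (1 + norm (z - v)) ^ N))"
    by auto
qed simp

text \<open>A pointwise quadratic remainder with integrable coefficient \<open>B\<close> integrates
  to an error of at most \<open>(norm h)^2\<close> times the integral of \<open>B\<close>, which is
  \<open>o(norm h)\<close>. The theorem on differentiation under the integral thereby reduces to a
  single norm estimate.\<close>

lemma has_derivative_integral:
  fixes F :: "'a::euclidean_space \<Rightarrow> 't \<Rightarrow> complex" and F' :: "'t \<Rightarrow> 'a \<Rightarrow> complex"
  assumes int: "\<And>y. integrable M (F y)"
    and lin: "\<And>t. linear (F' t)"
    and intD: "\<And>h. integrable M (\<lambda>t. F' t h)"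
    and B: "integrable M B"
    and bd: "\<And>h t. norm h \<le> 1 \<Longrightarrow> norm (F (x + h) t - F x t - F' t h) \<le> (norm h)\<^sup>2 * B t"
  shows "((\<lambda>y. LINT t|M. F y t) has_derivative (\<lambda>h. LINT t|M. F' t h)) (at x)"
  unfolding has_derivative_at
proof
  show "bounded_linear (\<lambda>h. LINT t|M. F' t h)"
    unfolding linear_conv_bounded_linear[symmetric]
    by (rule linearI) (auto simp: linear_add[OF lin] linear_cmul[OF lin] intD)
  show "(\<lambda>h. norm ((LINT t|M. F (x + h) t) - (LINT t|M. F x t) - (LINT t|M. F' t h)) / norm h) \<midarrow>0\<rightarrow> 0"
  proof (rule tendsto_0_le[of "\<lambda>h. norm h" _ _ "LINT t|M. B t"])
    show "((\<lambda>h::'a. norm h) \<longlongrightarrow> 0) (at 0)" by (intro tendsto_norm_zero tendsto_ident_at)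
    have "norm (norm ((LINT t|M. F (x + h) t) - (LINT t|M. F x t) - (LINT t|M. F' t h)) / norm h)
        \<le> norm (norm h) * (LINT t|M. B t)" if h: "norm h < 1" "h \<noteq> 0" for h
    proof -
      have "(LINT t|M. F (x + h) t) - (LINT t|M. F x t) - (LINT t|M. F' t h) = (LINT t|M. F (x + h) t - F x t - F' t h)"
        by (simp add: int intD)
      also have "norm \<dots> \<le> (LINT t|M. norm (F (x + h) t - F x t - F' t h))"
        by (rule integral_norm_bound)
      also have "\<dots> \<le> (LINT t|M. (norm h)\<^sup>2 * B t)"
        by (intro integral_mono bd) (use int intD B h in auto)
      finally show ?thesis using h by (simp add: field_simps power2_eq_square)
    qed
    then show "\<forall>\<^sub>F h in at 0. norm (norm ((LINT t|M. F (x + h) t) - (LINT t|M. F x t) - (LINT t|M. F' t h)) / norm h)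
        \<le> norm (norm h) * (LINT t|M. B t)"
      unfolding eventually_at by (intro exI[of _ 1]) (auto simp: dist_norm)
  qed
qed

section \<open>Convolution with a Schwartz function\<close>

definition conv :: "('a::euclidean_space \<Rightarrow> complex) \<Rightarrow> ('a \<Rightarrow> complex) \<Rightarrow> 'a \<Rightarrow> complex" where
  "conv w k z = (LINT v|lborel. w v * k (z - v))"

text \<open>The growth class to which the band-limited pieces of a tempered distribution belong;
  against a Schwartz kernel such functions are integrable.\<close>

definition slowly_growing :: "('a::euclidean_space \<Rightarrow> complex) \<Rightarrow> bool" where
  "slowly_growing w \<longleftrightarrow> w \<in> borel_measurable borel \<and> (\<exists>A M. \<forall>v. norm (w v) \<le> A * (1 + norm v) ^ M)"

lemma slowly_growing_measurable: "slowly_growing w \<Longrightarrow> w \<in> borel_measurable borel"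
  by (simp add: slowly_growing_def)

lemma schwartz_continuous: "f \<in> schwartz \<Longrightarrow> continuous_on S f"
  by (simp add: schwartz_smooth smooth_continuous_on)

lemma schwartz_measurable: "f \<in> schwartz \<Longrightarrow> f \<in> borel_measurable borel"
  by (intro borel_measurable_continuous_onI schwartz_continuous)

lemma schwartz_integrable: 
  assumes "f \<in> schwartz"
  shows "integrable lborel f"
proof -
  obtain C where "\<And>x. (1 + norm x) ^ Suc (DIM('a)) * norm (f x) \<le> C" using schwartz_rapid[OF assms] by metis
  then show ?thesis
    by (intro integrable_poly_decay_shift[of _ 0 "Suc (DIM('a))" C] schwartz_measurable assms) auto
qed

lemma schwartz_slowly_growing: "f \<in> schwartz \<Longrightarrow> slowly_growing f"
  unfolding slowly_growing_def using schwartz_rapid[of f 0]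
  by (metis schwartz_measurable mult.right_neutral power_0 mult_1)

lemma slowly_growing_bound:
  assumes "slowly_growing w"
  obtains A M where "A > 0" "\<And>v. norm (w v) \<le> A * (1 + norm v) ^ M"
proof -
  obtain A M where A: "\<And>v. norm (w v) \<le> A * (1 + norm v) ^ M" using assms by (auto simp: slowly_growing_def)
  have "norm (w v) \<le> max A 1 * (1 + norm v) ^ M" for v
    by (rule order_trans[OF A mult_right_mono]) auto
  then show ?thesis using that[of "max A 1" M] by auto
qed

text \<open>By Peetre's inequality the growth of \<open>w\<close> at \<open>v\<close> is split into
  a factor depending on the fixed point \<open>z\<close> and a power of
  \<open>1 + norm (z - v)\<close>, and the latter is absorbed by the decay of
  \<open>k\<close>.\<close>

lemma slowly_growing_mult_schwartz_bound:
  assumes "slowly_growing w" "\<And>M. \<exists>C. \<forall>z. (1 + norm (z::'a)) ^ M * norm (k z) \<le> C"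
  shows "\<exists>C. \<forall>v. (1 + norm (z - v)) ^ N * norm (w v * k (z - v :: 'a::euclidean_space) :: complex) \<le> C"
proof -
  obtain A M where A: "A > 0" "\<And>v. norm (w v) \<le> A * (1 + norm v) ^ M"
    using slowly_growing_bound[OF assms(1)] by metis
  obtain C where C: "\<And>z. (1 + norm z) ^ (M + N) * norm (k z) \<le> C"
    using assms(2) by metis
  have "(1 + norm (z - v)) ^ N * norm (w v * k (z - v)) \<le> A * (1 + norm z) ^ M * C" for v
  proof -
    have "norm (w v) \<le> A * ((1 + norm z) ^ M * (1 + norm (z - v)) ^ M)"
      using A(2)[of v] one_plus_norm_power_add[of z "v - z" M] A(1)
      by (smt (verit) add_diff_cancel_left' diff_add_cancel mult_le_cancel_left_pos norm_minus_commute)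
    then have "(1 + norm (z - v)) ^ N * norm (w v * k (z - v)) \<le>
       (1 + norm (z - v)) ^ N * ((A * ((1 + norm z) ^ M * (1 + norm (z - v)) ^ M)) * norm (k (z - v)))"
      unfolding norm_mult by (intro mult_left_mono mult_right_mono) auto
    also have "\<dots> = A * (1 + norm z) ^ M * ((1 + norm (z - v)) ^ (M + N) * norm (k (z - v)))"
      by (simp add: power_add)
    also have "\<dots> \<le> A * (1 + norm z) ^ M * C"
      using A(1) by (intro mult_left_mono C) auto
    finally show ?thesis .
  qed
  then show ?thesis by blast
qed

lemma conv_integrable:
  assumes "slowly_growing w" "k \<in> schwartz"
  shows "integrable lborel (\<lambda>v. w v * k (z - v))"
proof -
  have [measurable]: "w \<in> borel_measurable borel" "k \<in> borel_measurable borel"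
    using assms schwartz_measurable slowly_growing_measurable by auto
  obtain C where "\<And>v. (1 + norm (z - v)) ^ Suc (DIM('a)) * norm (w v * k (z - v)) \<le> C"
    using slowly_growing_mult_schwartz_bound[OF assms(1), of k z] schwartz_rapid[OF assms(2)] by metis
  then show ?thesis
    by (intro integrable_poly_decay_shift[of _ z "Suc (DIM('a))" C]) auto
qed

lemma conv_has_derivative:
  assumes "slowly_growing w" "k \<in> schwartz"
  shows "(conv w k has_derivative (\<lambda>h. LINT v|lborel. w v * frechet_derivative k (at (z - v)) h)) (at z)"
proof -
  have [measurable]: "w \<in> borel_measurable borel" "k \<in> borel_measurable borel"
    using assms schwartz_measurable slowly_growing_measurable by auto
  obtain A M where A: "A > 0" "\<And>v. norm (w v) \<le> A * (1 + norm v) ^ M"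
    using slowly_growing_bound[OF assms(1)] by metis
  \<comment> \<open>Weight \<open>M\<close> in the Taylor remainder absorbs the growth of
    \<open>w\<close>; the further weight \<open>L\<close>, larger than the dimension, leaves an
    integrable majorant.\<close>
  define L where "L = Suc (DIM('a))"
  obtain C where C: "C > 0" "\<And>x h. norm h \<le> 1 \<Longrightarrow>
      (1 + norm x) ^ (M + L) * norm (k (x + h) - k x - frechet_derivative k (at x) h) \<le> C * (norm h)\<^sup>2"
    using schwartz_taylor[OF assms(2)] by metis
  have lin: "linear (frechet_derivative k (at y))" for y
    using linear_frechet_derivative smooth_differentiable schwartz_smooth assms(2) by blast
  let ?B = "\<lambda>v. A * (1 + norm z) ^ M * C * (1 / (1 + norm (z - v)) ^ L)"
  have "((\<lambda>y. LINT v|lborel. w v * k (y - v)) has_derivative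
    (\<lambda>h. LINT v|lborel. w v * frechet_derivative k (at (z - v)) h)) (at z)"
  proof (rule has_derivative_integral[where B="?B"])
    show "linear (\<lambda>h. w t * frechet_derivative k (at (z - t)) h)" for t
      by (rule linearI) (auto simp: linear_add[OF lin] linear_cmul[OF lin] distrib_left)
    show "integrable lborel (\<lambda>v. w v * frechet_derivative k (at (z - v)) h)" for h
    proof -
      have "integrable lborel (\<lambda>v. (\<Sum>b\<in>Basis. (h \<bullet> b) *\<^sub>R (w v * pd b k (z - v))))"
        by (intro Bochner_Integration.integrable_sum integrable_scaleR_right conv_integrable schwartz_pd assms) auto
      also have "(\<lambda>v. (\<Sum>b\<in>Basis. (h \<bullet> b) *\<^sub>R (w v * pd b k (z - v)))) =
          (\<lambda>v. w v * frechet_derivative k (at (z - v)) h)"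
        by (rule ext, subst linear_basis_expansion[OF lin]) (simp add: sum_distrib_left)
      finally show ?thesis .
    qed
    show "integrable lborel ?B"
      by (intro integrable_mult_right, subst lborel_integral_reflect)
        (simp, rule integrable_poly_decay, simp add: L_def)
    fix h v assume h: "norm (h::'a) \<le> 1"
    let ?D = "k (z - v + h) - k (z - v) - frechet_derivative k (at (z - v)) h"
    have "norm (w v) \<le> A * ((1 + norm z) ^ M * (1 + norm (z - v)) ^ M)"
      using A(2)[of v] one_plus_norm_power_add[of z "v - z" M] A(1)
      by (smt (verit) add_diff_cancel_left' diff_add_cancel mult_le_cancel_left_pos norm_minus_commute)
    then have "(1 + norm (z - v)) ^ L * norm (w v * ?D) \<le>
       (1 + norm (z - v)) ^ L * ((A * ((1 + norm z) ^ M * (1 + norm (z - v)) ^ M)) * norm ?D)"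
      unfolding norm_mult by (intro mult_left_mono mult_right_mono) auto
    also have "\<dots> = A * (1 + norm z) ^ M * ((1 + norm (z - v)) ^ (M + L) * norm ?D)"
      by (simp add: power_add)
    also have "\<dots> \<le> A * (1 + norm z) ^ M * (C * (norm h)\<^sup>2)"
      using A(1) by (intro mult_left_mono C h) auto
    finally have "norm (w v * ?D) \<le> (A * (1 + norm z) ^ M * (C * (norm h)\<^sup>2)) / (1 + norm (z - v)) ^ L"
      by (simp only: pos_le_divide_eq add_pos_nonneg zero_less_power zero_less_one norm_ge_zero mult.commute)
    also have "\<dots> = (norm h)\<^sup>2 * ?B v" by simp
    also have "w v * ?D = w v * k (z + h - v) - w v * k (z - v) - w v * frechet_derivative k (at (z - v)) h"
      by (simp add: right_diff_distrib add_diff_eq diff_add_eq)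
    finally show "norm (w v * k (z + h - v) - w v * k (z - v) - w v * frechet_derivative k (at (z - v)) h) \<le> (norm h)\<^sup>2 * ?B v" .
  qed (rule conv_integrable[OF assms])
  then show ?thesis unfolding conv_def[abs_def] .
qed

lemma pd_conv:
  assumes "slowly_growing w" "k \<in> schwartz"
  shows "pd b (conv w k) = conv w (pd b k)"
  by (rule ext) (subst frechet_derivative_at[OF conv_has_derivative[OF assms], symmetric], simp add: conv_def)

lemma iter_deriv_conv:
  assumes "slowly_growing w" "k \<in> schwartz" "set bs \<subseteq> Basis"
  shows "iter_deriv bs (conv w k) = conv w (iter_deriv bs k)"
  using assms(3)
proof (induction bs)
  case (Cons b bs)
  then have "iter_deriv (b # bs) (conv w k) = pd b (conv w (iter_deriv bs k))" by simp
  also have "\<dots> = conv w (pd b (iter_deriv bs k))"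
    using Cons by (intro pd_conv assms schwartz_iter_deriv) auto
  finally show ?case by simp
qed simp

lemma smooth_conv:
  assumes "slowly_growing w" "k \<in> schwartz"
  shows "smooth (conv w k)"
proof (rule smooth_coinduct[where P="{conv w k |k. k \<in> schwartz}"], goal_cases)
  case (2 h x)
  then show ?case using conv_has_derivative[OF assms(1)] by (auto simp: differentiable_def)
next
  case (3 h b)
  then show ?case using pd_conv[OF assms(1)] schwartz_pd by blast
qed (use assms in auto)

text \<open>Decay as for Schwartz functions but with mere measurability: in a convolution the
  smoothness is supplied by the other factor.\<close>

definition rapidly_decreasing :: "('a::euclidean_space \<Rightarrow> complex) \<Rightarrow> bool" where
  "rapidly_decreasing w \<longleftrightarrow> w \<in> borel_measurable borel \<and> (\<forall>N. \<exists>C. \<forall>v. (1 + norm v) ^ N * norm (w v) \<le> C)"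

lemma schwartz_rapidly_decreasing: "w \<in> schwartz \<Longrightarrow> rapidly_decreasing w"
  unfolding rapidly_decreasing_def using schwartz_rapid schwartz_measurable by metis

lemma rapidly_decreasing_bound:
  assumes "rapidly_decreasing w"
  obtains C where "C > 0" "\<And>v. (1 + norm v) ^ N * norm (w v) \<le> C"
proof -
  obtain C where C: "\<And>v. (1 + norm v) ^ N * norm (w v) \<le> C"
    using assms unfolding rapidly_decreasing_def by metis
  have "(1 + norm v) ^ N * norm (w v) \<le> max C 1" for v using C[of v] by linarith
  then show ?thesis using that[of "max C 1"] by auto
qed

lemma rapidly_decreasing_slowly_growing: "rapidly_decreasing w \<Longrightarrow> slowly_growing w"
  unfolding slowly_growing_def using rapidly_decreasing_bound[of w 0]
  by (metis rapidly_decreasing_def mult.right_neutral power_0 mult_1)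

lemma rapidly_decreasing_integrable_moment:
  fixes w :: "'a::euclidean_space \<Rightarrow> complex"
  assumes "rapidly_decreasing w"
  shows "integrable lborel (\<lambda>v. (1 + norm v) ^ N * norm (w v))"
proof -
  define L where "L = Suc (DIM('a))"
  obtain C where C: "\<And>v. (1 + norm v) ^ (L + N) * norm (w v) \<le> C"
    using rapidly_decreasing_bound[OF assms] by metis
  have [measurable]: "w \<in> borel_measurable borel" using assms by (simp add: rapidly_decreasing_def)
  show ?thesis
  proof (rule integrable_poly_decay_shift[of _ 0 L C])
    show "(1 + norm (0 - v)) ^ L * norm ((1 + norm v) ^ N * norm (w v)) \<le> C" for v
      using C[of v] by (simp add: power_add mult.assoc abs_mult)
  qed (auto simp: L_def)
qed

lemma conv_bound:
  assumes "rapidly_decreasing w" "k \<in> schwartz"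
  shows "\<exists>C. \<forall>z. (1 + norm z) ^ N * norm (conv w k z) \<le> C"
proof -
  have [measurable]: "w \<in> borel_measurable borel" "k \<in> borel_measurable borel"
    using assms schwartz_measurable by (auto simp: rapidly_decreasing_def)
  define L where "L = Suc (DIM('a))"
  obtain A where A: "A > 0" "\<And>x. (1 + norm x) ^ (N + L) * norm (w x) \<le> A"
    using rapidly_decreasing_bound[OF assms(1)] by metis
  obtain C where C: "C > 0" "\<And>x. (1 + norm x) ^ N * norm (k x) \<le> C" using schwartz_rapid[OF assms(2)] by metis
  have intB: "integrable lborel (\<lambda>v::'a. A * C * (1 / (1 + norm v) ^ L))"
    by (intro integrable_mult_right integrable_poly_decay) (simp add: L_def)
  have "(1 + norm z) ^ N * norm (conv w k z) \<le> (LINT v|lborel. A * C * (1 / (1 + norm (v::'a)) ^ L))" for z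
  proof -
    have "(1 + norm z) ^ N * norm (conv w k z) = norm (LINT v|lborel. ((1 + norm z) ^ N) *\<^sub>R (w v * k (z - v)))"
      by (simp add: conv_def)
    also have "\<dots> \<le> (LINT v|lborel. A * C * (1 / (1 + norm (v::'a)) ^ L))"
    proof (rule Bochner_Integration.integral_norm_bound_integral[OF _ intB])
      show "integrable lborel (\<lambda>v. ((1 + norm z) ^ N) *\<^sub>R (w v * k (z - v)))"
        by (intro integrable_scaleR_right conv_integrable rapidly_decreasing_slowly_growing assms)
      fix v
      have "(1 + norm z) ^ N \<le> (1 + norm v) ^ N * (1 + norm (z - v)) ^ N"
        using one_plus_norm_power_add[of v "z - v" N] by simp
      then have "norm (((1 + norm z) ^ N) *\<^sub>R (w v * k (z - v))) \<le>
         ((1 + norm v) ^ N * (1 + norm (z - v)) ^ N) * (norm (w v) * norm (k (z - v)))"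
        unfolding norm_scaleR norm_mult by (simp add: mult_right_mono)
      also have "\<dots> = ((1 + norm v) ^ N * norm (w v)) * ((1 + norm (z - v)) ^ N * norm (k (z - v)))" by simp
      also have "\<dots> \<le> ((1 + norm v) ^ N * norm (w v)) * C"
        by (intro mult_left_mono C) auto
      also have "\<dots> = ((1 + norm v) ^ (N + L) * norm (w v)) * C / (1 + norm v) ^ L"
      proof -
        have "(1 + norm v) ^ L \<noteq> 0" using norm_ge_zero[of v] by (intro power_not_zero) linarith
        moreover have "a * b * c = (a * e * b) * c / e" if "e \<noteq> 0" for a b c e :: real using that by simp
        ultimately show ?thesis unfolding power_add by blast
      qed
      also have "\<dots> \<le> A * C / (1 + norm v) ^ L"
        by (intro divide_right_mono mult_right_mono A) (use C in auto)
      finally show "norm (((1 + norm z) ^ N) *\<^sub>R (w v * k (z - v))) \<le> A * C * (1 / (1 + norm v) ^ L)" by simp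
    qed
    finally show ?thesis .
  qed
  then show ?thesis by blast
qed

lemma conv_schwartz:
  assumes "rapidly_decreasing w" "k \<in> schwartz"
  shows "conv w k \<in> schwartz"
  using assms
  by (intro schwartzI) (auto simp: iter_deriv_conv rapidly_decreasing_slowly_growing smooth_conv intro!: conv_bound schwartz_iter_deriv)

section \<open>Fourier inversion for test functions\<close>

text \<open>The kernel of the multiplier operator with symbol \<open>\<eta>\<close>, reflected:
  \<open>\<F>\<^sup>-\<^sup>1[\<eta> \<F> f]\<close> is \<open>f\<close> convolved with \<open>mult_kernel \<eta> (- x)\<close>.\<close>
definition mult_kernel :: "('a::euclidean_space \<Rightarrow> complex) \<Rightarrow> 'a \<Rightarrow> complex" where
  "mult_kernel \<eta> z = of_real ((2 * pi) powr (- real DIM('a))) * (LINT \<xi>|lborel. cis (- (z \<bullet> \<xi>)) * \<eta> \<xi>)"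

lemma cis_continuous [continuous_intros]:
  "continuous_on S f \<Longrightarrow> continuous_on S (\<lambda>x. cis (f x))"
  unfolding cis_conv_exp by (intro continuous_intros)

lemma cis_measurable [measurable]: "cis \<in> borel_measurable borel"
  by (intro borel_measurable_continuous_onI continuous_intros)

lemma integrable_cis_mult:
  assumes "integrable lborel f" and [measurable]: "g \<in> borel_measurable borel"
  shows "integrable lborel (\<lambda>x::'a::euclidean_space. cis (g x) * f x)"
  by (rule Bochner_Integration.integrable_bound[OF assms(1)])
    (use borel_measurable_integrable[OF assms(1)] in \<open>auto simp: norm_mult\<close>)

lemma test_fun_integrable: "f \<in> test_fun \<Longrightarrow> integrable lborel f" for f :: "'a::euclidean_space \<Rightarrow> complex"
  by (intro schwartz_integrable test_fun_schwartz)

lemma test_fun_measurable: "f \<in> test_fun \<Longrightarrow> f \<in> borel_measurable borel" for f :: "'a::euclidean_space \<Rightarrow> complex"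
  by (intro schwartz_measurable test_fun_schwartz)

lemma cis_second_order: "cmod (cis t - 1 - \<i> * of_real t) \<le> t\<^sup>2"
proof -
  have "cmod (iexp t - (\<Sum>k\<le>1. (\<i> * t) ^ k / fact k)) \<le> \<bar>t\<bar> ^ Suc 1 / fact (Suc 1)"
    by (rule iexp_approx1)
  then have "cmod (cis t - 1 - \<i> * of_real t) \<le> t\<^sup>2 / 2"
    by (simp add: cis_conv_exp numeral_2_eq_2 algebra_simps power2_eq_square)
  then show ?thesis using zero_le_power2[of t] by linarith
qed

lemma smooth_inner: "smooth (\<lambda>\<xi>::'a::euclidean_space. complex_of_real (b \<bullet> \<xi>))"
  by (rule smooth_compose_linear[OF bounded_linear_of_real smooth_bounded_linear[OF bounded_linear_inner_right]])

lemma test_fun_mult_inner: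
  assumes "\<eta> \<in> test_fun"
  shows "(\<lambda>\<xi>::'a::euclidean_space. - \<i> * of_real (b \<bullet> \<xi>) * \<eta> \<xi>) \<in> test_fun"
  using test_fun_mult_smooth[OF assms smooth_cmult[OF smooth_inner[of b], of "- \<i>"]] by (simp add: mult_ac)

text \<open>Expand the phase to second order; since \<eta> is a test function,
  \<open>(norm \<xi>)^2 * norm (\<eta> \<xi>)\<close> is an integrable coefficient of the remainder.
  The derivative is again a kernel with a test function as symbol, so the family of kernels is
  closed under differentiation.\<close>

lemma mult_kernel_has_derivative:
  fixes \<eta> :: "'a::euclidean_space \<Rightarrow> complex"
  assumes \<eta>: "\<eta> \<in> test_fun"
  shows "(mult_kernel \<eta> has_derivative (\<lambda>h. mult_kernel (\<lambda>\<xi>. - \<i> * of_real (h \<bullet> \<xi>) * \<eta> \<xi>) z)) (at z)"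
proof -
  have [measurable]: "\<eta> \<in> borel_measurable borel" by (rule test_fun_measurable[OF \<eta>])
  have "((\<lambda>y. LINT \<xi>|lborel. cis (- (y \<bullet> \<xi>)) * \<eta> \<xi>) has_derivative
     (\<lambda>h. LINT \<xi>|lborel. cis (- (z \<bullet> \<xi>)) * (- \<i> * of_real (h \<bullet> \<xi>) * \<eta> \<xi>))) (at z)"
  proof (rule has_derivative_integral[where B="\<lambda>\<xi>. (norm \<xi>)\<^sup>2 * norm (\<eta> \<xi>)"])
    show "linear (\<lambda>h. cis (- (z \<bullet> \<xi>)) * (- \<i> * of_real (h \<bullet> \<xi>) * \<eta> \<xi>))" for \<xi>
      by (rule linearI) (auto simp: inner_add_left algebra_simps scaleR_conv_of_real)
    show "integrable lborel (\<lambda>\<xi>. cis (- (z \<bullet> \<xi>)) * (- \<i> * of_real (h \<bullet> \<xi>) * \<eta> \<xi>))" for h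
      by (intro integrable_cis_mult test_fun_integrable test_fun_mult_inner \<eta>) simp
    obtain C where C: "\<And>x. (1 + norm x) ^ (2 + Suc (DIM('a))) * norm (\<eta> x) \<le> C"
      using schwartz_rapid[OF test_fun_schwartz[OF \<eta>]] by metis
    show "integrable lborel (\<lambda>\<xi>. (norm \<xi>)\<^sup>2 * norm (\<eta> \<xi>))"
    proof (rule integrable_poly_decay_shift[of _ 0 "Suc (DIM('a))" C])
      fix v :: 'a
      have "(1 + norm v) ^ Suc (DIM('a)) * ((norm v)\<^sup>2 * norm (\<eta> v)) \<le>
          (1 + norm v) ^ Suc (DIM('a)) * ((1 + norm v)\<^sup>2 * norm (\<eta> v))"
        by (intro mult_left_mono mult_right_mono power_mono) auto
      also have "\<dots> = (1 + norm v) ^ (2 + Suc (DIM('a))) * norm (\<eta> v)"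
        by (simp only: power_add mult_ac)
      finally show "(1 + norm (0 - v)) ^ Suc DIM('a) * norm ((norm v)\<^sup>2 * cmod (\<eta> v)) \<le> C"
        using C[of v] by (simp add: norm_mult del: power_Suc)
    qed auto
    fix h \<xi> :: 'a
    have "cis (- ((z + h) \<bullet> \<xi>)) = cis (- (z \<bullet> \<xi>)) * cis (- (h \<bullet> \<xi>))"
      by (simp add: inner_add_left cis_mult add.commute)
    then have "cis (- ((z + h) \<bullet> \<xi>)) * \<eta> \<xi> - cis (- (z \<bullet> \<xi>)) * \<eta> \<xi> - cis (- (z \<bullet> \<xi>)) * (- \<i> * of_real (h \<bullet> \<xi>) * \<eta> \<xi>)
      = cis (- (z \<bullet> \<xi>)) * ((cis (- (h \<bullet> \<xi>)) - 1 - \<i> * of_real (- (h \<bullet> \<xi>))) * \<eta> \<xi>)"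
      by (simp add: algebra_simps)
    then have "norm (cis (- ((z + h) \<bullet> \<xi>)) * \<eta> \<xi> - cis (- (z \<bullet> \<xi>)) * \<eta> \<xi> - cis (- (z \<bullet> \<xi>)) * (- \<i> * of_real (h \<bullet> \<xi>) * \<eta> \<xi>))
      = norm (cis (- (h \<bullet> \<xi>)) - 1 - \<i> * of_real (- (h \<bullet> \<xi>))) * norm (\<eta> \<xi>)"
      by (simp add: norm_mult)
    also have "\<dots> \<le> (- (h \<bullet> \<xi>))\<^sup>2 * norm (\<eta> \<xi>)"
      by (intro mult_right_mono cis_second_order) auto
    also have "\<dots> \<le> ((norm h * norm \<xi>)\<^sup>2) * norm (\<eta> \<xi>)"
      using Cauchy_Schwarz_ineq2[of h \<xi>] by (intro mult_right_mono) (auto simp: abs_le_square_iff[symmetric])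
    finally show "norm (cis (- ((z + h) \<bullet> \<xi>)) * \<eta> \<xi> - cis (- (z \<bullet> \<xi>)) * \<eta> \<xi> - cis (- (z \<bullet> \<xi>)) * (- \<i> * of_real (h \<bullet> \<xi>) * \<eta> \<xi>))
       \<le> (norm h)\<^sup>2 * ((norm \<xi>)\<^sup>2 * norm (\<eta> \<xi>))" by (simp add: power_mult_distrib)
  qed (intro integrable_cis_mult test_fun_integrable \<eta>, simp)
  then show ?thesis unfolding mult_kernel_def[abs_def] by (rule has_derivative_mult_right)
qed

lemma pd_mult_kernel:
  fixes \<eta> :: "'a::euclidean_space \<Rightarrow> complex"
  assumes "\<eta> \<in> test_fun"
  shows "pd b (mult_kernel \<eta>) = mult_kernel (\<lambda>\<xi>. - \<i> * of_real (b \<bullet> \<xi>) * \<eta> \<xi>)"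
  by (rule pd_eqI[OF mult_kernel_has_derivative[OF assms]])

lemma test_fun_pd:
  fixes \<eta> :: "'a::euclidean_space \<Rightarrow> complex"
  assumes "\<eta> \<in> test_fun" "b \<in> Basis"
  shows "pd b \<eta> \<in> test_fun"
proof -
  obtain R where R: "R > 0" "\<And>x. norm x > R \<Longrightarrow> \<eta> x = 0" using test_fun_bounded_support[OF assms(1)] by metis
  show ?thesis
  proof (rule test_funI[of _ R])
    show "pd b \<eta> x = 0" if "norm x > R" for x
      using iter_deriv_support[of "cball 0 R" \<eta> x "[b]"] R that by auto
  qed (intro smooth_pd test_fun_smooth assms)
qed

text \<open>The modulated convolution \<open>\<integral> cis (v \<bullet> z) \<eta> (y - v) dv = cis (z \<bullet> y) \<integral> cis (- (z \<bullet> v)) \<eta> v dv\<close>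
  can be differentiated at \<open>y = 0\<close> in two ways, which replaces integration by parts.\<close>
lemma mult_kernel_pd:
  fixes \<eta> :: "'a::euclidean_space \<Rightarrow> complex"
  assumes \<eta>: "\<eta> \<in> test_fun" and b: "b \<in> Basis"
  shows "mult_kernel (pd b \<eta>) z = \<i> * of_real (z \<bullet> b) * mult_kernel \<eta> z"
proof -
  have [measurable]: "\<eta> \<in> borel_measurable borel" "pd b \<eta> \<in> borel_measurable borel"
    using test_fun_measurable test_fun_pd \<eta> b by blast+
  let ?w = "\<lambda>v. cis (z \<bullet> v)"
  let ?I = "LINT v|lborel. cis (- (z \<bullet> v)) * \<eta> v"
  have w: "slowly_growing ?w"
    unfolding slowly_growing_def by (auto intro!: exI[of _ "1::real"] exI[of _ "0::nat"])
  have conv: "conv ?w k y = cis (z \<bullet> y) * (LINT v|lborel. cis (- (z \<bullet> v)) * k v)"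
    if [measurable]: "k \<in> borel_measurable borel" for k :: "'a \<Rightarrow> complex" and y
  proof -
    have "conv ?w k y = (LINT v|lborel. cis (z \<bullet> (y - v)) * k v)"
      unfolding conv_def by (subst lborel_integral_reflect(1)[symmetric, of _ y]) auto
    also have "\<dots> = (LINT v|lborel. cis (z \<bullet> y) * (cis (- (z \<bullet> v)) * k v))"
      by (simp add: inner_diff_right mult.assoc[symmetric] cis_mult)
    finally show ?thesis by simp
  qed
  have "((\<lambda>y. cis (z \<bullet> y)) has_derivative (\<lambda>h. (z \<bullet> h) *\<^sub>R \<i>)) (at 0)"
  proof -
    have "((\<lambda>y. \<i> * complex_of_real (z \<bullet> y)) has_derivative (\<lambda>h. \<i> * of_real (z \<bullet> h))) (at 0)"
      by (intro has_derivative_mult_right bounded_linear.has_derivative[OF bounded_linear_of_real]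
          has_derivative_inner_right has_derivative_ident)
    moreover have "(exp has_derivative (\<lambda>h. h)) (at (\<i> * complex_of_real (z \<bullet> 0)))"
    proof -
      have "(*) (exp (0::complex)) = (\<lambda>h. h)" by auto
      then show ?thesis using DERIV_exp[of "0::complex"] unfolding has_field_derivative_def by simp
    qed
    ultimately have "((\<lambda>y. exp (\<i> * complex_of_real (z \<bullet> y))) has_derivative (\<lambda>h. \<i> * of_real (z \<bullet> h))) (at 0)"
      by (rule has_derivative_compose)
    then show ?thesis by (simp add: cis_conv_exp scaleR_conv_of_real mult.commute)
  qed
  then have "((\<lambda>y. cis (z \<bullet> y) * ?I) has_derivative (\<lambda>h. ((z \<bullet> h) *\<^sub>R \<i>) * ?I)) (at 0)"
    by (rule has_derivative_mult_left)
  then have d: "(conv ?w \<eta> has_derivative (\<lambda>h. ((z \<bullet> h) *\<^sub>R \<i>) * ?I)) (at 0)"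
    using ext[of "conv ?w \<eta>", OF conv[of \<eta>]] by simp
  have "pd b (conv ?w \<eta>) 0 = ((z \<bullet> b) *\<^sub>R \<i>) * ?I"
    by (rule fun_cong[OF frechet_derivative_at[OF d], symmetric])
  moreover have "pd b (conv ?w \<eta>) 0 = (LINT v|lborel. cis (- (z \<bullet> v)) * pd b \<eta> v)"
    using pd_conv[OF w test_fun_schwartz[OF \<eta>], of b] conv[of "pd b \<eta>" 0] by (simp add: fun_eq_iff)
  ultimately show ?thesis by (simp add: mult_kernel_def scaleR_conv_of_real)
qed

text \<open>One power of \<open>1 + norm z\<close> is dominated by 1 plus the coordinates of
  \<open>z\<close>, and multiplication by a coordinate amounts to differentiating the symbol. Since
  the derivative is again a test function, the induction over \<open>N\<close> runs over all symbols
  simultaneously.\<close>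

lemma mult_kernel_decay:
  fixes \<eta> :: "'a::euclidean_space \<Rightarrow> complex"
  assumes "\<eta> \<in> test_fun"
  shows "\<exists>C. \<forall>z. (1 + norm z) ^ N * norm (mult_kernel \<eta> z) \<le> C"
  using assms
proof (induction N arbitrary: \<eta>)
  case 0
  have "norm (mult_kernel \<eta> z) \<le> norm (complex_of_real ((2 * pi) powr (- real DIM('a)))) * (LINT \<xi>|lborel. norm (cis (- (z \<bullet> \<xi>)) * \<eta> \<xi>))" for z
    unfolding mult_kernel_def norm_mult[of "complex_of_real _"] by (intro mult_left_mono integral_norm_bound) auto
  then show ?case by (auto simp: norm_mult)
next
  case (Suc N)
  obtain C0 where C0: "\<And>z. (1 + norm z) ^ N * norm (mult_kernel \<eta> z) \<le> C0"
    using Suc by metis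
  obtain C where C: "\<And>b z. b \<in> Basis \<Longrightarrow> (1 + norm z) ^ N * norm (mult_kernel (pd b \<eta>) z) \<le> C b"
    using Suc.IH[OF test_fun_pd[OF Suc.prems]] by metis
  have "(1 + norm z) ^ Suc N * norm (mult_kernel \<eta> z) \<le> C0 + (\<Sum>b\<in>Basis. C b)" for z
  proof -
    have "(1 + norm z) * norm (mult_kernel \<eta> z) \<le> (1 + (\<Sum>b\<in>Basis. \<bar>z \<bullet> b\<bar>)) * norm (mult_kernel \<eta> z)"
      by (intro mult_right_mono add_left_mono norm_le_l1) auto
    also have "\<dots> = norm (mult_kernel \<eta> z) + (\<Sum>b\<in>Basis. norm (mult_kernel (pd b \<eta>) z))"
      by (simp add: mult_kernel_pd[OF Suc.prems] norm_mult distrib_right sum_distrib_right)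
    finally have "(1 + norm z) ^ N * ((1 + norm z) * norm (mult_kernel \<eta> z)) \<le>
       (1 + norm z) ^ N * (norm (mult_kernel \<eta> z) + (\<Sum>b\<in>Basis. norm (mult_kernel (pd b \<eta>) z)))"
      by (rule mult_left_mono) simp
    also have "\<dots> = (1 + norm z) ^ N * norm (mult_kernel \<eta> z) + (\<Sum>b\<in>Basis. (1 + norm z) ^ N * norm (mult_kernel (pd b \<eta>) z))"
      by (simp add: distrib_left sum_distrib_left)
    also have "\<dots> \<le> C0 + (\<Sum>b\<in>Basis. C b)" by (intro add_mono C0 sum_mono C)
    finally show ?thesis by (simp add: mult_ac)
  qed
  then show ?case by blast
qed

lemma iter_deriv_mult_kernel:
  assumes "\<eta> \<in> test_fun"
  obtains \<eta>' where "\<eta>' \<in> test_fun" "iter_deriv bs (mult_kernel \<eta>) = mult_kernel \<eta>'"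
proof -
  have "\<exists>\<eta>'\<in>test_fun. iter_deriv bs (mult_kernel \<eta>) = mult_kernel \<eta>'"
  proof (induction bs)
    case (Cons b bs)
    then obtain \<eta>' where "\<eta>' \<in> test_fun" "iter_deriv bs (mult_kernel \<eta>) = mult_kernel \<eta>'" by blast
    then show ?case using pd_mult_kernel[of \<eta>' b] test_fun_mult_inner[of \<eta>' b] by auto
  qed (use assms in auto)
  then show ?thesis using that by blast
qed

lemma mult_kernel_schwartz:
  fixes \<eta> :: "'a::euclidean_space \<Rightarrow> complex"
  assumes "\<eta> \<in> test_fun"
  shows "mult_kernel \<eta> \<in> schwartz"
proof (rule schwartzI)
  show "smooth (mult_kernel \<eta>)"
  proof (rule smooth_coinduct[where P="mult_kernel ` test_fun"], goal_cases)
    case (2 h x)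
    then show ?case using mult_kernel_has_derivative by (auto simp: differentiable_def)
  next
    case (3 h b)
    then show ?case using pd_mult_kernel test_fun_mult_inner by (force simp del: mult_minus_left)
  qed (use assms in auto)
  fix N and bs :: "'a list"
  obtain \<eta>' where "\<eta>' \<in> test_fun" "iter_deriv bs (mult_kernel \<eta>) = mult_kernel \<eta>'"
    using iter_deriv_mult_kernel[OF assms] by metis
  then show "\<exists>C. \<forall>x. (1 + norm x) ^ N * norm (iter_deriv bs (mult_kernel \<eta>) x) \<le> C"
    using mult_kernel_decay by metis
qed

text \<open>With \<open>c\<close> bounded by 1, in the applications a complex exponential, the
  double integral is dominated by the product of the two L1 norms.\<close>

lemma fubini_swap:
  fixes f :: "'a::euclidean_space \<Rightarrow> complex" and g :: "'b::euclidean_space \<Rightarrow> complex"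
  assumes f: "integrable lborel f" and g: "integrable lborel g"
    and [measurable]: "(\<lambda>(x, y). c x y) \<in> borel_measurable (borel \<Otimes>\<^sub>M borel)"
    and c: "\<And>x y. norm (c x y) \<le> 1"
  shows "(LINT x|lborel. f x * (LINT y|lborel. c x y * g y)) = (LINT y|lborel. g y * (LINT x|lborel. c x y * f x))"
proof -
  have [measurable]: "f \<in> borel_measurable borel" "g \<in> borel_measurable borel"
    using borel_measurable_integrable f g by force+
  have int1: "integrable lborel (\<lambda>y. c x y * g y)" for x
    by (rule Bochner_Integration.integrable_bound[OF g]) (auto simp: norm_mult intro!: mult_left_le_one_le c)
  have int2: "integrable lborel (\<lambda>x. c x y * f x)" for y
    by (rule Bochner_Integration.integrable_bound[OF f]) (auto simp: norm_mult intro!: mult_left_le_one_le c)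
  have I: "integrable (lborel \<Otimes>\<^sub>M lborel) (\<lambda>(x, y). f x * (c x y * g y))"
  proof (rule lborel_pair.Fubini_integrable)
    show "AE x in lborel. integrable lborel (\<lambda>y. case (x, y) of (x, y) \<Rightarrow> f x * (c x y * g y))"
      using int1 by auto
    have "integrable lborel (\<lambda>x. norm (f x) * (LINT y|lborel. norm (c x y * g y)))"
    proof (rule Bochner_Integration.integrable_bound)
      show "integrable lborel (\<lambda>x. norm (f x) * (LINT y|lborel. norm (g y)))" using f by auto
      have "(LINT y|lborel. norm (c x y * g y)) \<le> (LINT y|lborel. norm (g y))" for x
        by (intro integral_mono integrable_norm int1 g) (auto simp: norm_mult intro!: mult_left_le_one_le c)
      then show "AE x in lborel. norm (norm (f x) * (LINT y|lborel. norm (c x y * g y)))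
         \<le> norm (norm (f x) * (LINT y|lborel. norm (g y)))"
        by (auto simp: abs_mult intro!: mult_left_mono)
    qed measurable
    then show "integrable lborel (\<lambda>x. LINT y|lborel. norm (case (x, y) of (x, y) \<Rightarrow> f x * (c x y * g y)))"
      by (simp add: norm_mult mult.assoc)
  qed measurable
  have "(LINT x|lborel. f x * (LINT y|lborel. c x y * g y)) = (LINT x|lborel. LINT y|lborel. f x * (c x y * g y))"
    by (simp add: int1)
  also have "\<dots> = (LINT y|lborel. LINT x|lborel. f x * (c x y * g y))"
    using lborel_pair.Fubini_integral[OF I] by simp
  also have "\<dots> = (LINT y|lborel. LINT x|lborel. g y * (c x y * f x))"
    by (simp add: mult_ac)
  finally show ?thesis by simp
qed

text \<open>The one-dimensional Gaussian integral is read off from the characteristic function of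
  the standard normal distribution.\<close>

lemma std_normal_char: "(LINT x|lborel. complex_of_real (exp (- x\<^sup>2 / 2)) * cis (x * t)) = of_real (sqrt (2 * pi) * exp (- t\<^sup>2 / 2))"
  "integrable lborel (\<lambda>x. complex_of_real (exp (- x\<^sup>2 / 2)) * cis (x * t))"
proof -
  have den: "complex_of_real (exp (- x\<^sup>2 / 2)) = of_real (sqrt (2 * pi)) * of_real (std_normal_density x)" for x
    by (simp add: std_normal_density_def)
  have "complex_of_real (exp (- (t^2) / 2)) = char std_normal_distribution t"
    using char_std_normal_distribution by simp
  also have "\<dots> = (CLINT x|lborel. std_normal_density x *\<^sub>R iexp (t * x))"
    unfolding char_def by (subst integral_density) auto
  finally have "complex_of_real (exp (- (t^2) / 2)) = (CLINT x|lborel. of_real (std_normal_density x) * cis (x * t))"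
    by (simp add: scaleR_conv_of_real cis_conv_exp mult_ac)
  then show "(LINT x|lborel. complex_of_real (exp (- x\<^sup>2 / 2)) * cis (x * t)) = of_real (sqrt (2 * pi) * exp (- t\<^sup>2 / 2))"
    unfolding den[of "_ :: real"] mult.assoc by (simp add: std_normal_density_def)
  have "integrable lborel (\<lambda>x. complex_of_real (sqrt (2 * pi) * std_normal_density x))"
    using integrable_std_normal_moment[of 0] by (intro integrable_of_real integrable_mult_right) simp
  then have "integrable lborel (\<lambda>x. cis (x * t) * complex_of_real (exp (- x\<^sup>2 / 2)))"
    unfolding den by (intro integrable_cis_mult) auto
  then show "integrable lborel (\<lambda>x. complex_of_real (exp (- x\<^sup>2 / 2)) * cis (x * t))"
    by (simp add: mult.commute)
qed

text \<open>Lebesgue measure is the image of the product measure over \<open>Basis\<close>, and both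
  the Gaussian and the phase factor over the coordinates, so the integral is a product of
  one-dimensional ones.\<close>

lemma gaussian_fourier:
  fixes v :: "'a::euclidean_space"
  shows "(LINT y|lborel. complex_of_real (exp (- (norm y)\<^sup>2 / 2)) * cis (y \<bullet> v)) =
      of_real ((2 * pi) powr (real DIM('a) / 2) * exp (- (norm v)\<^sup>2 / 2))"
    and "integrable lborel (\<lambda>y. complex_of_real (exp (- (norm y)\<^sup>2 / 2)) * cis (y \<bullet> v))"
proof -
  interpret product_sigma_finite "\<lambda>b::'a. lborel :: real measure" ..
  let ?P = "\<Pi>\<^sub>M b\<in>(Basis::'a set). (lborel :: real measure)"
  let ?T = "\<lambda>f. \<Sum>b\<in>(Basis::'a set). f b *\<^sub>R b"
  let ?g = "\<lambda>b x. complex_of_real (exp (- x\<^sup>2 / 2)) * cis (x * (b \<bullet> v))"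
  let ?G = "\<lambda>y. complex_of_real (exp (- (norm y)\<^sup>2 / 2)) * cis (y \<bullet> v)"
  have lb: "lborel = distr ?P borel ?T" by (subst lborel_def) (simp only: lborel_eq_real)
  have T[measurable]: "?T \<in> measurable ?P borel" by measurable
  have norm2: "(norm y)\<^sup>2 = (\<Sum>b\<in>Basis. (y \<bullet> b)\<^sup>2)" for y :: 'a
    unfolding power2_norm_eq_inner by (subst euclidean_inner) (simp add: power2_eq_square)
  have cis_sum: "cis (\<Sum>b\<in>B. h b) = (\<Prod>b\<in>B. cis (h b))" if "finite B" for B and h :: "'a \<Rightarrow> real"
    using that by (induction B rule: finite_induct) (auto simp: cis_mult[symmetric])
  have G: "?G y = (\<Prod>b\<in>Basis. ?g b (y \<bullet> b))" for y
  proof -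
    have "cis (y \<bullet> v) = (\<Prod>b\<in>Basis. cis ((y \<bullet> b) * (b \<bullet> v)))"
      by (subst euclidean_inner) (simp add: cis_sum inner_commute[of v])
    moreover have "complex_of_real (exp (- (norm y)\<^sup>2 / 2)) = (\<Prod>b\<in>Basis. complex_of_real (exp (- (y \<bullet> b)\<^sup>2 / 2)))"
      unfolding norm2 by (simp add: sum_negf[symmetric] sum_divide_distrib exp_sum)
    ultimately show ?thesis by (simp add: prod.distrib)
  qed
  have GT: "?G (?T f) = (\<Prod>b\<in>Basis. ?g b (f b))" for f
    unfolding G by (intro prod.cong refl) (simp add: inner_sum_left inner_Basis if_distrib[of "\<lambda>x. _ * x"] cong: if_cong)
  have int: "integrable ?P (\<lambda>f. \<Prod>b\<in>Basis. ?g b (f b))"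
    by (rule product_integrable_prod) (rule finite_Basis, rule std_normal_char(2))
  have m: "?G \<in> borel_measurable borel" by measurable
  show "integrable lborel ?G"
    unfolding lb by (subst integrable_distr_eq[OF T m]) (use int in \<open>simp only: GT\<close>)
  have "(LINT y|lborel. ?G y) = (LINT f|?P. (\<Prod>b\<in>Basis. ?g b (f b)))"
    unfolding lb by (subst integral_distr[OF T m]) (simp only: GT)
  also have "\<dots> = (\<Prod>b\<in>Basis. LINT x|lborel. ?g b x)"
    by (rule product_integral_prod) (rule finite_Basis, rule std_normal_char(2))
  also have "\<dots> = of_real (\<Prod>b\<in>Basis. sqrt (2 * pi) * exp (- (b \<bullet> v)\<^sup>2 / 2))"
    unfolding std_normal_char(1) by simp
  also have "(\<Prod>b\<in>Basis. sqrt (2 * pi) * exp (- (b \<bullet> v)\<^sup>2 / 2)) = sqrt (2 * pi) ^ DIM('a) * exp (- (norm v)\<^sup>2 / 2)"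
    unfolding norm2 by (simp add: prod.distrib sum_negf[symmetric] sum_divide_distrib exp_sum inner_commute)
  also have "sqrt (2 * pi) ^ DIM('a) = (2 * pi) powr (real DIM('a) / 2)"
    by (simp add: powr_half_sqrt[symmetric] powr_power)
  finally show "(LINT y|lborel. ?G y) = of_real ((2 * pi) powr (real DIM('a) / 2) * exp (- (norm v)\<^sup>2 / 2))" .
qed

text \<open>Gaussian summability. After insertion of a Gaussian damping factor of scale \<epsilon>
  in \<open>y\<close> the integrals may be interchanged, and the result is an average of \<eta>
  against a Gaussian of width \<epsilon> about \<xi>. As \<epsilon> tends to 0 the damped integral
  converges both to the integral in question and to the value of \<eta> at \<xi>.\<close>

lemma mult_kernel_inversion:
  fixes \<eta> :: "'a::euclidean_space \<Rightarrow> complex"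
  assumes \<eta>: "\<eta> \<in> test_fun"
  shows "(LINT y|lborel. mult_kernel \<eta> y * cis (y \<bullet> \<xi>)) = \<eta> \<xi>"
proof (rule LIMSEQ_unique)
  have [measurable]: "\<eta> \<in> borel_measurable borel" "mult_kernel \<eta> \<in> borel_measurable borel"
    using test_fun_measurable schwartz_measurable mult_kernel_schwartz \<eta> by blast+
  let ?c = "complex_of_real ((2 * pi) powr (- real DIM('a)))"
  let ?g = "\<lambda>y::'a. complex_of_real (exp (- (norm y)\<^sup>2 / 2))"
  let ?e = "\<lambda>n. 1 / real (Suc n)"
  let ?J = "\<lambda>n. LINT y|lborel. mult_kernel \<eta> y * (cis (y \<bullet> \<xi>) * ?g (?e n *\<^sub>R y))"
  have e0: "?e \<longlonglongrightarrow> 0" by (rule LIMSEQ_Suc[OF lim_const_over_n[of 1]])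
  have cont: "(\<lambda>n. ?g (?e n *\<^sub>R y)) \<longlonglongrightarrow> ?g (0 *\<^sub>R y)" for y :: 'a
    by (intro tendsto_of_real tendsto_exp tendsto_divide tendsto_minus tendsto_power tendsto_norm tendsto_scaleR tendsto_const e0) auto
  show "?J \<longlonglongrightarrow> (LINT y|lborel. mult_kernel \<eta> y * cis (y \<bullet> \<xi>))"
  proof (rule integral_dominated_convergence[where w="\<lambda>y. norm (mult_kernel \<eta> y)"])
    show "AE y in lborel. (\<lambda>n. mult_kernel \<eta> y * (cis (y \<bullet> \<xi>) * ?g (?e n *\<^sub>R y))) \<longlonglongrightarrow> mult_kernel \<eta> y * cis (y \<bullet> \<xi>)"
      using tendsto_mult[OF tendsto_const tendsto_mult[OF tendsto_const cont]] by (intro AE_I2) simp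
    show "AE y in lborel. norm (mult_kernel \<eta> y * (cis (y \<bullet> \<xi>) * ?g (?e n *\<^sub>R y))) \<le> norm (mult_kernel \<eta> y)" for n
      by (intro AE_I2) (auto simp: norm_mult intro!: mult_right_le_one_le)
  qed (auto intro: schwartz_integrable mult_kernel_schwartz \<eta>)
  let ?s = "(2 * pi) powr (real DIM('a) / 2)"
  have J: "?J n = ?c * of_real ?s * (LINT w|lborel. \<eta> (\<xi> + ?e n *\<^sub>R w) * ?g w)" for n
  proof -
    let ?\<epsilon> = "?e n"
    have \<epsilon>: "?\<epsilon> > 0" by simp
    \<comment> \<open>The Fourier transform of the dilated Gaussian: concentrated at distance
      \<epsilon> from \<xi>, with the normalising power of the inverse of \<epsilon>.\<close>
    have inner: "(LINT y|lborel. cis (- (y \<bullet> \<zeta>)) * (cis (y \<bullet> \<xi>) * ?g (?\<epsilon> *\<^sub>R y))) =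
        of_real (inverse ?\<epsilon> ^ DIM('a) * ?s) * ?g (inverse ?\<epsilon> *\<^sub>R (\<zeta> - \<xi>))" for \<zeta>
    proof -
      have "(LINT y|lborel. cis (- (y \<bullet> \<zeta>)) * (cis (y \<bullet> \<xi>) * ?g (?\<epsilon> *\<^sub>R y))) =
          (LINT y|lborel. ?g (?\<epsilon> *\<^sub>R y) * cis (y \<bullet> (\<xi> - \<zeta>)))"
        by (intro Bochner_Integration.integral_cong refl)
          (simp add: mult.assoc[symmetric] cis_mult inner_diff_right mult.commute)
      also have "\<dots> = (\<bar>inverse ?\<epsilon>\<bar> ^ DIM('a)) *\<^sub>R (LINT u|lborel. ?g (?\<epsilon> *\<^sub>R (0 + inverse ?\<epsilon> *\<^sub>R u)) * cis ((0 + inverse ?\<epsilon> *\<^sub>R u) \<bullet> (\<xi> - \<zeta>)))"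
        by (rule lborel_integral_scale) (use \<epsilon> in auto)
      also have "(LINT u|lborel. ?g (?\<epsilon> *\<^sub>R (0 + inverse ?\<epsilon> *\<^sub>R u)) * cis ((0 + inverse ?\<epsilon> *\<^sub>R u) \<bullet> (\<xi> - \<zeta>))) =
          (LINT u|lborel. ?g u * cis (u \<bullet> (inverse ?\<epsilon> *\<^sub>R (\<xi> - \<zeta>))))"
        by simp
      also have "\<dots> = of_real (?s * exp (- (norm (inverse ?\<epsilon> *\<^sub>R (\<xi> - \<zeta>)))\<^sup>2 / 2))"
        by (rule gaussian_fourier)
      also have "norm (inverse ?\<epsilon> *\<^sub>R (\<xi> - \<zeta>)) = norm (inverse ?\<epsilon> *\<^sub>R (\<zeta> - \<xi>))"
        by (simp add: norm_minus_commute)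
      finally show ?thesis using \<epsilon> by (simp add: scaleR_conv_of_real)
    qed
    have gint: "integrable lborel (\<lambda>y. cis (y \<bullet> \<xi>) * ?g (?\<epsilon> *\<^sub>R y))"
    proof (rule integrable_cis_mult)
      have "integrable lborel ?g" using gaussian_fourier(2)[of "0::'a"] by simp
      then show "integrable lborel (\<lambda>y. ?g (?\<epsilon> *\<^sub>R y))"
        using lborel_integral_scale(2)[of ?g ?\<epsilon> 0] \<epsilon> by simp
    qed simp
    have "?J n = ?c * (LINT y|lborel. (cis (y \<bullet> \<xi>) * ?g (?\<epsilon> *\<^sub>R y)) * (LINT \<zeta>|lborel. cis (- (y \<bullet> \<zeta>)) * \<eta> \<zeta>))"
      unfolding mult_kernel_def by (simp add: mult_ac flip: integral_mult_right_zero)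
    also have "(LINT y|lborel. (cis (y \<bullet> \<xi>) * ?g (?\<epsilon> *\<^sub>R y)) * (LINT \<zeta>|lborel. cis (- (y \<bullet> \<zeta>)) * \<eta> \<zeta>)) =
        (LINT \<zeta>|lborel. \<eta> \<zeta> * (LINT y|lborel. cis (- (y \<bullet> \<zeta>)) * (cis (y \<bullet> \<xi>) * ?g (?\<epsilon> *\<^sub>R y))))"
      by (rule fubini_swap[OF gint test_fun_integrable[OF \<eta>]]) auto
    also have "\<dots> = (LINT \<zeta>|lborel. of_real (inverse ?\<epsilon> ^ DIM('a) * ?s) * (\<eta> \<zeta> * ?g (inverse ?\<epsilon> *\<^sub>R (\<zeta> - \<xi>))))"
      unfolding inner by (simp add: mult_ac)
    also have "\<dots> = of_real (inverse ?\<epsilon> ^ DIM('a) * ?s) * (LINT \<zeta>|lborel. \<eta> \<zeta> * ?g (inverse ?\<epsilon> *\<^sub>R (\<zeta> - \<xi>)))"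
      by (rule integral_mult_right_zero)
    also have "(LINT \<zeta>|lborel. \<eta> \<zeta> * ?g (inverse ?\<epsilon> *\<^sub>R (\<zeta> - \<xi>))) = (\<bar>?\<epsilon>\<bar> ^ DIM('a)) *\<^sub>R
       (LINT w|lborel. \<eta> (\<xi> + ?\<epsilon> *\<^sub>R w) * ?g (inverse ?\<epsilon> *\<^sub>R ((\<xi> + ?\<epsilon> *\<^sub>R w) - \<xi>)))"
      by (rule lborel_integral_scale) (use \<epsilon> in auto)
    also have "(LINT w|lborel. \<eta> (\<xi> + ?\<epsilon> *\<^sub>R w) * ?g (inverse ?\<epsilon> *\<^sub>R ((\<xi> + ?\<epsilon> *\<^sub>R w) - \<xi>))) =
       (LINT w|lborel. \<eta> (\<xi> + ?\<epsilon> *\<^sub>R w) * ?g w)" by simp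
    finally have "?J n = ?c * (of_real (inverse ?\<epsilon> ^ DIM('a) * ?s) * ((\<bar>?\<epsilon>\<bar> ^ DIM('a)) *\<^sub>R (LINT w|lborel. \<eta> (\<xi> + ?\<epsilon> *\<^sub>R w) * ?g w)))" .
    \<comment> \<open>The substitution around \<xi> contributes the dimension-th power of
      \<epsilon>, which cancels the normalisation of the Gaussian.\<close>
    moreover have "of_real (inverse ?\<epsilon> ^ DIM('a) * ?s) * ((\<bar>?\<epsilon>\<bar> ^ DIM('a)) *\<^sub>R x) = of_real ?s * x" for x :: complex
    proof -
      have "inverse ?\<epsilon> ^ DIM('a) * \<bar>?\<epsilon>\<bar> ^ DIM('a) = 1" by (simp add: power_mult_distrib[symmetric])
      moreover have "complex_of_real (a * s) * (b *\<^sub>R x) = of_real (a * b) * (of_real s * x)" for a b s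
        by (simp add: scaleR_conv_of_real)
      ultimately show ?thesis by (metis mult_1 of_real_1)
    qed
    ultimately show ?thesis by (simp only: mult.assoc)
  qed
  obtain B where B: "\<And>x. norm (\<eta> x) \<le> B"
    using schwartz_rapid[OF test_fun_schwartz[OF \<eta>], of 0] by auto
  have "(\<lambda>n. LINT w|lborel. \<eta> (\<xi> + ?e n *\<^sub>R w) * ?g w) \<longlonglongrightarrow> (LINT w|lborel. \<eta> \<xi> * ?g w)"
  proof (rule integral_dominated_convergence[where w="\<lambda>y. B * norm (?g y)"])
    have "isCont \<eta> \<xi>" using smooth_isCont test_fun_smooth \<eta> by blast
    moreover have "(\<lambda>n. \<xi> + ?e n *\<^sub>R w) \<longlonglongrightarrow> \<xi> + 0 *\<^sub>R w" for w
      by (intro tendsto_add tendsto_scaleR tendsto_const e0)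
    ultimately have "(\<lambda>n. \<eta> (\<xi> + ?e n *\<^sub>R w)) \<longlonglongrightarrow> \<eta> \<xi>" for w
      using isCont_tendsto_compose[of \<xi> \<eta> "\<lambda>n. \<xi> + ?e n *\<^sub>R w"] by simp
    then show "AE w in lborel. (\<lambda>n. \<eta> (\<xi> + ?e n *\<^sub>R w) * ?g w) \<longlonglongrightarrow> \<eta> \<xi> * ?g w"
      by (intro AE_I2 tendsto_mult tendsto_const)
    show "AE w in lborel. norm (\<eta> (\<xi> + ?e n *\<^sub>R w) * ?g w) \<le> B * norm (?g w)" for n
      unfolding norm_mult by (intro AE_I2 mult_right_mono B) auto
    show "integrable lborel (\<lambda>y. B * norm (?g y))"
      using gaussian_fourier(2)[of "0::'a"] by (intro integrable_mult_right integrable_norm) simp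
  qed auto
  also have "(LINT w|lborel. \<eta> \<xi> * ?g w) = \<eta> \<xi> * of_real ?s"
    using gaussian_fourier(1)[of "0::'a"] by simp
  \<comment> \<open>The factor \<open>?s\<close> occurs twice, once from the Fourier transform of
    the Gaussian and once from its total mass; together they cancel the constant in
    \<open>mult_kernel\<close>.\<close>
  finally have "?J \<longlonglongrightarrow> ?c * of_real ?s * (\<eta> \<xi> * of_real ?s)"
    unfolding J by (intro tendsto_mult tendsto_const)
  also have "?c * of_real ?s * (\<eta> \<xi> * of_real ?s) = of_real ((2 * pi) powr (- real DIM('a)) * (?s * ?s)) * \<eta> \<xi>" by simp
  also have "(2 * pi) powr (- real DIM('a)) * (?s * ?s) = 1"
    by (simp add: powr_add[symmetric])
  finally show "?J \<longlonglongrightarrow> \<eta> \<xi>" by simp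
qed

lemma mult_kernel_inversion_shift:
  fixes \<eta> :: "'a::euclidean_space \<Rightarrow> complex"
  assumes \<eta>: "\<eta> \<in> test_fun"
  shows "(LINT v|lborel. mult_kernel \<eta> (v - z) * cis (v \<bullet> \<xi>)) = cis (z \<bullet> \<xi>) * \<eta> \<xi>"
proof -
  have [measurable]: "mult_kernel \<eta> \<in> borel_measurable borel"
    using schwartz_measurable mult_kernel_schwartz \<eta> by blast
  have "(LINT v|lborel. mult_kernel \<eta> (v - z) * cis (v \<bullet> \<xi>)) = (LINT y|lborel. mult_kernel \<eta> (z + y - z) * cis ((z + y) \<bullet> \<xi>))"
    by (rule lborel_integral_translate(1)[symmetric]) simp
  also have "\<dots> = (LINT y|lborel. cis (z \<bullet> \<xi>) * (mult_kernel \<eta> y * cis (y \<bullet> \<xi>)))"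
    by (simp add: inner_add_left cis_mult[symmetric] mult_ac)
  finally show ?thesis by (simp add: mult_kernel_inversion[OF \<eta>])
qed

text \<open>Both factors of \<open>mult_kernel H (v - x) * mult_kernel \<eta> (y - v)\<close> are band limited in \<open>v\<close>, hence so
  is the product, and convolving with a kernel whose symbol is 1 on the difference set of
  the bands reproduces it.\<close>
lemma mult_kernel_reproduce_product:
  fixes \<eta> H \<Theta> :: "'a::euclidean_space \<Rightarrow> complex"
  assumes \<eta>: "\<eta> \<in> test_fun" and H: "H \<in> test_fun" and \<Theta>: "\<Theta> \<in> test_fun"
    and one: "\<And>\<xi> \<zeta>. \<eta> \<xi> \<noteq> 0 \<Longrightarrow> H \<zeta> \<noteq> 0 \<Longrightarrow> \<Theta> (\<xi> - \<zeta>) = 1"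
  shows "(LINT v|lborel. (mult_kernel \<Theta> (v - z) * mult_kernel H (v - x)) * mult_kernel \<eta> (y - v)) =
     mult_kernel H (z - x) * mult_kernel \<eta> (y - z)"
proof -
  let ?c = "complex_of_real ((2 * pi) powr (- real DIM('a)))"
  have [measurable]: "mult_kernel \<eta> \<in> borel_measurable borel" "mult_kernel \<Theta> \<in> borel_measurable borel"
    using schwartz_measurable mult_kernel_schwartz \<eta> \<Theta> by blast+
  have sc: "(\<lambda>v. mult_kernel \<Theta> (v - z)) \<in> schwartz"
    by (intro schwartz_translate mult_kernel_schwartz \<Theta>)
  have int: "integrable lborel (\<lambda>v. mult_kernel \<Theta> (v - z) * mult_kernel \<eta> (y - v))"
    by (rule conv_integrable[OF schwartz_slowly_growing[OF sc] mult_kernel_schwartz[OF \<eta>]])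
  have inner: "(LINT v|lborel. cis (- ((v - x) \<bullet> \<zeta>)) * (mult_kernel \<Theta> (v - z) * mult_kernel \<eta> (y - v))) =
     cis (- ((z - x) \<bullet> \<zeta>)) * mult_kernel \<eta> (y - z)" if "H \<zeta> \<noteq> 0" for \<zeta>
  proof -
    have "(LINT v|lborel. cis (- ((v - x) \<bullet> \<zeta>)) * (mult_kernel \<Theta> (v - z) * mult_kernel \<eta> (y - v))) =
       ?c * (LINT v|lborel. cis (- ((v - x) \<bullet> \<zeta>)) * mult_kernel \<Theta> (v - z) * (LINT \<xi>|lborel. cis (- ((y - v) \<bullet> \<xi>)) * \<eta> \<xi>))"
      unfolding mult_kernel_def[of \<eta>] by (simp add: mult_ac flip: integral_mult_right_zero)
    also have "\<dots> = ?c * (LINT \<xi>|lborel. \<eta> \<xi> * (LINT v|lborel. cis (- ((y - v) \<bullet> \<xi>)) * (cis (- ((v - x) \<bullet> \<zeta>)) * mult_kernel \<Theta> (v - z))))"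
      by (rule arg_cong[OF fubini_swap[OF integrable_cis_mult[OF schwartz_integrable[OF sc]] test_fun_integrable[OF \<eta>]]]) auto
    also have "(\<lambda>\<xi>. \<eta> \<xi> * (LINT v|lborel. cis (- ((y - v) \<bullet> \<xi>)) * (cis (- ((v - x) \<bullet> \<zeta>)) * mult_kernel \<Theta> (v - z)))) =
       (\<lambda>\<xi>. cis (- ((z - x) \<bullet> \<zeta>)) * (cis (- ((y - z) \<bullet> \<xi>)) * \<eta> \<xi>))"
    proof
      fix \<xi>
      have "(LINT v|lborel. cis (- ((y - v) \<bullet> \<xi>)) * (cis (- ((v - x) \<bullet> \<zeta>)) * mult_kernel \<Theta> (v - z))) =
         (LINT v|lborel. cis (x \<bullet> \<zeta> - y \<bullet> \<xi>) * (mult_kernel \<Theta> (v - z) * cis (v \<bullet> (\<xi> - \<zeta>))))"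
      proof (intro Bochner_Integration.integral_cong refl)
        fix v
        have "cis (- ((y - v) \<bullet> \<xi>)) * cis (- ((v - x) \<bullet> \<zeta>)) = cis (x \<bullet> \<zeta> - y \<bullet> \<xi>) * cis (v \<bullet> (\<xi> - \<zeta>))"
          by (simp add: cis_mult algebra_simps)
        then show "cis (- ((y - v) \<bullet> \<xi>)) * (cis (- ((v - x) \<bullet> \<zeta>)) * mult_kernel \<Theta> (v - z)) =
           cis (x \<bullet> \<zeta> - y \<bullet> \<xi>) * (mult_kernel \<Theta> (v - z) * cis (v \<bullet> (\<xi> - \<zeta>)))"
          by (simp add: mult.assoc[symmetric])
      qed
      \<comment> \<open>Inversion for \<Theta> evaluates the integral over \<open>v\<close> and
        leaves the factor \<open>\<Theta> (\<xi> - \<zeta>)\<close>, which equals 1 wherever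
        \<open>\<eta> \<xi>\<close> and \<open>H \<zeta>\<close> are both nonzero.\<close>
      also have "\<dots> = cis (x \<bullet> \<zeta> - y \<bullet> \<xi>) * (cis (z \<bullet> (\<xi> - \<zeta>)) * \<Theta> (\<xi> - \<zeta>))"
        by (simp only: integral_mult_right_zero mult_kernel_inversion_shift[OF \<Theta>])
      also have "\<dots> = cis (- ((z - x) \<bullet> \<zeta>)) * cis (- ((y - z) \<bullet> \<xi>)) * \<Theta> (\<xi> - \<zeta>)"
      proof -
        have "cis (x \<bullet> \<zeta> - y \<bullet> \<xi>) * cis (z \<bullet> (\<xi> - \<zeta>)) = cis (- ((z - x) \<bullet> \<zeta>)) * cis (- ((y - z) \<bullet> \<xi>))"
          by (simp add: cis_mult inner_diff_left inner_diff_right)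
            (rule arg_cong[of _ _ cis], simp)
        then show ?thesis by (simp only: mult.assoc[symmetric])
      qed
      finally show "\<eta> \<xi> * (LINT v|lborel. cis (- ((y - v) \<bullet> \<xi>)) * (cis (- ((v - x) \<bullet> \<zeta>)) * mult_kernel \<Theta> (v - z))) =
         cis (- ((z - x) \<bullet> \<zeta>)) * (cis (- ((y - z) \<bullet> \<xi>)) * \<eta> \<xi>)"
        using one[of \<xi> \<zeta>] that by (cases "\<eta> \<xi> = 0") auto
    qed
    finally show ?thesis
      unfolding mult_kernel_def[of \<eta>] integral_mult_right_zero by (simp only: mult.left_commute)
  qed
  have "(LINT v|lborel. (mult_kernel \<Theta> (v - z) * mult_kernel H (v - x)) * mult_kernel \<eta> (y - v)) =
     ?c * (LINT v|lborel. (mult_kernel \<Theta> (v - z) * mult_kernel \<eta> (y - v)) * (LINT \<zeta>|lborel. cis (- ((v - x) \<bullet> \<zeta>)) * H \<zeta>))"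
    unfolding mult_kernel_def[of H] by (simp add: mult_ac flip: integral_mult_right_zero)
  also have "\<dots> = ?c * (LINT \<zeta>|lborel. H \<zeta> * (LINT v|lborel. cis (- ((v - x) \<bullet> \<zeta>)) * (mult_kernel \<Theta> (v - z) * mult_kernel \<eta> (y - v))))"
    by (rule arg_cong[OF fubini_swap[OF int test_fun_integrable[OF H]]]) auto
  also have "(\<lambda>\<zeta>. H \<zeta> * (LINT v|lborel. cis (- ((v - x) \<bullet> \<zeta>)) * (mult_kernel \<Theta> (v - z) * mult_kernel \<eta> (y - v)))) =
     (\<lambda>\<zeta>. (cis (- ((z - x) \<bullet> \<zeta>)) * H \<zeta>) * mult_kernel \<eta> (y - z))"
  proof
    fix \<zeta>
    show "H \<zeta> * (LINT v|lborel. cis (- ((v - x) \<bullet> \<zeta>)) * (mult_kernel \<Theta> (v - z) * mult_kernel \<eta> (y - v))) =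
      (cis (- ((z - x) \<bullet> \<zeta>)) * H \<zeta>) * mult_kernel \<eta> (y - z)"
    proof (cases "H \<zeta> = 0")
      case False
      show ?thesis unfolding inner[OF False] by (simp only: mult_ac)
    qed simp
  qed
  finally show ?thesis
    unfolding mult_kernel_def[of H] integral_mult_left_zero by (simp only: mult.assoc)
qed

text \<open>The convolution theorem at the level of kernels: after Fubini the inversion formula for
  \<open>H\<close> evaluates the inner integral, so the symbols multiply.\<close>

lemma conv_mult_kernel:
  fixes \<eta> H :: "'a::euclidean_space \<Rightarrow> complex"
  assumes \<eta>: "\<eta> \<in> test_fun" and H: "H \<in> test_fun"
  shows "conv (\<lambda>v. mult_kernel H (v - x)) (mult_kernel \<eta>) y = mult_kernel (\<lambda>\<xi>. \<eta> \<xi> * H \<xi>) (y - x)"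
proof -
  let ?c = "complex_of_real ((2 * pi) powr (- real DIM('a)))"
  have [measurable]: "mult_kernel H \<in> borel_measurable borel"
    using schwartz_measurable mult_kernel_schwartz H by blast
  have "conv (\<lambda>v. mult_kernel H (v - x)) (mult_kernel \<eta>) y =
     ?c * (LINT v|lborel. mult_kernel H (v - x) * (LINT \<xi>|lborel. cis (- ((y - v) \<bullet> \<xi>)) * \<eta> \<xi>))"
    unfolding conv_def mult_kernel_def[of \<eta>] by (simp add: mult_ac flip: integral_mult_right_zero)
  also have "\<dots> = ?c * (LINT \<xi>|lborel. \<eta> \<xi> * (LINT v|lborel. cis (- ((y - v) \<bullet> \<xi>)) * mult_kernel H (v - x)))"
    by (rule arg_cong[OF fubini_swap[OF schwartz_integrable[OF schwartz_translate[OF mult_kernel_schwartz[OF H]]]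
        test_fun_integrable[OF \<eta>]]]) auto
  also have "(\<lambda>\<xi>. (LINT v|lborel. cis (- ((y - v) \<bullet> \<xi>)) * mult_kernel H (v - x))) =
     (\<lambda>\<xi>. (LINT v|lborel. cis (- (y \<bullet> \<xi>)) * (mult_kernel H (v - x) * cis (v \<bullet> \<xi>))))"
  proof (intro ext Bochner_Integration.integral_cong refl)
    fix \<xi> v
    have "cis (- ((y - v) \<bullet> \<xi>)) = cis (- (y \<bullet> \<xi>)) * cis (v \<bullet> \<xi>)"
      by (simp add: cis_mult inner_diff_left)
    then show "cis (- ((y - v) \<bullet> \<xi>)) * mult_kernel H (v - x) = cis (- (y \<bullet> \<xi>)) * (mult_kernel H (v - x) * cis (v \<bullet> \<xi>))"
      by simp
  qed
  also have "\<dots> = (\<lambda>\<xi>. cis (- ((y - x) \<bullet> \<xi>)) * H \<xi>)"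
    unfolding integral_mult_right_zero mult_kernel_inversion_shift[OF H]
    by (simp add: mult.assoc[symmetric] cis_mult inner_diff_left)
  finally show ?thesis unfolding mult_kernel_def[of "\<lambda>\<xi>. \<eta> \<xi> * H \<xi>"] by (simp only: mult_ac)
qed

text \<open>By duality, testing the multiplier against \<phi> means applying the distribution to the
  left-hand side. The identity exhibits this function as a convolution, hence as a superposition of
  translates of one Schwartz kernel.\<close>

lemma fourier_mult_inv_fourier:
  fixes \<eta> \<phi> :: "'a::euclidean_space \<Rightarrow> complex"
  assumes \<eta>: "\<eta> \<in> test_fun" and \<phi>: "\<phi> \<in> test_fun"
  shows "fourier (\<lambda>\<xi>. \<eta> \<xi> * inv_fourier \<phi> \<xi>) = conv \<phi> (mult_kernel \<eta>)"
proof
  fix z :: 'a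
  let ?h = "complex_of_real ((2 * pi) powr (- real DIM('a) / 2))"
  have [measurable]: "\<phi> \<in> borel_measurable borel" "\<eta> \<in> borel_measurable borel"
    using \<eta> \<phi> test_fun_measurable by auto
  have c: "?h * ?h = complex_of_real ((2 * pi) powr (- real DIM('a)))"
    unfolding of_real_mult[symmetric] by (simp add: powr_add[symmetric])
  have "fourier (\<lambda>\<xi>. \<eta> \<xi> * inv_fourier \<phi> \<xi>) z =
     ?h * (LINT \<xi>|lborel. ?h * ((cis (- (z \<bullet> \<xi>)) * \<eta> \<xi>) * (LINT x|lborel. cis (x \<bullet> \<xi>) * \<phi> x)))"
    unfolding fourier_def inv_fourier_def by (simp only: mult_ac inner_commute)
  also have "\<dots> = ?h * ?h * (LINT \<xi>|lborel. (cis (- (z \<bullet> \<xi>)) * \<eta> \<xi>) * (LINT x|lborel. cis (x \<bullet> \<xi>) * \<phi> x))"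
    by (simp only: integral_mult_right_zero mult.assoc)
  also have "\<dots> = ?h * ?h * (LINT x|lborel. \<phi> x * (LINT \<xi>|lborel. cis (x \<bullet> \<xi>) * (cis (- (z \<bullet> \<xi>)) * \<eta> \<xi>)))"
    by (rule arg_cong[OF fubini_swap[OF integrable_cis_mult[OF test_fun_integrable[OF \<eta>]] test_fun_integrable[OF \<phi>]]]) auto
  also have "\<dots> = (LINT x|lborel. \<phi> x * (?h * ?h * (LINT \<xi>|lborel. cis (- ((z - x) \<bullet> \<xi>)) * \<eta> \<xi>)))"
  proof -
    have "cis (x \<bullet> \<xi>) * (cis (- (z \<bullet> \<xi>)) * \<eta> \<xi>) = cis (- ((z - x) \<bullet> \<xi>)) * \<eta> \<xi>" for x \<xi>
      by (simp add: mult.assoc[symmetric] cis_mult inner_diff_left)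
    then show ?thesis
      by (simp only: integral_mult_right_zero[symmetric] mult.left_commute[of "\<phi> _" "?h * ?h"])
  qed
  also have "\<dots> = conv \<phi> (mult_kernel \<eta>) z"
    unfolding conv_def mult_kernel_def c ..
  finally show "fourier (\<lambda>\<xi>. \<eta> \<xi> * inv_fourier \<phi> \<xi>) z = conv \<phi> (mult_kernel \<eta>) z" .
qed

section \<open>Tempered distributions\<close>

lemma tempered_add: "T \<in> tempered \<Longrightarrow> \<phi> \<in> schwartz \<Longrightarrow> \<theta> \<in> schwartz \<Longrightarrow> T (\<lambda>x. \<phi> x + \<theta> x) = T \<phi> + T \<theta>"
  and tempered_cmult: "T \<in> tempered \<Longrightarrow> \<phi> \<in> schwartz \<Longrightarrow> T (\<lambda>x. c * \<phi> x) = c * T \<phi>"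
  by (auto simp: tempered_def)

lemma tempered_diff:
  assumes "T \<in> tempered" "\<phi> \<in> schwartz" "\<theta> \<in> schwartz"
  shows "T (\<lambda>x. \<phi> x - \<theta> x) = T \<phi> - T \<theta>"
  using tempered_add[OF assms(1,2) schwartz_cmult[OF assms(3), of "-1"]] tempered_cmult[OF assms(1,3), of "-1"] by simp

lemma tempered_sum:
  assumes "T \<in> tempered" "finite I" "\<And>i. i \<in> I \<Longrightarrow> f i \<in> schwartz"
  shows "T (\<lambda>x. \<Sum>i\<in>I. f i x) = (\<Sum>i\<in>I. T (f i))"
  using assms(2,3)
proof (induction I rule: finite_induct)
  case empty
  show ?case using tempered_cmult[OF assms(1) schwartz_zero, of 0] by simp
next
  case (insert i I)
  then show ?case by (simp add: tempered_add[OF assms(1)] schwartz_sum)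
qed

text \<open>A pointwise bound for every derivative separately, which is easier to establish for
  differences and convolutions than the supremum of a weighted sum in
  \<open>tempered\<close>.\<close>

definition seminorm_le :: "nat \<Rightarrow> ('a::euclidean_space \<Rightarrow> complex) \<Rightarrow> real \<Rightarrow> bool" where
  "seminorm_le N \<phi> M \<longleftrightarrow> (\<forall>x bs. set bs \<subseteq> Basis \<longrightarrow> length bs \<le> N \<longrightarrow> (1 + norm x) ^ N * norm (iter_deriv bs \<phi> x) \<le> M)"

lemma tempered_bound:
  assumes T: "T \<in> tempered"
  obtains C N where "C > 0" "\<And>\<phi> M. \<phi> \<in> schwartz \<Longrightarrow> seminorm_le N \<phi> M \<Longrightarrow>
     norm (T \<phi>) \<le> C * M"
proof -
  obtain C0 N where C0: "\<And>\<phi>. \<phi> \<in> schwartz \<Longrightarrow> cmod (T \<phi>) \<le> C0 * (SUP x. schwartz_weight N \<phi> x)"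
    using T unfolding tempered_def by blast
  let ?S = "{bs :: 'a list. set bs \<subseteq> Basis \<and> length bs \<le> N}"
  let ?n = "real (card ?S)"
  \<comment> \<open>The sum in \<open>schwartz_weight\<close> has \<open>?n\<close> terms, each at
    most \<open>M\<close>. The sign of \<open>C0\<close> is unknown, hence the absolute value, and
    adding 1 makes the constant positive.\<close>
  have "norm (T \<phi>) \<le> ((\<bar>C0\<bar> + 1) * (?n + 1)) * M" if \<phi>: "\<phi> \<in> schwartz" and le: "seminorm_le N \<phi> M" for \<phi> M
  proof -
    have M: "\<And>x bs. set bs \<subseteq> Basis \<Longrightarrow> length bs \<le> N \<Longrightarrow> (1 + norm x) ^ N * norm (iter_deriv bs \<phi> x) \<le> M"
      using le by (simp add: seminorm_le_def)
    have M0: "0 \<le> M" using M[of "[]" 0] by (auto intro: order_trans[rotated])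
    have w: "schwartz_weight N \<phi> x \<le> ?n * M" for x
      unfolding schwartz_weight_def sum_distrib_left
      by (rule order_trans[OF sum_mono[where g="\<lambda>_. M"]]) (use M in auto)
    have "(SUP x. schwartz_weight N \<phi> x) \<le> ?n * M" by (rule cSUP_least) (use w in auto)
    moreover have "0 \<le> (SUP x. schwartz_weight N \<phi> x)"
      by (rule cSUP_upper2[of _ _ 0]) (use \<phi> in \<open>auto simp: schwartz_def schwartz_weight_def intro!: mult_nonneg_nonneg sum_nonneg\<close>)
    ultimately have "C0 * (SUP x. schwartz_weight N \<phi> x) \<le> (\<bar>C0\<bar> + 1) * ((?n + 1) * M)"
      using M0 by (intro mult_mono) (auto simp: algebra_simps)
    then show ?thesis using C0[OF \<phi>] by (simp add: mult.assoc)
  qed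
  moreover have "(\<bar>C0\<bar> + 1) * (?n + 1) > 0" by (intro mult_pos_pos) auto
  ultimately show ?thesis using that by blast
qed

text \<open>For nearby \<open>v\<close> and \<open>v'\<close> this is the Lipschitz bound, otherwise
  both terms are estimated separately. The factor \<open>norm (v - v')\<close> gives continuity of
  translation, while the cap at 1 keeps the growth polynomial, so the same bound also serves as a
  majorant in limits.\<close>

lemma schwartz_translate_diff_bound:
  assumes "k \<in> schwartz"
  obtains C where "C > 0" "\<And>v v' z. (1 + norm z) ^ N * norm (k (z - v) - k (z - v')) \<le>
     C * (min 1 (norm (v - v')) * ((1 + norm v) ^ N * (1 + norm v') ^ N))"
proof -
  obtain C0 where C0: "C0 > 0" "\<And>x. (1 + norm x) ^ N * norm (k x) \<le> C0" using schwartz_rapid[OF assms] by metis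
  obtain C1 where C1: "C1 > 0" "\<And>x h. norm h \<le> 1 \<Longrightarrow> (1 + norm x) ^ N * norm (k (x + h) - k x) \<le> C1 * norm h"
    using schwartz_lipschitz[OF assms] by metis
  have z: "(1 + norm z) ^ N \<le> (1 + norm v) ^ N * (1 + norm (z - v)) ^ N" for z v :: 'a
    using one_plus_norm_power_add[of v "z - v" N] by simp
  have one: "1 \<le> (1 + norm v) ^ N" for v :: 'a by (simp add: one_le_power)
  have le1: "(1 + norm v) ^ N \<le> (1 + norm v) ^ N * (1 + norm v') ^ N" for v v' :: 'a
    using mult_left_mono[OF one[of v'], of "(1 + norm v) ^ N"] by simp
  have "(1 + norm z) ^ N * norm (k (z - v) - k (z - v')) \<le>
     (2 * C0 + C1) * (min 1 (norm (v - v')) * ((1 + norm v) ^ N * (1 + norm v') ^ N))" for v v' z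
  proof (cases "norm (v - v') \<le> 1")
    case True
    have "(1 + norm z) ^ N * norm (k (z - v) - k (z - v')) \<le>
       ((1 + norm v) ^ N * (1 + norm (z - v)) ^ N) * norm (k (z - v) - k (z - v'))"
      by (intro mult_right_mono z) auto
    also have "\<dots> = (1 + norm v) ^ N * ((1 + norm (z - v)) ^ N * norm (k (z - v + (v - v')) - k (z - v)))"
      by (simp add: norm_minus_commute)
    also have "\<dots> \<le> (1 + norm v) ^ N * (C1 * norm (v - v'))"
      by (intro mult_left_mono C1 True) auto
    also have "\<dots> \<le> ((1 + norm v) ^ N * (1 + norm v') ^ N) * (C1 * norm (v - v'))"
      using C1(1) by (intro mult_right_mono le1) auto
    also have "\<dots> \<le> ((1 + norm v) ^ N * (1 + norm v') ^ N) * ((2 * C0 + C1) * norm (v - v'))"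
      using C0(1) by (intro mult_left_mono mult_right_mono) auto
    finally show ?thesis using True by (simp add: mult_ac min_def)
  next
    case False
    have "(1 + norm z) ^ N * norm (k (z - v)) \<le> ((1 + norm v) ^ N * (1 + norm v') ^ N) * C0" (is "?l v \<le> ?r")
    proof -
      have "(1 + norm z) ^ N * norm (k (z - v)) \<le> (1 + norm v) ^ N * ((1 + norm (z - v)) ^ N * norm (k (z - v)))"
        using mult_right_mono[OF z norm_ge_zero] by (simp add: mult.assoc)
      also have "\<dots> \<le> (1 + norm v) ^ N * C0" by (intro mult_left_mono C0) auto
      also have "\<dots> \<le> ?r" using C0(1) by (intro mult_right_mono le1) auto
      finally show ?thesis .
    qed
    moreover have "?l v' \<le> ?r"
    proof -
      have "(1 + norm z) ^ N * norm (k (z - v')) \<le> (1 + norm v') ^ N * ((1 + norm (z - v')) ^ N * norm (k (z - v')))"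
        using mult_right_mono[OF z norm_ge_zero] by (simp add: mult.assoc)
      also have "\<dots> \<le> (1 + norm v') ^ N * C0" by (intro mult_left_mono C0) auto
      also have "\<dots> \<le> ?r" using C0(1) le1[of v' v] by (intro mult_right_mono) (auto simp: mult.commute)
      finally show ?thesis .
    qed
    moreover have "(1 + norm z) ^ N * norm (k (z - v) - k (z - v')) \<le> ?l v + ?l v'"
      unfolding distrib_left[symmetric] by (intro mult_left_mono norm_triangle_ineq4) auto
    moreover have "((1 + norm v) ^ N * (1 + norm v') ^ N) * (2 * C0) \<le> ((1 + norm v) ^ N * (1 + norm v') ^ N) * (2 * C0 + C1)"
      using C1(1) by (intro mult_left_mono) auto
    ultimately show ?thesis using False by (simp add: mult_ac min_def)
  qed
  then show ?thesis using that[of "2 * C0 + C1"] C0(1) C1(1) by auto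
qed

lemma schwartz_translate_diff_bound_uniform:
  assumes "k \<in> schwartz"
  obtains C where "C > 0" "\<And>v v' z bs. set bs \<subseteq> Basis \<Longrightarrow> length bs \<le> N \<Longrightarrow>
     (1 + norm z) ^ N * norm (iter_deriv bs k (z - v) - iter_deriv bs k (z - v')) \<le>
     C * (min 1 (norm (v - v')) * ((1 + norm v) ^ N * (1 + norm v') ^ N))"
proof -
  let ?S = "{bs :: 'a list. set bs \<subseteq> Basis \<and> length bs \<le> N}"
  let ?P = "\<lambda>bs C. C > 0 \<and> (bs \<in> ?S \<longrightarrow> (\<forall>v v' z. (1 + norm z) ^ N * norm (iter_deriv bs k (z - v) - iter_deriv bs k (z - v')) \<le>
     C * (min 1 (norm (v - v')) * ((1 + norm v) ^ N * (1 + norm v') ^ N))))"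
  have "\<forall>bs. \<exists>C. ?P bs C"
  proof
    fix bs :: "'a list"
    show "\<exists>C. ?P bs C"
    proof (cases "bs \<in> ?S")
      case True
      obtain C where "C > 0" "\<And>v v' z. (1 + norm z) ^ N * norm (iter_deriv bs k (z - v) - iter_deriv bs k (z - v')) \<le>
         C * (min 1 (norm (v - v')) * ((1 + norm v) ^ N * (1 + norm v') ^ N))"
        by (rule schwartz_translate_diff_bound[OF schwartz_iter_deriv[OF assms], of bs N]) (use True in auto)
      then show ?thesis by (intro exI[of _ C]) auto
    qed (auto intro: exI[of _ 1])
  qed
  from choice[OF this] obtain C where PC: "\<forall>bs. ?P bs (C bs)" ..
  have C: "\<And>bs. C bs > 0" "\<And>bs v v' z. bs \<in> ?S \<Longrightarrow>
     (1 + norm z) ^ N * norm (iter_deriv bs k (z - v) - iter_deriv bs k (z - v')) \<le>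
     C bs * (min 1 (norm (v - v')) * ((1 + norm v) ^ N * (1 + norm v') ^ N))"
    using PC by auto
  have fin: "finite ?S" by (rule finite_multi)
  have le: "C bs \<le> sum C ?S" if "bs \<in> ?S" for bs
    using fin that C(1) by (intro member_le_sum) (auto intro: less_imp_le)
  have "sum C ?S > 0" using fin C(1) by (intro sum_pos) (auto intro!: exI[of _ "[]"])
  moreover have "(1 + norm z) ^ N * norm (iter_deriv bs k (z - v) - iter_deriv bs k (z - v')) \<le>
     sum C ?S * (min 1 (norm (v - v')) * ((1 + norm v) ^ N * (1 + norm v') ^ N))"
    if "set bs \<subseteq> Basis" "length bs \<le> N" for v v' z bs
    using that by (intro order_trans[OF C(2) mult_right_mono[OF le]]) auto
  ultimately show ?thesis using that by blast
qed

lemma tempered_translate_diff_bound: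
  assumes T: "T \<in> tempered" and k: "k \<in> schwartz"
  obtains C N where "C > 0" "\<And>v v'. norm (T (\<lambda>z. k (z - v)) - T (\<lambda>z. k (z - v'))) \<le>
     C * (min 1 (norm (v - v')) * ((1 + norm v) ^ N * (1 + norm v') ^ N))"
proof -
  obtain A N where A: "A > 0" "\<And>\<phi> M. \<phi> \<in> schwartz \<Longrightarrow> seminorm_le N \<phi> M \<Longrightarrow> norm (T \<phi>) \<le> A * M"
    by (rule tempered_bound[OF T]) blast
  obtain C where C: "C > 0" "\<And>v v' z bs. set bs \<subseteq> Basis \<Longrightarrow> length bs \<le> N \<Longrightarrow>
     (1 + norm z) ^ N * norm (iter_deriv bs k (z - v) - iter_deriv bs k (z - v')) \<le>
     C * (min 1 (norm (v - v')) * ((1 + norm v) ^ N * (1 + norm v') ^ N))"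
    by (rule schwartz_translate_diff_bound_uniform[OF k, of N]) blast
  have "norm (T (\<lambda>z. k (z - v)) - T (\<lambda>z. k (z - v'))) \<le> A * (C * (min 1 (norm (v - v')) * ((1 + norm v) ^ N * (1 + norm v') ^ N)))" for v v'
    unfolding tempered_diff[OF T schwartz_translate[OF k] schwartz_translate[OF k], symmetric]
    by (rule A) (auto simp: seminorm_le_def intro!: schwartz_diff schwartz_translate k C
        simp: iter_deriv_diff iter_deriv_translate smooth_translate schwartz_smooth k)
  then show ?thesis using that[of "A * C" N] A(1) C(1) by (auto simp: mult.assoc)
qed

lemma tempered_translate_continuous:
  assumes T: "T \<in> tempered" and k: "k \<in> schwartz"
  shows "isCont (\<lambda>v. T (\<lambda>z. k (z - v))) v"
proof -
  obtain C N where C: "C > 0" "\<And>v v'. norm (T (\<lambda>z. k (z - v)) - T (\<lambda>z. k (z - v'))) \<le>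
     C * (min 1 (norm (v - v')) * ((1 + norm v) ^ N * (1 + norm v') ^ N))"
    using tempered_translate_diff_bound[OF assms] by blast
  have "((\<lambda>x. C * (min 1 (norm (x - v)) * ((1 + norm x) ^ N * (1 + norm v) ^ N))) \<longlongrightarrow>
     C * (min 1 (norm (v - v)) * ((1 + norm v) ^ N * (1 + norm v) ^ N))) (at v)"
    by (intro tendsto_intros)
  then have "((\<lambda>x. C * (min 1 (norm (x - v)) * ((1 + norm x) ^ N * (1 + norm v) ^ N))) \<longlongrightarrow> 0) (at v)" by simp
  then have "((\<lambda>x. T (\<lambda>z. k (z - x)) - T (\<lambda>z. k (z - v))) \<longlongrightarrow> 0) (at v)"
    by (rule Lim_null_comparison[rotated]) (use C in auto)
  then show ?thesis unfolding isCont_def by (rule Lim_transform2[rotated, unfolded Lim_null[symmetric]] LIM_zero_cancel)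
qed

lemma tempered_translate_slowly_growing:
  assumes T: "T \<in> tempered" and k: "k \<in> schwartz"
  shows "slowly_growing (\<lambda>v. T (\<lambda>z. k (z - v)))"
proof -
  let ?G = "\<lambda>v. T (\<lambda>z. k (z - v))"
  obtain C N where C: "C > 0" "\<And>v v'. norm (?G v - ?G v') \<le>
     C * (min 1 (norm (v - v')) * ((1 + norm v) ^ N * (1 + norm v') ^ N))"
    using tempered_translate_diff_bound[OF assms] by blast
  have "norm (?G v) \<le> (norm (?G 0) + C) * (1 + norm v) ^ N" for v
  proof -
    have one: "1 \<le> (1 + norm v) ^ N" by (simp add: one_le_power)
    have "norm (?G v) \<le> norm (?G 0) + norm (?G v - ?G 0)" by (rule norm_triangle_sub)
    also have "norm (?G v - ?G 0) \<le> C * (1 + norm v) ^ N"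
    proof -
      have "min 1 (norm v) * (1 + norm v) ^ N \<le> (1 + norm v) ^ N" by (intro mult_left_le_one_le) auto
      then show ?thesis using C(1) by (intro order_trans[OF C(2)[of v 0]]) auto
    qed
    also have "norm (?G 0) \<le> norm (?G 0) * (1 + norm v) ^ N" using mult_left_mono[OF one, of "norm (?G 0)"] by simp
    finally show ?thesis by (simp add: distrib_right)
  qed
  moreover have "?G \<in> borel_measurable borel"
    by (intro borel_measurable_continuous_onI continuous_at_imp_continuous_on ballI tempered_translate_continuous assms)
  ultimately show ?thesis unfolding slowly_growing_def by blast
qed

lemma integral_simple_split:
  fixes w :: "'a::euclidean_space \<Rightarrow> complex" and g :: "'a \<Rightarrow> complex"
  assumes w: "integrable lborel w" and s: "simple_function lborel s"
  shows "(LINT v|lborel. w v * g (s v)) = (\<Sum>y\<in>range s. (LINT v|lborel. w v * indicator (s -` {y}) v) * g y)"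
proof -
  have fin: "finite (range s)" using simple_functionD(1)[OF s] by simp
  have meas: "s -` {y} \<in> sets lborel" for y using simple_functionD(2)[OF s, of "{y}"] by simp
  have "(LINT v|lborel. w v * g (s v)) = (LINT v|lborel. (\<Sum>y\<in>range s. (w v * indicator (s -` {y}) v) * g y))"
  proof (intro Bochner_Integration.integral_cong refl)
    fix v
    have "(\<Sum>y\<in>range s. (w v * indicator (s -` {y}) v) * g y) = (\<Sum>y\<in>range s. if y = s v then w v * g y else 0)"
      by (intro sum.cong refl) (auto simp: indicator_def)
    then show "w v * g (s v) = (\<Sum>y\<in>range s. (w v * indicator (s -` {y}) v) * g y)" using fin by simp
  qed
  also have "\<dots> = (\<Sum>y\<in>range s. (LINT v|lborel. (w v * indicator (s -` {y}) v) * g y))"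
  proof (rule Bochner_Integration.integral_sum)
    fix y
    have "integrable lborel (\<lambda>v. indicator (s -` {y}) v *\<^sub>R w v)" by (rule integrable_mult_indicator[OF meas w])
    then have "integrable lborel (\<lambda>v. w v * indicator (s -` {y}) v)"
      by (rule Bochner_Integration.integrable_cong[THEN iffD1, rotated -1]) (auto simp: indicator_def)
    then show "integrable lborel (\<lambda>v. (w v * indicator (s -` {y}) v) * g y)" by (rule integrable_mult_left)
  qed
  finally show ?thesis by simp
qed

text \<open>Approximating \<open>v\<close> by simple functions \<open>s i v\<close> turns the convolution into a finite combination of
  translates of \<open>k\<close>, which converges in every Schwartz seminorm.\<close>
lemma tempered_conv:
  fixes w :: "'a::euclidean_space \<Rightarrow> complex"
  assumes T: "T \<in> tempered" and w: "rapidly_decreasing w" and k: "k \<in> schwartz"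
  shows "T (conv w k) = (LINT v|lborel. w v * T (\<lambda>z. k (z - v)))"
proof -
  let ?G = "\<lambda>v. T (\<lambda>z. k (z - v))"
  have [measurable]: "w \<in> borel_measurable borel" using w by (simp add: rapidly_decreasing_def)
  have wint: "integrable lborel w"
    using rapidly_decreasing_integrable_moment[OF w, of 0] by (simp add: integrable_norm_iff)
  have [measurable]: "?G \<in> borel_measurable borel"
    by (rule slowly_growing_measurable[OF tempered_translate_slowly_growing[OF T k]])
  \<comment> \<open>The bound by twice the norm keeps the polynomial weights at \<open>s i v\<close>
    comparable with those at \<open>v\<close>; both dominated limits below depend on it.\<close>
  obtain s :: "nat \<Rightarrow> 'a \<Rightarrow> 'a" where s: "\<And>i. simple_function lborel (s i)"
    "\<And>x. (\<lambda>i. s i x) \<longlonglongrightarrow> x" "\<And>i x. dist (s i x) 0 \<le> 2 * dist x 0"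
    using borel_measurable_implies_sequence_metric[of "\<lambda>x. x" "lborel :: 'a measure" 0] by auto
  have [measurable]: "s i \<in> borel_measurable borel" for i
    using borel_measurable_simple_function[OF s(1)] by simp
  define c where "c i y = (LINT v|lborel. w v * indicator (s i -` {y}) v)" for i y
  define \<theta> where "\<theta> i z = (\<Sum>y\<in>range (s i). c i y * k (z - y))" for i z
  have fin: "finite (range (s i))" for i using simple_functionD(1)[OF s(1)] by simp
  have \<theta>_schwartz: "\<theta> i \<in> schwartz" for i
    unfolding \<theta>_def[abs_def] by (intro schwartz_sum schwartz_cmult schwartz_translate fin k)
  have T\<theta>: "T (\<theta> i) = (LINT v|lborel. w v * ?G (s i v))" for i
  proof -
    have "T (\<theta> i) = (\<Sum>y\<in>range (s i). T (\<lambda>z. c i y * k (z - y)))"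
      unfolding \<theta>_def[abs_def] by (intro tempered_sum T fin schwartz_cmult schwartz_translate k)
    also have "\<dots> = (\<Sum>y\<in>range (s i). c i y * ?G y)"
      by (intro sum.cong refl tempered_cmult T schwartz_translate k)
    finally show ?thesis unfolding c_def using integral_simple_split[OF wint s(1), of ?G i] by simp
  qed
  have sn: "(1 + norm (s i v)) \<le> 2 * (1 + norm v)" for i v
    using s(3)[of i v] norm_ge_zero[of v] by simp
  have lim1: "(\<lambda>i. T (\<theta> i)) \<longlonglongrightarrow> (LINT v|lborel. w v * ?G v)"
  proof -
    obtain A M where A: "A > 0" "\<And>v. norm (?G v) \<le> A * (1 + norm v) ^ M"
      using slowly_growing_bound[OF tempered_translate_slowly_growing[OF T k]] by blast
    show ?thesis unfolding T\<theta>
    proof (rule integral_dominated_convergence[where w="\<lambda>v. A * 2 ^ M * ((1 + norm v) ^ M * norm (w v))"])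
      show "integrable lborel (\<lambda>v. A * 2 ^ M * ((1 + norm v) ^ M * norm (w v)))"
        by (intro integrable_mult_right rapidly_decreasing_integrable_moment w)
      show "AE v in lborel. (\<lambda>i. w v * ?G (s i v)) \<longlonglongrightarrow> w v * ?G v"
        by (intro AE_I2 tendsto_mult tendsto_const isCont_tendsto_compose[OF tempered_translate_continuous[OF T k]] s)
      show "AE v in lborel. norm (w v * ?G (s i v)) \<le> A * 2 ^ M * ((1 + norm v) ^ M * norm (w v))" for i
      proof (rule AE_I2)
        fix v
        have "norm (?G (s i v)) \<le> A * (2 * (1 + norm v)) ^ M"
          using A(1) sn by (intro order_trans[OF A(2)] mult_left_mono power_mono) auto
        then have "norm (w v) * norm (?G (s i v)) \<le> norm (w v) * (A * (2 * (1 + norm v)) ^ M)"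
          by (rule mult_left_mono) simp
        then show "norm (w v * ?G (s i v)) \<le> A * 2 ^ M * ((1 + norm v) ^ M * norm (w v))"
          unfolding norm_mult power_mult_distrib by (simp only: mult_ac)
      qed
    qed auto
  qed
  obtain A N where A: "A > 0" "\<And>\<phi> M. \<phi> \<in> schwartz \<Longrightarrow> seminorm_le N \<phi> M \<Longrightarrow> norm (T \<phi>) \<le> A * M"
    by (rule tempered_bound[OF T]) blast
  obtain C where C: "C > 0" "\<And>v v' z bs. set bs \<subseteq> Basis \<Longrightarrow> length bs \<le> N \<Longrightarrow>
     (1 + norm z) ^ N * norm (iter_deriv bs k (z - v) - iter_deriv bs k (z - v')) \<le>
     C * (min 1 (norm (v - v')) * ((1 + norm v) ^ N * (1 + norm v') ^ N))"
    by (rule schwartz_translate_diff_bound_uniform[OF k, of N]) blast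
  \<comment> \<open>One integrand that dominates all derivatives up to order \<open>N\<close> at all
    points \<open>z\<close>. Its integral tends to 0, which yields convergence of the finite
    combinations in the seminorm that controls \<open>T\<close>.\<close>
  let ?D = "\<lambda>i v. norm (w v) * (C * (min 1 (norm (v - s i v)) * ((1 + norm v) ^ N * (1 + norm (s i v)) ^ N)))"
  define B where "B v = C * 2 ^ N * ((1 + norm v) ^ (N + N) * norm (w v))" for v
  have Bint: "integrable lborel B"
    unfolding B_def by (intro integrable_mult_right rapidly_decreasing_integrable_moment w)
  have DB: "norm (?D i v) \<le> B v" for i v
  proof -
    have "min 1 (norm (v - s i v)) * ((1 + norm v) ^ N * (1 + norm (s i v)) ^ N) \<le> 1 * ((1 + norm v) ^ N * (2 * (1 + norm v)) ^ N)"
      by (intro mult_mono power_mono sn) auto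
    then have "norm (w v) * (C * (min 1 (norm (v - s i v)) * ((1 + norm v) ^ N * (1 + norm (s i v)) ^ N))) \<le>
       norm (w v) * (C * ((1 + norm v) ^ N * (2 * (1 + norm v)) ^ N))"
      using C(1) by (intro mult_left_mono) auto
    moreover have "norm (?D i v) = ?D i v" using C(1) unfolding real_norm_def by (intro abs_of_nonneg) auto
    ultimately show ?thesis unfolding B_def power_mult_distrib power_add by (simp only: mult_ac mult_1_left)
  qed
  have Dint: "integrable lborel (?D i)" for i
    by (rule Bochner_Integration.integrable_bound[OF Bint]) (use DB in \<open>auto intro: order_trans[OF _ abs_ge_self]\<close>)
  have "(\<lambda>i. LINT v|lborel. ?D i v) \<longlonglongrightarrow> (LINT v|(lborel::'a measure). 0)"
  proof (rule integral_dominated_convergence[where w=B])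
    show "AE v in lborel. (\<lambda>i. ?D i v) \<longlonglongrightarrow> 0"
    proof (rule AE_I2)
      fix v
      have "(\<lambda>i. ?D i v) \<longlonglongrightarrow> norm (w v) * (C * (min 1 (norm (v - v)) * ((1 + norm v) ^ N * (1 + norm v) ^ N)))"
        by (intro tendsto_intros s)
      then show "(\<lambda>i. ?D i v) \<longlonglongrightarrow> 0" by simp
    qed
  qed (use Bint DB in auto)
  then have D0: "(\<lambda>i. A * (LINT v|lborel. ?D i v)) \<longlonglongrightarrow> 0"
    using tendsto_mult_right_zero by auto
  have "norm (T (\<theta> i) - T (conv w k)) \<le> A * (LINT v|lborel. ?D i v)" for i
    unfolding tempered_diff[OF T \<theta>_schwartz conv_schwartz[OF w k], symmetric]
  proof (rule A, goal_cases)
    case 1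
    show "(\<lambda>x. \<theta> i x - conv w k x) \<in> schwartz"
      by (intro schwartz_diff \<theta>_schwartz conv_schwartz w k)
  next
    case 2
    show ?case unfolding seminorm_le_def
    proof (intro allI impI)
    fix z and bs :: "'a list" assume bs: "set bs \<subseteq> Basis" "length bs \<le> N"
    let ?k = "iter_deriv bs k"
    have kS: "?k \<in> schwartz" by (rule schwartz_iter_deriv[OF k bs(1)])
    then have [measurable]: "?k \<in> borel_measurable borel" by (rule schwartz_measurable)
    have i1: "integrable lborel (\<lambda>v. w v * ?k (z - v))"
      by (rule conv_integrable[OF rapidly_decreasing_slowly_growing[OF w] kS])
    obtain E where E: "\<And>x. norm (?k x) \<le> E" using schwartz_rapid[OF kS, of 0] by auto
    have i2: "integrable lborel (\<lambda>v. w v * ?k (z - s i v))"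
    proof (rule Bochner_Integration.integrable_bound[of _ "\<lambda>v. norm (w v) * E"])
      have "norm (w v * ?k (z - s i v)) \<le> norm (norm (w v) * E)" for v
        unfolding norm_mult by (intro mult_mono) (use E[of "z - s i v"] in auto)
      then show "AE v in lborel. norm (w v * ?k (z - s i v)) \<le> norm (norm (w v) * E)" by simp
    qed (use wint in auto)
    have "iter_deriv bs (\<theta> i) z = (\<Sum>y\<in>range (s i). c i y * ?k (z - y))"
      unfolding \<theta>_def[abs_def] using fin bs schwartz_smooth[OF k]
      by (simp add: iter_deriv_sum iter_deriv_cmult iter_deriv_translate smooth_cmult smooth_translate)
    also have "\<dots> = (LINT v|lborel. w v * ?k (z - s i v))"
      unfolding c_def using integral_simple_split[OF wint s(1), of "\<lambda>y. ?k (z - y)" i] by simp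
    finally have "iter_deriv bs (\<lambda>x. \<theta> i x - conv w k x) z =
       (LINT v|lborel. w v * ?k (z - s i v)) - (LINT v|lborel. w v * ?k (z - v))"
      using bs iter_deriv_conv[OF rapidly_decreasing_slowly_growing[OF w] k bs(1)]
      by (simp add: iter_deriv_diff schwartz_smooth \<theta>_schwartz conv_schwartz w k conv_def[of w "iter_deriv bs k"])
    also have "\<dots> = (LINT v|lborel. w v * ?k (z - s i v) - w v * ?k (z - v))"
      using i1 i2 by simp
    finally have eq: "(1 + norm z) ^ N * norm (iter_deriv bs (\<lambda>x. \<theta> i x - conv w k x) z) =
       norm (LINT v|lborel. ((1 + norm z) ^ N) *\<^sub>R (w v * ?k (z - s i v) - w v * ?k (z - v)))"
      by simp
    also have "\<dots> \<le> (LINT v|lborel. ?D i v)"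
    proof (rule Bochner_Integration.integral_norm_bound_integral[OF _ Dint])
      show "integrable lborel (\<lambda>v. ((1 + norm z) ^ N) *\<^sub>R (w v * ?k (z - s i v) - w v * ?k (z - v)))"
        using i1 i2 by (intro integrable_scaleR_right Bochner_Integration.integrable_diff)
      fix v
      have "norm (((1 + norm z) ^ N) *\<^sub>R (w v * ?k (z - s i v) - w v * ?k (z - v))) =
        norm (w v) * ((1 + norm z) ^ N * norm (?k (z - v) - ?k (z - s i v)))"
        by (simp add: right_diff_distrib[symmetric] norm_mult norm_minus_commute)
      also have "\<dots> \<le> ?D i v" by (intro mult_left_mono C bs) auto
      finally show "norm (((1 + norm z) ^ N) *\<^sub>R (w v * ?k (z - s i v) - w v * ?k (z - v))) \<le> ?D i v" .
    qed
    finally show "(1 + norm z) ^ N * norm (iter_deriv bs (\<lambda>x. \<theta> i x - conv w k x) z) \<le> (LINT v|lborel. ?D i v)" .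
    qed
  qed
  then have "(\<lambda>i. T (\<theta> i) - T (conv w k)) \<longlonglongrightarrow> 0"
    by (intro Lim_null_comparison[OF _ D0]) auto
  then have "(\<lambda>i. T (\<theta> i)) \<longlonglongrightarrow> T (conv w k)" by (rule LIM_zero_cancel)
  then show ?thesis using lim1 LIMSEQ_unique by blast
qed

section \<open>Band-limited pieces of a tempered distribution\<close>

definition filtered :: "('a::euclidean_space \<Rightarrow> complex) \<Rightarrow> (('a \<Rightarrow> complex) \<Rightarrow> complex) \<Rightarrow> 'a \<Rightarrow> complex" where
  "filtered \<eta> T x = T (\<lambda>z. mult_kernel \<eta> (z - x))"

lemma filtered_slowly_growing: "T \<in> tempered \<Longrightarrow> \<eta> \<in> test_fun \<Longrightarrow> slowly_growing (filtered \<eta> T)"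
  unfolding filtered_def[abs_def] by (rule tempered_translate_slowly_growing[OF _ mult_kernel_schwartz])

text \<open>A further multiplier acts by integration against its kernel. In the applications
  \<open>H\<close> is either a cutoff equal to 1 on the support of \<eta>, which makes the formula
  reproduce the filtered function, or the symbol of a dyadic piece.\<close>

lemma filtered_mult:
  assumes "T \<in> tempered" "\<eta> \<in> test_fun" "H \<in> test_fun"
  shows "filtered (\<lambda>\<xi>. \<eta> \<xi> * H \<xi>) T x = (LINT v|lborel. mult_kernel H (v - x) * filtered \<eta> T v)"
proof -
  have "rapidly_decreasing (\<lambda>v. mult_kernel H (v - x))"
    by (intro schwartz_rapidly_decreasing schwartz_translate mult_kernel_schwartz assms)
  from tempered_conv[OF assms(1) this mult_kernel_schwartz[OF assms(2)]] show ?thesis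
    by (simp add: filtered_def conv_mult_kernel[OF assms(2,3), abs_def])
qed

lemma rapidly_decreasing_mult:
  assumes "rapidly_decreasing f" "rapidly_decreasing g"
  shows "rapidly_decreasing (\<lambda>v. f v * g v)"
proof -
  have [measurable]: "f \<in> borel_measurable borel" "g \<in> borel_measurable borel"
    using assms by (auto simp: rapidly_decreasing_def)
  have "\<exists>C. \<forall>v. (1 + norm v) ^ N * norm (f v * g v) \<le> C" for N
  proof -
    obtain C where C: "C > 0" "\<And>v. (1 + norm v) ^ N * norm (f v) \<le> C" using rapidly_decreasing_bound[OF assms(1)] by metis
    obtain D where D: "D > 0" "\<And>v. (1 + norm v) ^ 0 * norm (g v) \<le> D" using rapidly_decreasing_bound[OF assms(2)] by metis
    have "(1 + norm v) ^ N * norm (f v * g v) \<le> C * D" for v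
      unfolding norm_mult mult.assoc[symmetric] using C D(2)[of v] by (intro mult_mono) auto
    then show ?thesis by blast
  qed
  then show ?thesis unfolding rapidly_decreasing_def by auto
qed

text \<open>The identity for products of kernels is transported through \<open>T\<close> by
  \<open>tempered_conv\<close>, which applies because the product of two Schwartz kernels is rapidly
  decreasing. It writes kernel times filtered distribution at \<open>z\<close> as an average of
  itself, so that its supremum can be bounded by its integral.\<close>

lemma filtered_reproduce_product:
  assumes T: "T \<in> tempered" and \<eta>: "\<eta> \<in> test_fun" and H: "H \<in> test_fun" and \<Theta>: "\<Theta> \<in> test_fun"
    and one: "\<And>\<xi> \<zeta>. \<eta> \<xi> \<noteq> 0 \<Longrightarrow> H \<zeta> \<noteq> 0 \<Longrightarrow> \<Theta> (\<xi> - \<zeta>) = 1"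
  shows "mult_kernel H (z - x) * filtered \<eta> T z =
     (LINT v|lborel. (mult_kernel \<Theta> (v - z) * mult_kernel H (v - x)) * filtered \<eta> T v)"
proof -
  let ?w = "\<lambda>v. mult_kernel \<Theta> (v - z) * mult_kernel H (v - x)"
  have w: "rapidly_decreasing ?w"
    by (intro rapidly_decreasing_mult schwartz_rapidly_decreasing schwartz_translate mult_kernel_schwartz H \<Theta>)
  have "conv ?w (mult_kernel \<eta>) = (\<lambda>y. mult_kernel H (z - x) * mult_kernel \<eta> (y - z))"
    unfolding conv_def[abs_def] using mult_kernel_reproduce_product[OF \<eta> H \<Theta> one] by auto
  then show ?thesis
    using tempered_conv[OF T w mult_kernel_schwartz[OF \<eta>]]
      tempered_cmult[OF T schwartz_translate[OF mult_kernel_schwartz[OF \<eta>]]]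
    by (simp add: filtered_def)
qed

lemma mult_kernel_reflect:
  fixes \<eta> :: "'a::euclidean_space \<Rightarrow> complex"
  assumes "\<eta> \<in> test_fun"
  shows "mult_kernel \<eta> (- z) = mult_kernel (\<lambda>\<xi>. \<eta> (- \<xi>)) z"
proof -
  have [measurable]: "\<eta> \<in> borel_measurable borel" by (rule test_fun_measurable[OF assms])
  show ?thesis unfolding mult_kernel_def
    by (subst lborel_integral_reflect(1)[symmetric, of _ 0]) auto
qed

lemma mult_kernel_scale:
  fixes \<eta> :: "'a::euclidean_space \<Rightarrow> complex"
  assumes "\<eta> \<in> test_fun" "t > 0"
  shows "mult_kernel (\<lambda>\<xi>. \<eta> (inverse t *\<^sub>R \<xi>)) z = of_real (t ^ DIM('a)) * mult_kernel \<eta> (t *\<^sub>R z)"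
proof -
  have [measurable]: "\<eta> \<in> borel_measurable borel" by (rule test_fun_measurable[OF assms(1)])
  have "(LINT \<xi>|lborel. cis (- (z \<bullet> \<xi>)) * \<eta> (inverse t *\<^sub>R \<xi>)) =
      (\<bar>t\<bar> ^ DIM('a)) *\<^sub>R (LINT \<xi>|lborel. cis (- (z \<bullet> (0 + t *\<^sub>R \<xi>))) * \<eta> (inverse t *\<^sub>R (0 + t *\<^sub>R \<xi>)))"
    by (rule lborel_integral_scale) (use assms in auto)
  then show ?thesis using assms(2) by (simp add: mult_kernel_def scaleR_conv_of_real)
qed

lemma test_fun_scale:
  assumes "\<eta> \<in> test_fun" "t > 0"
  shows "(\<lambda>\<xi>. \<eta> (inverse t *\<^sub>R \<xi>)) \<in> test_fun"
  using test_fun_affine[OF assms(1), of "inverse t" 0] assms(2) by simp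

lemma test_fun_add:
  assumes "f \<in> test_fun" "g \<in> test_fun"
  shows "(\<lambda>x. f x + g x) \<in> test_fun"
proof -
  obtain R where R: "R > 0" "\<And>x. norm x > R \<Longrightarrow> f x = 0" using test_fun_bounded_support[OF assms(1)] by metis
  obtain S where S: "S > 0" "\<And>x. norm x > S \<Longrightarrow> g x = 0" using test_fun_bounded_support[OF assms(2)] by metis
  show ?thesis
    by (rule test_funI[of _ "max R S", OF smooth_add[OF assms[THEN test_fun_smooth]]]) (use R S in auto)
qed

lemma filtered_add:
  assumes "T \<in> tempered" "\<eta> \<in> test_fun" "\<theta> \<in> test_fun"
  shows "filtered (\<lambda>\<xi>. \<eta> \<xi> + \<theta> \<xi>) T x = filtered \<eta> T x + filtered \<theta> T x"
proof -
  have "mult_kernel (\<lambda>\<xi>. \<eta> \<xi> + \<theta> \<xi>) z = mult_kernel \<eta> z + mult_kernel \<theta> z" for z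
    unfolding mult_kernel_def distrib_left
    by (subst Bochner_Integration.integral_add)
      (simp_all add: distrib_left integrable_cis_mult[OF test_fun_integrable[OF assms(2)]]
        integrable_cis_mult[OF test_fun_integrable[OF assms(3)]])
  then show ?thesis unfolding filtered_def
    by (simp add: tempered_add[OF assms(1)] schwartz_translate mult_kernel_schwartz assms)
qed

lemma borel_locally_integrable:
  fixes g :: "'a::euclidean_space \<Rightarrow> complex"
  assumes "continuous_on UNIV g" "compact C"
  shows "set_integrable lebesgue C g"
proof -
  have [measurable]: "g \<in> borel_measurable borel" "C \<in> sets borel"
    using assms by (auto intro: borel_measurable_continuous_onI borel_closed compact_imp_closed)
  have "integrable lborel (\<lambda>x. indicator C x *\<^sub>R g x)"
    by (rule borel_integrable_compact[OF assms(2)]) (rule continuous_on_subset[OF assms(1)], simp)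
  then show ?thesis unfolding set_integrable_def by (subst integrable_completion) auto
qed

section \<open>Uniqueness of the representing function\<close>

text \<open>Inner regularity: inside a ball the set where \<open>g\<close> is positive contains a
  closed, hence compact, set of almost full measure. On it \<open>g\<close> is positive with
  integral zero, so that set is null, and the whole positivity set has measure below every
  \<epsilon>.\<close>

lemma AE_nonpos_if_integral_compact_zero:
  fixes g :: "'a::euclidean_space \<Rightarrow> real"
  assumes int: "\<And>C. compact C \<Longrightarrow> set_integrable lebesgue C g"
    and zero: "\<And>C. compact C \<Longrightarrow> (LINT x:C|lebesgue. g x) = 0"
  shows "AE x in lebesgue. g x \<le> 0"
proof -
  define A where "A n = {x. indicator (cball 0 (real n)) x *\<^sub>R g x > 0}" for n
  have A_sub: "A n \<subseteq> cball 0 (real n)" for n by (auto simp: A_def indicator_def split: if_splits)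
  have A_pos: "g x > 0" if "x \<in> A n" for x n
    using that by (cases "norm x \<le> real n") (auto simp: A_def)
  have A_sets: "A n \<in> sets lebesgue" for n
  proof -
    have "(\<lambda>x. indicator (cball 0 (real n)) x *\<^sub>R g x) \<in> borel_measurable lebesgue"
      using borel_measurable_integrable int[OF compact_cball] unfolding set_integrable_def by blast
    then have "{x \<in> space lebesgue. 0 < indicator (cball 0 (real n)) x *\<^sub>R g x} \<in> sets lebesgue"
      by (rule borel_measurable_less[OF borel_measurable_const])
    then show ?thesis by (simp add: A_def)
  qed
  have "A n \<in> null_sets lebesgue" for n
  proof -
    have "emeasure lebesgue (A n) \<le> ennreal e" if "e > 0" for e
    proof -
      obtain T where T: "closed T" "T \<subseteq> A n" "A n - T \<in> lmeasurable" "emeasure lebesgue (A n - T) < ennreal e"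
        using sets_lebesgue_inner_closed[OF A_sets \<open>e > 0\<close>] by metis
      have cT: "compact T" using T A_sub[of n] by (meson bounded_cball bounded_subset compact_eq_bounded_closed order_trans)
      have ge: "0 \<le> indicator T x *\<^sub>R g x" for x using A_pos[of x n] T(2) by (auto simp: indicator_def)
      have "AE x in lebesgue. indicator T x *\<^sub>R g x = 0"
        using integral_nonneg_eq_0_iff_AE[of lebesgue "\<lambda>x. indicator T x *\<^sub>R g x"] int[OF cT] zero[OF cT] ge
        unfolding set_integrable_def set_lebesgue_integral_def by auto
      then have "AE x in lebesgue. x \<notin> T"
        by eventually_elim (use A_pos[of _ n] T(2) in \<open>force simp: indicator_def split: if_splits\<close>)
      moreover have Ts: "T \<in> sets lebesgue" using T(1) by (simp add: sets_completionI_sets)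
      ultimately have "emeasure lebesgue T = 0" by (subst (asm) AE_iff_measurable[of T]) auto
      then have "emeasure lebesgue (T \<union> (A n - T)) \<le> emeasure lebesgue (A n - T)"
        using emeasure_subadditive[of T lebesgue "A n - T"] Ts A_sets by auto
      moreover have "T \<union> (A n - T) = A n" using T(2) by auto
      ultimately show ?thesis using T(4) by simp
    qed
    then have "emeasure lebesgue (A n) = 0"
      using ennreal_le_epsilon[of 0 "emeasure lebesgue (A n)"] by simp
    then show ?thesis using A_sets by blast
  qed
  then have "AE x in lebesgue. x \<notin> A n" for n by (rule AE_not_in)
  then have "AE x in lebesgue. \<forall>n. x \<notin> A n" by (simp add: AE_all_countable)
  then show ?thesis
  proof eventually_elim
    case (elim x)
    obtain n where "norm x \<le> real n" using real_arch_simple by blast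
    then show ?case using elim[rule_format, of n] by (auto simp: A_def not_less)
  qed
qed

lemma conv_commute:
  assumes [measurable]: "w \<in> borel_measurable borel" "k \<in> borel_measurable borel"
  shows "conv w k z = (LINT v|lborel. w (z - v) * k v)"
  unfolding conv_def by (subst lborel_integral_reflect(1)[symmetric, of _ z]) auto

section \<open>Dilated cutoffs, smooth representatives and their uniqueness\<close>

locale smooth_cutoff =
  fixes \<phi>\<^sub>0 :: "'a::euclidean_space \<Rightarrow> real"
  assumes cutoff_test: "\<phi>\<^sub>0 \<in> test_fun" and cutoff_nonneg: "0 \<le> \<phi>\<^sub>0 x"
    and cutoff_one: "norm x \<le> 1 \<Longrightarrow> \<phi>\<^sub>0 x = 1" and cutoff_zero: "2 \<le> norm x \<Longrightarrow> \<phi>\<^sub>0 x = 0"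
begin

text \<open>The dilated cutoff is 1 on the ball of radius \<open>R\<close> and 0 outside the ball of
  radius \<open>2 * R\<close>. At dyadic radii these are the partial sums of the Littlewood-Paley
  symbols, since \<open>psi \<phi>\<^sub>0 k\<close> is the difference of two consecutive
  ones.\<close>

definition cut :: "real \<Rightarrow> 'a \<Rightarrow> complex" where
  "cut R \<xi> = of_real (\<phi>\<^sub>0 (inverse R *\<^sub>R \<xi>))"

lemma cut_test: "R > 0 \<Longrightarrow> cut R \<in> test_fun"
  unfolding cut_def[abs_def] using test_fun_scale[OF test_fun_of_real[OF cutoff_test]] .

lemma cut_one: "R > 0 \<Longrightarrow> norm \<xi> \<le> R \<Longrightarrow> cut R \<xi> = 1"
  by (simp add: cut_def cutoff_one field_simps)

lemma cut_zero: "R > 0 \<Longrightarrow> 2 * R \<le> norm \<xi> \<Longrightarrow> cut R \<xi> = 0"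
  by (simp add: cut_def cutoff_zero field_simps)

text \<open>A cutoff equal to 1 on the support of \<eta> does not change the symbol, so the filtered
  distribution is its own convolution with a Schwartz kernel and inherits the smoothness of that
  kernel.\<close>

lemma smooth_filtered:
  fixes \<eta> :: "'a \<Rightarrow> complex"
  assumes T: "T \<in> tempered" and \<eta>: "\<eta> \<in> test_fun"
  shows "smooth (filtered \<eta> T)"
proof -
  obtain R where R: "R > 0" "\<And>x. norm x > R \<Longrightarrow> \<eta> x = 0" using test_fun_bounded_support[OF \<eta>] by metis
  have eq: "(\<lambda>\<xi>. \<eta> \<xi> * cut R \<xi>) = \<eta>" using R cut_one[OF R(1)] by (force simp: not_le[symmetric])
  have refl: "(\<lambda>\<xi>. cut R (- \<xi>)) \<in> test_fun" using test_fun_affine[OF cut_test[OF R(1)], of "-1" 0] by simp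
  have kr: "mult_kernel (\<lambda>\<xi>. cut R (- \<xi>)) (x - v) = mult_kernel (cut R) (v - x)" for x v
    using mult_kernel_reflect[OF cut_test[OF R(1)], of "x - v"] by simp
  have "filtered \<eta> T = conv (filtered \<eta> T) (mult_kernel (\<lambda>\<xi>. cut R (- \<xi>)))"
  proof
    fix x
    show "filtered \<eta> T x = conv (filtered \<eta> T) (mult_kernel (\<lambda>\<xi>. cut R (- \<xi>))) x"
      using filtered_mult[OF T \<eta> cut_test[OF R(1)], of x] unfolding conv_def kr eq by (simp only: mult.commute)
  qed
  then show ?thesis using smooth_conv[OF filtered_slowly_growing[OF T \<eta>] mult_kernel_schwartz[OF refl]] by simp
qed

lemma continuous_filtered: "(T :: ('a \<Rightarrow> complex) \<Rightarrow> complex) \<in> tempered \<Longrightarrow> \<eta> \<in> test_fun \<Longrightarrow> continuous_on S (filtered \<eta> T)"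
  by (intro smooth_continuous_on smooth_filtered)

lemma filtered_borel: "(T :: ('a \<Rightarrow> complex) \<Rightarrow> complex) \<in> tempered \<Longrightarrow> \<eta> \<in> test_fun \<Longrightarrow> filtered \<eta> T \<in> borel_measurable borel"
  by (intro borel_measurable_continuous_onI continuous_filtered)

lemma represents_filtered:
  fixes \<eta> :: "'a \<Rightarrow> real"
  assumes T: "T \<in> tempered" and \<eta>: "\<eta> \<in> test_fun"
  shows "represents (filtered (\<lambda>\<xi>. of_real (\<eta> \<xi>)) T) (inv_fourier_dist (mult_dist \<eta> (fourier_dist T)))"
  unfolding represents_def
proof (intro conjI allI impI ballI)
  let ?\<eta> = "\<lambda>\<xi>. complex_of_real (\<eta> \<xi>)"
  have \<eta>': "?\<eta> \<in> test_fun" by (rule test_fun_of_real[OF \<eta>])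
  show "set_integrable lebesgue C (filtered ?\<eta> T)" if "compact C" for C
    by (intro borel_locally_integrable continuous_filtered T \<eta>' that)
  fix \<phi> :: "'a \<Rightarrow> complex" assume \<phi>: "\<phi> \<in> test_fun"
  have [measurable]: "\<phi> \<in> borel_measurable borel" "filtered ?\<eta> T \<in> borel_measurable borel"
    using test_fun_measurable \<phi> filtered_borel T \<eta>' by blast+
  have "inv_fourier_dist (mult_dist \<eta> (fourier_dist T)) \<phi> = T (conv \<phi> (mult_kernel ?\<eta>))"
    by (simp add: inv_fourier_dist_def mult_dist_def fourier_dist_def fourier_mult_inv_fourier[OF \<eta>' \<phi>])
  also have "\<dots> = (LINT v|lborel. \<phi> v * filtered ?\<eta> T v)"
    unfolding filtered_def
    by (intro tempered_conv T schwartz_rapidly_decreasing test_fun_schwartz \<phi> mult_kernel_schwartz \<eta>')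
  also have "\<dots> = (LINT v|lebesgue. filtered ?\<eta> T v * \<phi> v)"
    by (subst integral_completion) (auto simp: mult.commute)
  finally show "inv_fourier_dist (mult_dist \<eta> (fourier_dist T)) \<phi> = (LINT v|lebesgue. filtered ?\<eta> T v * \<phi> v)" .
qed

text \<open>Mollify the indicator functions of shrinking neighbourhoods of \<open>K\<close>.\<close>
lemma indicator_compact_limit_test:
  fixes K :: "'a set"
  assumes "compact K" "K \<noteq> {}"
  obtains f R where "\<And>n::nat. f n \<in> test_fun" "\<And>n x. norm (f n x) \<le> 1" "\<And>n x. norm x > R \<Longrightarrow> f n x = 0"
    "\<And>x. (\<lambda>n. f n x) \<longlonglongrightarrow> complex_of_real (indicator K x)"
proof -
  \<comment> \<open>The cutoff lives in the ball of radius 2, so the mollifier is supported within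
    \<open>2 * r n = 1 / Suc n\<close>. With neighbourhoods of the same width, the mollified
    indicator is exactly 1 on \<open>K\<close> and vanishes at distance \<open>2 / Suc n\<close> or
    more.\<close>
  define r where "r n = 1 / (2 * real (Suc n))" for n
  have r: "r n > 0" "r n \<le> 1 / 2" for n by (auto simp: r_def field_simps)
  define J where "J n = (LINT x|lborel. \<phi>\<^sub>0 (inverse (r n) *\<^sub>R x))" for n
  have int: "integrable lborel (\<lambda>x. \<phi>\<^sub>0 (inverse (r n) *\<^sub>R x))" for n
    using integrable_Re[OF test_fun_integrable[OF cut_test[OF r(1)[of n]]]] by (simp add: cut_def)
  have J: "J n > 0" for n
  proof -
    have "0 < measure lborel (ball (0::'a) (r n))" using r(1) by (simp add: content_ball_pos)
    also have "\<dots> = (LINT x|lborel. indicator (ball (0::'a) (r n)) x)" by simp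
    also have "\<dots> \<le> J n" unfolding J_def
    proof (intro integral_mono int)
      fix x :: 'a
      show "indicator (ball 0 (r n)) x \<le> \<phi>\<^sub>0 (inverse (r n) *\<^sub>R x)"
        using cutoff_nonneg cutoff_one[of "inverse (r n) *\<^sub>R x"] r(1)[of n] by (auto simp: indicator_def field_simps)
    qed (intro integrable_real_indicator, use emeasure_lborel_ball_finite[of "0::'a" "r n"] in simp_all)
    finally show ?thesis .
  qed
  define \<rho> where "\<rho> n x = complex_of_real (1 / J n) * cut (r n) x" for n x
  have \<rho>_test: "\<rho> n \<in> test_fun" for n
    using test_fun_mult_smooth[OF cut_test[OF r(1)[of n]] smooth_const[of "complex_of_real (1 / J n)"]]
    by (simp add: \<rho>_def[abs_def] mult.commute)
  have \<rho>_int: "integrable lborel (\<rho> n)" for n by (rule test_fun_integrable[OF \<rho>_test])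
  have \<rho>_one: "(LINT x|lborel. \<rho> n x) = 1" for n
    using J[of n] by (simp add: \<rho>_def cut_def J_def[symmetric])
  have \<rho>_norm: "(LINT x|lborel. norm (\<rho> n x)) = 1" for n
  proof -
    have "norm (\<rho> n x) = (1 / J n) * \<phi>\<^sub>0 (inverse (r n) *\<^sub>R x)" for x
      using J[of n] cutoff_nonneg by (simp add: \<rho>_def cut_def norm_mult norm_divide)
    then show ?thesis using J[of n] by (simp add: J_def[symmetric])
  qed
  have \<rho>_supp: "norm v < 1 / real (Suc n)" if "\<rho> n v \<noteq> 0" for n v
  proof -
    have "norm v < 2 * r n" using that cut_zero[OF r(1)[of n], of v] by (force simp: \<rho>_def)
    also have "2 * r n = 1 / real (Suc n)" by (simp add: r_def field_simps)
    finally show ?thesis .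
  qed
  define Kn where "Kn n = {x. infdist x K \<le> 1 / real (Suc n)}" for n
  have closedKn: "closed (Kn n)" for n unfolding Kn_def
    by (intro closed_Collect_le continuous_intros)
  define w where "w n x = complex_of_real (indicator (Kn n) x)" for n x
  have w_meas [measurable]: "w n \<in> borel_measurable borel" for n
    unfolding w_def[abs_def] using closedKn[of n] by (auto intro!: borel_measurable_of_real)
  have w1: "norm (w n y * c) \<le> norm c" for n y c by (simp add: w_def indicator_def)
  have w_slow: "slowly_growing (w n)" for n
    unfolding slowly_growing_def using w_meas by (auto intro!: exI[of _ "1::real"] exI[of _ "0::nat"] simp: w_def indicator_def)
  have [measurable]: "\<rho> n \<in> borel_measurable borel" for n by (rule test_fun_measurable[OF \<rho>_test])
  define f where "f n = conv (w n) (\<rho> n)" for n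
  have f: "f n x = (LINT v|lborel. w n (x - v) * \<rho> n v)" for n x
    unfolding f_def by (rule conv_commute) auto
  have f_in: "f n x = 1" if "x \<in> K" for n x
  proof -
    have eq: "w n (x - v) * \<rho> n v = \<rho> n v" for v
    proof (cases "\<rho> n v = 0")
      case False
      have "infdist (x - v) K \<le> dist (x - v) x" by (rule infdist_le[OF that])
      then have "x - v \<in> Kn n" using \<rho>_supp[OF False] by (simp add: Kn_def dist_norm)
      then show ?thesis by (simp add: w_def)
    qed simp
    show ?thesis unfolding f by (simp only: eq \<rho>_one)
  qed
  have f_out: "f n x = 0" if "2 / real (Suc n) \<le> infdist x K" for n x
  proof -
    have eq: "w n (x - v) * \<rho> n v = 0" for v
    proof (cases "\<rho> n v = 0")
      case False
      have "infdist x K \<le> infdist (x - v) K + dist x (x - v)" by (rule infdist_triangle)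
      moreover have "dist x (x - v) = norm v" by (simp add: dist_norm)
      moreover have "2 / real (Suc n) = 1 / real (Suc n) + 1 / real (Suc n)" by simp
      ultimately have "infdist (x - v) K > 1 / real (Suc n)"
        using \<rho>_supp[OF False] that by linarith
      then show ?thesis by (simp add: w_def Kn_def)
    qed simp
    show ?thesis unfolding f by (simp only: eq) simp
  qed
  obtain B where B: "\<And>y. y \<in> K \<Longrightarrow> norm y \<le> B"
    using compact_imp_bounded[OF assms(1)] by (auto simp: bounded_iff)
  have f_supp: "f n x = 0" if "norm x > B + 2" for n x
  proof (rule f_out)
    obtain y where y: "y \<in> K" "infdist x K = dist x y"
      using infdist_attains_inf[OF compact_imp_closed[OF assms(1)] assms(2)] by metis
    have "2 \<le> infdist x K" using B[OF y(1)] that norm_triangle_sub[of x y] by (simp add: y dist_norm)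
    moreover have "2 / real (Suc n) \<le> 2" by (simp add: field_simps)
    ultimately show "2 / real (Suc n) \<le> infdist x K" by linarith
  qed
  have "f n \<in> test_fun" for n
  proof (rule test_funI[of _ "B + 2"])
    show "smooth (f n)" unfolding f_def by (intro smooth_conv w_slow test_fun_schwartz \<rho>_test)
  qed (rule f_supp)
  moreover have "norm (f n x) \<le> 1" for n x
  proof -
    have "norm (f n x) \<le> (LINT v|lborel. norm (\<rho> n v))"
      unfolding f
    proof (rule Bochner_Integration.integral_norm_bound_integral)
      show "integrable lborel (\<lambda>v. w n (x - v) * \<rho> n v)"
        by (rule Bochner_Integration.integrable_bound[OF \<rho>_int[of n]], measurable) (simp add: w1)
    qed (auto simp: \<rho>_int w1)
    then show ?thesis by (simp add: \<rho>_norm)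
  qed
  moreover have "(\<lambda>n. f n x) \<longlonglongrightarrow> complex_of_real (indicator K x)" for x
  proof (cases "x \<in> K")
    case False
    then have pos: "infdist x K > 0"
      using in_closed_iff_infdist_zero[OF compact_imp_closed[OF assms(1)] assms(2)] infdist_nonneg[of x K] by fastforce
    have "(\<lambda>n. 2 / real (Suc n)) \<longlonglongrightarrow> 0" by (rule LIMSEQ_Suc[OF lim_const_over_n[of 2]])
    then have "\<forall>\<^sub>F n in sequentially. 2 / real (Suc n) < infdist x K" using pos by (rule order_tendstoD)
    then have "\<forall>\<^sub>F n in sequentially. f n x = complex_of_real (indicator K x)"
      by eventually_elim (use False f_out in auto)
    then show ?thesis by (rule tendsto_eventually)
  qed (simp add: f_in)
  ultimately show ?thesis using that f_supp by blast
qed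

text \<open>The approximating test functions are bounded by 1 and supported in one common ball, so
  \<open>d\<close> restricted to that ball is an integrable majorant and the vanishing passes to the
  limit.\<close>

lemma integral_compact_zero:
  fixes d :: "'a \<Rightarrow> complex"
  assumes int: "\<And>C. compact C \<Longrightarrow> set_integrable lebesgue C d"
    and zero: "\<And>\<phi>. \<phi> \<in> test_fun \<Longrightarrow> (LINT x|lebesgue. d x * \<phi> x) = 0" and K: "compact K"
  shows "(LINT x:K|lebesgue. d x) = 0"
proof (cases "K = {}")
  case False
  obtain f R where f: "\<And>n::nat. f n \<in> test_fun" "\<And>n x. norm (f n x) \<le> 1" "\<And>n x. norm x > R \<Longrightarrow> f n x = 0"
    "\<And>x. (\<lambda>n. f n x) \<longlonglongrightarrow> complex_of_real (indicator K x)"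
    using indicator_compact_limit_test[OF K False] by metis
  let ?d = "\<lambda>x. indicator (cball 0 R) x *\<^sub>R d x"
  have dint: "integrable lebesgue ?d" using int[OF compact_cball] by (simp add: set_integrable_def)
  have eq: "d x * f n x = ?d x * f n x" for n x using f(3)[of x n] by (auto simp: indicator_def)
  have K_sub: "K \<subseteq> cball 0 R"
  proof
    fix x assume "x \<in> K"
    then have "(\<lambda>n. f n x) \<longlonglongrightarrow> 1" using f(4)[of x] by simp
    then show "x \<in> cball 0 R" using f(3)[of x] LIMSEQ_unique[of "\<lambda>n. f n x" 1 0] by (cases "norm x > R") auto
  qed
  have "(\<lambda>n. LINT x|lebesgue. ?d x * f n x) \<longlonglongrightarrow> (LINT x|lebesgue. ?d x * complex_of_real (indicator K x))"
  proof (rule integral_dominated_convergence[where w="\<lambda>x. norm (?d x)"])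
    have fm: "f n \<in> borel_measurable lebesgue" for n
      using test_fun_measurable[OF f(1)[of n]] by (simp add: measurable_completion)
    have dm: "?d \<in> borel_measurable lebesgue" using dint by (rule borel_measurable_integrable)
    show "(\<lambda>x. ?d x * f n x) \<in> borel_measurable lebesgue" for n by (intro borel_measurable_times fm dm)
    have "K \<in> sets lebesgue" using compact_imp_closed[OF K] by (simp add: sets_completionI_sets)
    then show "(\<lambda>x. ?d x * complex_of_real (indicator K x)) \<in> borel_measurable lebesgue"
      by (intro borel_measurable_times dm measurable_compose[OF borel_measurable_indicator borel_measurable_of_real])
    show "AE x in lebesgue. (\<lambda>n. ?d x * f n x) \<longlonglongrightarrow> ?d x * complex_of_real (indicator K x)"
      by (intro AE_I2 tendsto_mult tendsto_const f)
    show "AE x in lebesgue. norm (?d x * f n x) \<le> norm (?d x)" for n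
      unfolding norm_mult by (intro AE_I2 mult_right_le_one_le f) auto
  qed (rule integrable_norm[OF dint])
  moreover have "(LINT x|lebesgue. ?d x * f n x) = 0" for n
    using zero[OF f(1)[of n]] unfolding eq .
  moreover have "?d x * complex_of_real (indicator K x) = indicator K x *\<^sub>R d x" for x
    using K_sub by (auto simp: indicator_def)
  ultimately show ?thesis using LIMSEQ_unique[OF tendsto_const, of "0::complex"] by (simp add: set_lebesgue_integral_def)
qed (simp add: set_lebesgue_integral_def)

text \<open>Once all integrals over compact sets vanish, the sign criterion is applied to the real
  and imaginary parts and to their negatives.\<close>

lemma AE_zero_if_integral_test_zero:
  fixes d :: "'a \<Rightarrow> complex"
  assumes int: "\<And>C. compact C \<Longrightarrow> set_integrable lebesgue C d"
    and zero: "\<And>\<phi>. \<phi> \<in> test_fun \<Longrightarrow> (LINT x|lebesgue. d x * \<phi> x) = 0"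
  shows "AE x in lebesgue. d x = 0"
proof -
  have part: "AE x in lebesgue. L (d x) \<le> 0" if L: "bounded_linear L" for L :: "complex \<Rightarrow> real"
  proof (rule AE_nonpos_if_integral_compact_zero)
    fix C :: "'a set" assume C: "compact C"
    have int': "integrable lebesgue (\<lambda>x. indicator C x *\<^sub>R d x)"
      using int[OF C] unfolding set_integrable_def .
    have eq: "L (indicator C x *\<^sub>R d x) = indicator C x *\<^sub>R L (d x)" for x
      using L by (simp add: linear_simps)
    show "set_integrable lebesgue C (\<lambda>x. L (d x))"
      using integrable_bounded_linear[OF L int'] unfolding set_integrable_def eq .
    have "(LINT x|lebesgue. L (indicator C x *\<^sub>R d x)) = L (LINT x|lebesgue. indicator C x *\<^sub>R d x)"
      by (rule integral_bounded_linear[OF L int'])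
    then show "(LINT x:C|lebesgue. L (d x)) = 0"
      using integral_compact_zero[OF int zero C] linear_simps(3)[OF L] unfolding eq set_lebesgue_integral_def by simp
  qed
  have "AE x in lebesgue. Re (d x) \<le> 0" "AE x in lebesgue. - Re (d x) \<le> 0"
    "AE x in lebesgue. Im (d x) \<le> 0" "AE x in lebesgue. - Im (d x) \<le> 0"
    by (rule part, rule bounded_linear_Re)
      (rule part, rule bounded_linear_minus, rule bounded_linear_Re,
       rule part, rule bounded_linear_Im, rule part, rule bounded_linear_minus, rule bounded_linear_Im)
  then show ?thesis by eventually_elim (auto simp: complex_eq_iff)
qed

text \<open>This pins down the choice in \<open>fun_of_dist\<close> up to null sets, so the Morrey
  quasi-norm may be computed from any explicit representative.\<close>

lemma represents_unique:
  fixes g g' :: "'a \<Rightarrow> complex"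
  assumes "represents g T" "represents g' T"
  shows "AE x in lebesgue. g x = g' x"
proof -
  have "AE x in lebesgue. g x - g' x = 0"
  proof (rule AE_zero_if_integral_test_zero)
    show "set_integrable lebesgue C (\<lambda>x. g x - g' x)" if "compact C" for C
      using assms that by (auto simp: represents_def intro!: set_integral_diff)
    fix \<phi> :: "'a \<Rightarrow> complex" assume \<phi>: "\<phi> \<in> test_fun"
    obtain R where R: "\<And>x. norm x > R \<Longrightarrow> \<phi> x = 0" using test_fun_bounded_support[OF \<phi>] by metis
    obtain M where M: "\<And>x. norm (\<phi> x) \<le> M" using schwartz_rapid[OF test_fun_schwartz[OF \<phi>], of 0] by auto
    have m: "\<phi> \<in> borel_measurable lebesgue" using test_fun_measurable[OF \<phi>] by (simp add: measurable_completion)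
    have int: "integrable lebesgue (\<lambda>x. h x * \<phi> x)" if "represents h T" for h
    proof -
      have hi: "integrable lebesgue (\<lambda>x. indicator (cball 0 R) x *\<^sub>R h x)"
        using that compact_cball unfolding represents_def set_integrable_def by blast
      have "integrable lebesgue (\<lambda>x. (indicator (cball 0 R) x *\<^sub>R h x) * \<phi> x)"
      proof (rule Bochner_Integration.integrable_bound[of _ "\<lambda>x. M * norm (indicator (cball 0 R) x *\<^sub>R h x)"])
        show "(\<lambda>x. (indicator (cball 0 R) x *\<^sub>R h x) * \<phi> x) \<in> borel_measurable lebesgue"
          by (intro borel_measurable_times m borel_measurable_integrable[OF hi])
        show "AE x in lebesgue. norm ((indicator (cball 0 R) x *\<^sub>R h x) * \<phi> x) \<le> norm (M * norm (indicator (cball 0 R) x *\<^sub>R h x))"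
        proof (rule AE_I2)
          fix x
          have "norm (\<phi> x) \<le> \<bar>M\<bar>" using M[of x] by linarith
          then show "norm ((indicator (cball 0 R) x *\<^sub>R h x) * \<phi> x) \<le> norm (M * norm (indicator (cball 0 R) x *\<^sub>R h x))"
            unfolding norm_mult real_norm_def abs_mult abs_norm_cancel mult.commute[of "\<bar>M\<bar>"]
            by (rule mult_left_mono) simp
        qed
      qed (rule integrable_mult_right[OF integrable_norm[OF hi]])
      moreover have "(indicator (cball 0 R) x *\<^sub>R h x) * \<phi> x = h x * \<phi> x" for x
        using R[of x] by (auto simp: indicator_def)
      ultimately show ?thesis by simp
    qed
    have "(LINT x|lebesgue. (g x - g' x) * \<phi> x) = (LINT x|lebesgue. g x * \<phi> x) - (LINT x|lebesgue. g' x * \<phi> x)"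
      using int assms by (simp add: left_diff_distrib)
    moreover have "(LINT x|lebesgue. g x * \<phi> x) = T \<phi>" "(LINT x|lebesgue. g' x * \<phi> x) = T \<phi>"
      using assms \<phi> by (auto simp: represents_def)
    ultimately show "(LINT x|lebesgue. (g x - g' x) * \<phi> x) = 0" by simp
  qed
  then show ?thesis by simp
qed

text \<open>Two continuous representatives differ on an open set of measure zero, which must be
  empty. This justifies the definite description in \<open>fourier_mult\<close>.\<close>

lemma represents_continuous_unique:
  fixes g g' :: "'a \<Rightarrow> complex"
  assumes "represents g T" "represents g' T" "continuous_on UNIV g" "continuous_on UNIV g'"
  shows "g = g'"
proof -
  let ?S = "{x. g x \<noteq> g' x}"
  have "AE x in lebesgue. x \<notin> ?S" using represents_unique[OF assms(1,2)] by simp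
  then have "negligible ?S" 
    by (auto simp: negligible_iff_null_sets eventually_ae_filter intro: completion.complete2 negligible_subset)
  moreover have "open ?S" using assms by (intro open_Collect_neq) auto
  ultimately show ?thesis using open_not_negligible[of ?S] by auto
qed

lemma fourier_mult_eq_filtered:
  fixes \<eta> :: "'a \<Rightarrow> real"
  assumes T: "T \<in> tempered" and \<eta>: "\<eta> \<in> test_fun"
  shows "fourier_mult \<eta> T = filtered (\<lambda>\<xi>. of_real (\<eta> \<xi>)) T"
  unfolding fourier_mult_def
proof (rule the_equality)
  show "smooth (filtered (\<lambda>\<xi>. of_real (\<eta> \<xi>)) T) \<and>
    represents (filtered (\<lambda>\<xi>. of_real (\<eta> \<xi>)) T) (inv_fourier_dist (mult_dist \<eta> (fourier_dist T)))"
    using smooth_filtered[OF T test_fun_of_real[OF \<eta>]] represents_filtered[OF T \<eta>] by simp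
  fix g assume "smooth g \<and> represents g (inv_fourier_dist (mult_dist \<eta> (fourier_dist T)))"
  then show "g = filtered (\<lambda>\<xi>. of_real (\<eta> \<xi>)) T"
    using represents_continuous_unique represents_filtered[OF T \<eta>] smooth_continuous_on
      continuous_filtered[OF T test_fun_of_real[OF \<eta>]] by blast
qed

end

section \<open>Littlewood-Paley decomposition\<close>

lemma integrable_schwartz_translate_diff:
  fixes k \<psi> :: "'a::euclidean_space \<Rightarrow> complex"
  assumes "k \<in> schwartz" "\<psi> \<in> schwartz"
  shows "integrable lborel (\<lambda>v. k v * (\<psi> (z - v) - \<psi> z))"
  using conv_integrable[OF schwartz_slowly_growing[OF assms(1)] assms(2), of z] schwartz_integrable[OF assms(1)]
  by (auto simp: right_diff_distrib intro!: Bochner_Integration.integrable_diff)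

context smooth_cutoff
begin

lemma mult_kernel_cut:
  assumes "t > 0"
  shows "mult_kernel (cut t) v = of_real (t ^ DIM('a)) * mult_kernel (cut 1) (t *\<^sub>R v)"
proof -
  have "cut t = (\<lambda>\<xi>. cut 1 (inverse t *\<^sub>R \<xi>))" by (simp add: cut_def fun_eq_iff)
  then show ?thesis using mult_kernel_scale[OF cut_test assms, of 1] by simp
qed

text \<open>The kernel has total mass 1 and lives at scale \<open>1 / t\<close>: after the
  substitution \<open>u = t *\<^sub>R v\<close> the increment of \<psi> contributes the factor
  \<open>norm u / t\<close>, and the remaining moment of the fixed kernel is finite.\<close>

lemma approximate_identity:
  assumes \<psi>: "\<psi> \<in> schwartz" and t: "t \<ge> 1" and C: "C \<ge> 0"
    and bound: "\<And>v z. (1 + norm z) ^ N * norm (\<psi> (z - v) - \<psi> z) \<le> C * (min 1 (norm v) * (1 + norm v) ^ N)"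
  shows "(1 + norm z) ^ N * norm (conv (mult_kernel (cut t)) \<psi> z - \<psi> z)
    \<le> C * (LINT u|lborel. (1 + norm u) ^ Suc N * norm (mult_kernel (cut 1) (u::'a))) / t"
proof -
  let ?k = "mult_kernel (cut t)" and ?K = "mult_kernel (cut 1)"
  have kS: "?k \<in> schwartz" and KS: "?K \<in> schwartz" using t by (auto intro!: mult_kernel_schwartz cut_test)
  have [measurable]: "?k \<in> borel_measurable borel" "?K \<in> borel_measurable borel"
    using kS KS schwartz_measurable by blast+
  \<comment> \<open>The mass of the kernel is its symbol at the origin, by the inversion
    formula.\<close>
  have one: "(LINT v|lborel. ?k v) = 1"
    using mult_kernel_inversion[OF cut_test, of t 0] cut_one[of t 0] t by simp
  let ?f = "\<lambda>u. C * ((norm u / t) * ((1 + norm u) ^ N * norm (?K u)))"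
  have bint: "integrable lborel (\<lambda>u. (1 + norm u) ^ Suc N * norm (?K u))"
    by (intro rapidly_decreasing_integrable_moment schwartz_rapidly_decreasing KS)
  have fint: "integrable lborel ?f"
  proof (rule integrable_mult_right, rule Bochner_Integration.integrable_bound[OF integrable_mult_right[OF bint, of "1 / t"]])
    have "norm u / t * ((1 + norm u) ^ N * norm (?K u)) \<le> 1 / t * ((1 + norm u) ^ Suc N * norm (?K u))" for u
    proof -
      have "norm u * ((1 + norm u) ^ N * norm (?K u)) \<le> (1 + norm u) * ((1 + norm u) ^ N * norm (?K u))"
        by (intro mult_right_mono) auto
      then show ?thesis using t by (simp add: divide_right_mono mult.assoc)
    qed
    then show "AE u in lborel. norm (norm u / t * ((1 + norm u) ^ N * norm (?K u))) \<le> norm (1 / t * ((1 + norm u) ^ Suc N * norm (?K u)))"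
      using t by (intro AE_I2) (auto simp: abs_mult)
  qed measurable
  have ik: "integrable lborel ?k" by (rule schwartz_integrable[OF kS])
  have ic: "integrable lborel (\<lambda>v. ?k v * \<psi> (z - v))" by (rule conv_integrable[OF schwartz_slowly_growing[OF kS] \<psi>])
  have "conv ?k \<psi> z - \<psi> z = (LINT v|lborel. ?k v * \<psi> (z - v)) - (LINT v|lborel. ?k v * \<psi> z)"
    by (simp add: conv_def one)
  also have "\<dots> = (LINT v|lborel. ?k v * (\<psi> (z - v) - \<psi> z))"
    using ik ic by (simp add: right_diff_distrib)
  finally have "(1 + norm z) ^ N * norm (conv ?k \<psi> z - \<psi> z) = norm (LINT v|lborel. ((1 + norm z) ^ N) *\<^sub>R (?k v * (\<psi> (z - v) - \<psi> z)))"
    by simp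
  also have "\<dots> \<le> (LINT v|lborel. t ^ DIM('a) * ?f (t *\<^sub>R v))"
  proof (rule Bochner_Integration.integral_norm_bound_integral)
    show "integrable lborel (\<lambda>v. ((1 + norm z) ^ N) *\<^sub>R (?k v * (\<psi> (z - v) - \<psi> z)))"
      by (intro integrable_scaleR_right integrable_schwartz_translate_diff kS \<psi>)
    have "integrable lborel (\<lambda>v. ?f (0 + t *\<^sub>R v))"
      by (subst lborel_integral_scale(2)) (use t fint in auto)
    then have "integrable lborel (\<lambda>v. ?f (t *\<^sub>R v))" unfolding add_0_left .
    then show "integrable lborel (\<lambda>v. t ^ DIM('a) * ?f (t *\<^sub>R v))" by (rule integrable_mult_right)
    fix v :: 'a
    have "norm (((1 + norm z) ^ N) *\<^sub>R (?k v * (\<psi> (z - v) - \<psi> z))) =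
       t ^ DIM('a) * (norm (?K (t *\<^sub>R v)) * ((1 + norm z) ^ N * norm (\<psi> (z - v) - \<psi> z)))"
      using t mult_kernel_cut[of t v] by (simp add: norm_mult norm_power)
    also have "\<dots> \<le> t ^ DIM('a) * (norm (?K (t *\<^sub>R v)) * (C * (min 1 (norm v) * (1 + norm v) ^ N)))"
      using t by (intro mult_left_mono bound) auto
    also have "\<dots> \<le> t ^ DIM('a) * (norm (?K (t *\<^sub>R v)) * (C * (norm v * (1 + norm (t *\<^sub>R v)) ^ N)))"
      using t C by (intro mult_left_mono mult_mono power_mono) (auto simp: mult_le_cancel_right1)
    also have "\<dots> = t ^ DIM('a) * ?f (t *\<^sub>R v)" using t by simp
    finally show "norm (((1 + norm z) ^ N) *\<^sub>R (?k v * (\<psi> (z - v) - \<psi> z))) \<le> t ^ DIM('a) * ?f (t *\<^sub>R v)" .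
  qed
  also have "\<dots> = (LINT u|lborel. ?f u)"
    using lborel_integral_scale(1)[of ?f t 0] t by simp
  also have "\<dots> \<le> (LINT u|lborel. C * (1 / t) * ((1 + norm u) ^ Suc N * norm (?K u)))"
  proof (rule integral_mono[OF fint integrable_mult_right[OF bint]])
    fix u
    have "norm u * ((1 + norm u) ^ N * norm (?K u)) \<le> (1 + norm u) * ((1 + norm u) ^ N * norm (?K u))"
      by (intro mult_right_mono) auto
    then have "norm u / t * ((1 + norm u) ^ N * norm (?K u)) \<le> 1 / t * ((1 + norm u) ^ Suc N * norm (?K u))"
      using t by (simp add: divide_right_mono mult.assoc)
    then show "?f u \<le> C * (1 / t) * ((1 + norm u) ^ Suc N * norm (?K u))"
      using mult_left_mono[OF _ C] by (simp only: mult.assoc)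
  qed
  also have "\<dots> = C * (LINT u|lborel. (1 + norm u) ^ Suc N * norm (?K u)) / t"
    by (simp only: integral_mult_right_zero) simp
  finally show ?thesis .
qed

text \<open>Filtering \<open>T\<close> is dual to mollifying \<phi>. The mollified test functions
  converge to \<phi>, at rate \<open>2 ^ n\<close> in the denominator, in the one seminorm that
  controls \<open>T\<close>.\<close>

lemma filtered_cut_tendsto:
  fixes T :: "('a \<Rightarrow> complex) \<Rightarrow> complex"
  assumes T: "T \<in> tempered" and \<phi>: "\<phi> \<in> test_fun"
  shows "(\<lambda>n. LINT v|lborel. \<phi> v * filtered (cut (2 ^ n)) T v) \<longlonglongrightarrow> T \<phi>"
proof -
  have \<phi>S: "\<phi> \<in> schwartz" by (rule test_fun_schwartz[OF \<phi>])
  obtain A N where A: "A > 0" "\<And>\<phi> M. \<phi> \<in> schwartz \<Longrightarrow> seminorm_le N \<phi> M \<Longrightarrow> norm (T \<phi>) \<le> A * M"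
    by (rule tempered_bound[OF T]) blast
  obtain C where C: "C > 0" "\<And>v v' z bs. set bs \<subseteq> Basis \<Longrightarrow> length bs \<le> N \<Longrightarrow>
     (1 + norm z) ^ N * norm (iter_deriv bs \<phi> (z - v) - iter_deriv bs \<phi> (z - v')) \<le>
     C * (min 1 (norm (v - v')) * ((1 + norm v) ^ N * (1 + norm v') ^ N))"
    by (rule schwartz_translate_diff_bound_uniform[OF \<phi>S, of N]) blast
  define W where "W = (LINT u|lborel. (1 + norm u) ^ Suc N * norm (mult_kernel (cut 1) (u::'a)))"
  have bd: "norm (T (conv \<phi> (mult_kernel (cut (2 ^ n)))) - T \<phi>) \<le> A * (C * W / 2 ^ n)" for n
  proof -
    let ?k = "mult_kernel (cut (2 ^ n))"
    have kS: "?k \<in> schwartz" by (intro mult_kernel_schwartz cut_test) simp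
    have cS: "conv \<phi> ?k \<in> schwartz" by (intro conv_schwartz schwartz_rapidly_decreasing \<phi>S kS)
    have comm: "conv \<phi> ?k = conv ?k \<phi>"
    proof
      fix z show "conv \<phi> ?k z = conv ?k \<phi> z"
        using conv_commute[OF schwartz_measurable[OF \<phi>S] schwartz_measurable[OF kS]]
        by (simp add: conv_def mult.commute)
    qed
    show ?thesis
      unfolding tempered_diff[OF T cS \<phi>S, symmetric]
    proof (rule A(2))
      show "(\<lambda>x. conv \<phi> ?k x - \<phi> x) \<in> schwartz" by (intro schwartz_diff cS \<phi>S)
      show "seminorm_le N (\<lambda>x. conv \<phi> ?k x - \<phi> x) (C * W / 2 ^ n)"
        unfolding seminorm_le_def
      proof (intro allI impI)
        fix z and bs :: "'a list" assume bs: "set bs \<subseteq> Basis" "length bs \<le> N"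
        have "iter_deriv bs (\<lambda>x. conv \<phi> ?k x - \<phi> x) z = conv ?k (iter_deriv bs \<phi>) z - iter_deriv bs \<phi> z"
          unfolding comm using bs \<phi>S kS
          by (simp add: iter_deriv_diff smooth_conv schwartz_slowly_growing schwartz_smooth iter_deriv_conv)
        moreover have "(1 + norm z) ^ N * norm (conv ?k (iter_deriv bs \<phi>) z - iter_deriv bs \<phi> z) \<le> C * W / 2 ^ n"
          unfolding W_def
        proof (rule approximate_identity)
          show "(1 + norm z) ^ N * norm (iter_deriv bs \<phi> (z - v) - iter_deriv bs \<phi> z) \<le> C * (min 1 (norm v) * (1 + norm v) ^ N)" for v z
            using C(2)[OF bs, of z v 0] by simp
        qed (use C bs \<phi>S in \<open>auto intro: schwartz_iter_deriv\<close>)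
        ultimately show "(1 + norm z) ^ N * norm (iter_deriv bs (\<lambda>x. conv \<phi> ?k x - \<phi> x) z) \<le> C * W / 2 ^ n" by simp
      qed
    qed
  qed
  have lim: "(\<lambda>n. A * (C * W / 2 ^ n)) \<longlonglongrightarrow> 0"
    by real_asymp
  have "(\<lambda>n. T (conv \<phi> (mult_kernel (cut (2 ^ n)))) - T \<phi>) \<longlonglongrightarrow> 0"
    by (rule Lim_null_comparison[OF _ lim]) (use bd in \<open>rule always_eventually[OF allI]\<close>)
  then have "(\<lambda>n. T (conv \<phi> (mult_kernel (cut (2 ^ n))))) \<longlonglongrightarrow> T \<phi>" by (rule LIM_zero_cancel)
  moreover have "T (conv \<phi> (mult_kernel (cut (2 ^ n)))) = (LINT v|lborel. \<phi> v * filtered (cut (2 ^ n)) T v)" for n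
    unfolding filtered_def
    by (intro tempered_conv T schwartz_rapidly_decreasing \<phi>S mult_kernel_schwartz cut_test) simp
  ultimately show ?thesis by simp
qed

lemma psi_eq_cut: "complex_of_real (psi \<phi>\<^sub>0 k \<xi>) = cut (2 powi k) \<xi> - cut (2 powi (k - 1)) \<xi>"
proof -
  have "inverse ((2::real) powi (k - 1)) = 2 * 2 powi (- k)"
    by (simp add: power_int_diff power_int_minus field_simps)
  moreover have "inverse ((2::real) powi k) = 2 powi (- k)" by (simp add: power_int_minus)
  ultimately show ?thesis unfolding psi_def cut_def Let_def by simp
qed

lemma psi_test: "(\<lambda>\<xi>. complex_of_real (psi \<phi>\<^sub>0 k \<xi>)) \<in> test_fun"
proof -
  have "(\<lambda>\<xi>. - 1 * cut (2 powi (k - 1)) \<xi>) \<in> test_fun"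
    using test_fun_mult_smooth[OF cut_test smooth_const[of "-1"], of "2 powi (k - 1)"] by simp
  from test_fun_add[OF cut_test this, of "2 powi k"] show ?thesis by (simp add: psi_eq_cut)
qed

lemma psi_support: "complex_of_real (psi \<phi>\<^sub>0 k \<xi>) \<noteq> 0 \<Longrightarrow> norm \<xi> \<le> 2 * 2 powi k"
proof (rule ccontr)
  assume "complex_of_real (psi \<phi>\<^sub>0 k \<xi>) \<noteq> 0" "\<not> norm \<xi> \<le> 2 * 2 powi k"
  moreover have "(2::real) powi (k - 1) \<le> 2 powi k" by (intro power_int_increasing) auto
  ultimately show False unfolding psi_eq_cut
    using cut_zero[of "2 powi k" \<xi>] cut_zero[of "2 powi (k - 1)" \<xi>] by (simp add: not_le)
qed

lemma psi_test_real: "psi \<phi>\<^sub>0 k \<in> test_fun"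
proof -
  have "smooth (\<lambda>\<xi>. Re (complex_of_real (psi \<phi>\<^sub>0 k \<xi>)))"
    by (rule smooth_compose_linear[OF bounded_linear_Re test_fun_smooth[OF psi_test]])
  then show ?thesis
    using psi_support[of k] by (intro test_funI[of _ "2 * 2 powi k"]) (auto simp: not_le[symmetric])
qed

definition piece :: "(('a \<Rightarrow> complex) \<Rightarrow> complex) \<Rightarrow> int \<Rightarrow> 'a \<Rightarrow> complex" where
  "piece T k = filtered (\<lambda>\<xi>. of_real (psi \<phi>\<^sub>0 k \<xi>)) T"

lemma fourier_mult_psi: "T \<in> tempered \<Longrightarrow> fourier_mult (psi \<phi>\<^sub>0 k) T = piece T k"
  unfolding piece_def by (rule fourier_mult_eq_filtered[OF _ psi_test_real])

lemma fourier_mult_phi: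
  "T \<in> tempered \<Longrightarrow> fourier_mult (phi \<phi>\<^sub>0 k) T = (if k = 0 then filtered (cut 1) T else piece T k)"
  using fourier_mult_eq_filtered[OF _ cutoff_test] fourier_mult_psi
  by (auto simp: phi_def cut_def[abs_def])

lemma filtered_cut_Suc:
  assumes "T \<in> tempered"
  shows "filtered (cut (2 ^ Suc n)) T x = filtered (cut (2 ^ n)) T x + piece T (int (Suc n)) x"
proof -
  have "cut (2 ^ Suc n) = (\<lambda>\<xi>. cut (2 ^ n) \<xi> + of_real (psi \<phi>\<^sub>0 (int (Suc n)) \<xi>))"
    by (rule ext) (simp add: psi_eq_cut power_int_add)
  then show ?thesis unfolding piece_def
    using filtered_add[OF assms cut_test psi_test, of "2 ^ n" "int (Suc n)" x] by simp
qed

lemma filtered_cut_sum: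
  assumes "T \<in> tempered"
  shows "filtered (cut (2 ^ n)) T x = (\<Sum>k\<le>n. fourier_mult (phi \<phi>\<^sub>0 (int k)) T x)"
  by (induction n) (simp_all add: fourier_mult_phi[OF assms] filtered_cut_Suc[OF assms] del: power_Suc of_nat_Suc)

end

section \<open>Convolution estimates with exponent p\<close>

text \<open>Write \<open>|F|\<close> as \<open>|F| powr (1 - p) * |F| powr p\<close>, bound the
  first factor by the assumed supremum bound, integrate, and divide by a power of the integral of
  \<open>|F|\<close>, which is finite by integrability of \<open>F\<close>.\<close>

lemma nn_integral_powr_le_small_exponent:
  fixes F :: "'a::euclidean_space \<Rightarrow> complex"
  assumes int: "integrable lborel F" and S: "S > 0"
    and sup: "\<And>z. norm (F z) \<le> S * (LINT v|lborel. norm (F v))" and p: "0 < p" "p \<le> 1"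
  shows "ennreal ((LINT v|lborel. norm (F v)) powr p) \<le>
    ennreal (S powr (1 - p)) * (\<integral>\<^sup>+v. ennreal (norm (F v) powr p) \<partial>lborel)"
proof -
  define I where "I = (LINT v|lborel. norm (F v))"
  have I0: "I \<ge> 0" by (simp add: I_def)
  have [measurable]: "F \<in> borel_measurable borel" using borel_measurable_integrable[OF int] by simp
  show ?thesis
  proof (cases "I = 0")
    case True
    then show ?thesis by (simp add: I_def)
  next
    case False
    then have I: "I > 0" using I0 by simp
    have "ennreal I = (\<integral>\<^sup>+v. ennreal (norm (F v)) \<partial>lborel)"
      unfolding I_def by (rule nn_integral_eq_integral[symmetric]) (use int in auto)
    also have "\<dots> \<le> (\<integral>\<^sup>+v. ennreal ((S * I) powr (1 - p)) * ennreal (norm (F v) powr p) \<partial>lborel)"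
    proof (rule nn_integral_mono)
      fix v
      have "norm (F v) = norm (F v) powr (1 - p) * norm (F v) powr p"
        by (simp add: powr_add[symmetric])
      also have "\<dots> \<le> (S * I) powr (1 - p) * norm (F v) powr p"
        using sup[of v] p by (intro mult_right_mono powr_mono2) (auto simp: I_def)
      finally show "ennreal (norm (F v)) \<le> ennreal ((S * I) powr (1 - p)) * ennreal (norm (F v) powr p)"
        by (simp add: ennreal_mult[symmetric])
    qed
    also have "\<dots> = ennreal ((S * I) powr (1 - p)) * (\<integral>\<^sup>+v. ennreal (norm (F v) powr p) \<partial>lborel)"
      by (rule nn_integral_cmult) measurable
    finally have le: "ennreal I \<le> ennreal ((S * I) powr (1 - p)) * (\<integral>\<^sup>+v. ennreal (norm (F v) powr p) \<partial>lborel)" .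
    have "ennreal (I powr p) = ennreal (I powr (p - 1)) * ennreal I"
      using I by (simp add: ennreal_mult[symmetric] powr_diff)
    also have "\<dots> \<le> ennreal (I powr (p - 1)) * (ennreal ((S * I) powr (1 - p)) * (\<integral>\<^sup>+v. ennreal (norm (F v) powr p) \<partial>lborel))"
      by (rule mult_left_mono[OF le]) simp
    also have "\<dots> = ennreal (I powr (p - 1) * (S * I) powr (1 - p)) * (\<integral>\<^sup>+v. ennreal (norm (F v) powr p) \<partial>lborel)"
      by (simp add: ennreal_mult mult.assoc)
    also have "I powr (p - 1) * (S * I) powr (1 - p) = S powr (1 - p)"
      using I S by (simp add: powr_mult powr_add[symmetric] mult.left_commute)
    finally show ?thesis by (simp add: I_def)
  qed
qed

text \<open>Jensen's inequality for a weight \<open>h\<close> of mass at most \<open>M\<close>,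
  obtained by integrating the tangent line of the power function at the mean value. An upper bound
  \<open>M\<close> is enough because the constant term of the tangent estimate is
  nonnegative.\<close>

lemma nn_integral_powr_le_large_exponent:
  fixes h g :: "'a::euclidean_space \<Rightarrow> real"
  assumes h: "integrable lborel h" "\<And>v. h v \<ge> 0" and hg: "integrable lborel (\<lambda>v. h v * g v)"
    and g: "\<And>v. g v \<ge> 0" "g \<in> borel_measurable borel" and M: "(LINT v|lborel. h v) \<le> M" "M > 0" and p: "p \<ge> 1"
  shows "ennreal ((LINT v|lborel. h v * g v) powr p) \<le>
    ennreal (M powr (p - 1)) * (\<integral>\<^sup>+v. ennreal (h v * g v powr p) \<partial>lborel)"
proof -
  have [measurable]: "h \<in> borel_measurable borel" "g \<in> borel_measurable borel"
    using borel_measurable_integrable[OF h(1)] g(2) by simp_all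
  define I where "I = (LINT v|lborel. h v * g v)"
  have I0: "I \<ge> 0" unfolding I_def using h g by (intro Bochner_Integration.integral_nonneg) auto
  show ?thesis
  \<comment> \<open>Set aside are the cases in which one could not divide by the mean, the conjugate
    exponent would degenerate, or the right-hand side would not be a real number.\<close>
  proof (cases "I = 0 \<or> p = 1 \<or> (\<integral>\<^sup>+v. ennreal (h v * g v powr p) \<partial>lborel) = \<top>")
    case True
    then consider "I = 0" | "p = 1" | "(\<integral>\<^sup>+v. ennreal (h v * g v powr p) \<partial>lborel) = \<top>" by blast
    then show ?thesis
    proof cases
      case 1
      then show ?thesis using p by (simp add: I_def)
    next
      case 2
      then show ?thesis using nn_integral_eq_integral[OF hg] h g I0 M by (simp add: I_def)
    next
      case 3
      then show ?thesis using M by (simp add: ennreal_mult_top)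
    qed
  next
    case False
    then have I: "I > 0" and p1: "p > 1" and fin: "(\<integral>\<^sup>+v. ennreal (h v * g v powr p) \<partial>lborel) < \<top>"
      using I0 p by (auto simp: less_top)
    have int: "integrable lborel (\<lambda>v. h v * g v powr p)"
      by (rule integrableI_nonneg) (use h fin in auto)
    define X where "X = (LINT v|lborel. h v * g v powr p)"
    \<comment> \<open>The point of tangency: the mean of \<open>g\<close> if \<open>h\<close> had
      mass exactly \<open>M\<close>.\<close>
    define l where "l = I / M"
    have l: "l > 0" using I M by (simp add: l_def)
    \<comment> \<open>Young's inequality for the pair \<open>y / l\<close> and 1, rescaled; equality
      holds at \<open>y = l\<close>.\<close>
    have tangent: "y \<le> l powr (1 - p) / p * y powr p + (1 - 1 / p) * l" if "y \<ge> 0" for y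
    proof -
      define q where "q = p / (p - 1)"
      have "(y / l) * 1 \<le> (y / l) powr p / p + 1 powr q / q"
        by (rule Youngs_inequality) (use p1 that l in \<open>auto simp: q_def field_simps\<close>)
      moreover have "1 / q = 1 - 1 / p" using p1 by (simp add: q_def field_simps)
      ultimately have "y / l \<le> (y / l) powr p / p + (1 - 1 / p)" by simp
      then have "l * (y / l) \<le> l * ((y / l) powr p / p + (1 - 1 / p))" using l by (intro mult_left_mono) auto
      moreover have "(y / l) powr p = y powr p * l powr (- p)" using that l by (simp add: powr_divide powr_minus_divide)
      moreover have "l * (c * l powr (- p)) = c * l powr (1 - p)" for c using l by (simp add: powr_diff powr_minus_divide)
      ultimately show ?thesis using l by (simp add: distrib_left mult.commute mult.left_commute)
    qed
    have "I \<le> (LINT v|lborel. l powr (1 - p) / p * (h v * g v powr p) + (1 - 1 / p) * l * h v)"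
      unfolding I_def
    proof (rule integral_mono[OF hg])
      show "integrable lborel (\<lambda>v. l powr (1 - p) / p * (h v * g v powr p) + (1 - 1 / p) * l * h v)"
        using int h(1) by auto
      fix v
      have "h v * g v \<le> h v * (l powr (1 - p) / p * g v powr p + (1 - 1 / p) * l)"
        by (rule mult_left_mono[OF tangent[OF g(1)] h(2)])
      then show "h v * g v \<le> l powr (1 - p) / p * (h v * g v powr p) + (1 - 1 / p) * l * h v"
        by (simp add: distrib_left mult_ac)
    qed
    also have "\<dots> = l powr (1 - p) / p * X + (1 - 1 / p) * l * (LINT v|lborel. h v)"
      using int h(1) by (simp add: X_def)
    also have "\<dots> \<le> l powr (1 - p) / p * X + (1 - 1 / p) * l * M"
      using p1 l M by (intro add_left_mono mult_left_mono) auto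
    also have "(1 - 1 / p) * l * M = (1 - 1 / p) * I" using M by (simp add: l_def)
    finally have "I / p \<le> l powr (1 - p) / p * X" by (simp add: algebra_simps)
    then have "I \<le> l powr (1 - p) * X" using p1 by (simp add: field_simps)
    then have "l powr (p - 1) * I \<le> l powr (p - 1) * (l powr (1 - p) * X)" by (rule mult_left_mono) simp
    also have "\<dots> = X" using l by (simp add: mult.assoc[symmetric] powr_add[symmetric])
    finally have "l powr (p - 1) * I \<le> X" .
    then have "M powr (p - 1) * (l powr (p - 1) * I) \<le> M powr (p - 1) * X" by (rule mult_left_mono) simp
    moreover have "M powr (p - 1) * (l powr (p - 1) * I) = I powr p"
    proof -
      have "M powr (p - 1) * l powr (p - 1) = I powr (p - 1)"
        using M I by (simp add: l_def powr_divide)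
      then have "M powr (p - 1) * (l powr (p - 1) * I) = I powr (p - 1) * I" by (simp add: mult.assoc[symmetric])
      also have "\<dots> = I powr p" using I by (simp add: powr_diff)
      finally show ?thesis .
    qed
    ultimately have "I powr p \<le> M powr (p - 1) * X" by simp
    moreover have "ennreal X = (\<integral>\<^sup>+v. ennreal (h v * g v powr p) \<partial>lborel)"
      unfolding X_def by (rule nn_integral_eq_integral[symmetric]) (use int h in auto)
    ultimately show ?thesis unfolding I_def by (metis ennreal_leI ennreal_mult' powr_ge_zero)
  qed
qed

text \<open>For \<open>p \<le> 1\<close> the product of the kernel with the band-limited function is itself band limited, so its
  supremum is controlled by its integral (inequality of Plancherel-Polya-Nikolskij type).\<close>
lemma filtered_mult_powr_le:
  fixes T :: "('a::euclidean_space \<Rightarrow> complex) \<Rightarrow> complex"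
  assumes T: "T \<in> tempered" and \<eta>: "\<eta> \<in> test_fun" and H: "H \<in> test_fun" and \<Theta>: "\<Theta> \<in> test_fun"
    and one: "\<And>\<xi> \<zeta>. \<eta> \<xi> \<noteq> 0 \<Longrightarrow> H \<zeta> \<noteq> 0 \<Longrightarrow> \<Theta> (\<xi> - \<zeta>) = 1"
    and S: "\<And>y. norm (mult_kernel \<Theta> y) \<le> S" "S > 0"
    and M: "(LINT v|lborel. norm (mult_kernel H v)) \<le> M" "M > 0" and p: "p > 0"
  shows "ennreal (norm (filtered (\<lambda>\<xi>. \<eta> \<xi> * H \<xi>) T x) powr p) \<le>
    ennreal (if p < 1 then S powr (1 - p) else M powr (p - 1)) *
    (\<integral>\<^sup>+v. ennreal (norm (mult_kernel H (v - x)) powr (min 1 p)) * ennreal (norm (filtered \<eta> T v) powr p) \<partial>lborel)"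
proof -
  let ?h = "\<lambda>v. mult_kernel H (v - x)" and ?g = "filtered \<eta> T"
  let ?F = "\<lambda>v. ?h v * ?g v"
  have HS: "mult_kernel H \<in> schwartz" "?h \<in> schwartz" by (auto intro!: schwartz_translate mult_kernel_schwartz H)
  have g: "slowly_growing ?g" by (rule filtered_slowly_growing[OF T \<eta>])
  have [measurable]: "?g \<in> borel_measurable borel" "mult_kernel H \<in> borel_measurable borel" "?h \<in> borel_measurable borel"
    using slowly_growing_measurable[OF g] schwartz_measurable HS by auto
  \<comment> \<open>Rapid decay of the kernel against polynomial growth of the filtered
    distribution. Finiteness of this integral is what permits dividing it out when
    \<open>p < 1\<close>.\<close>
  have Fint: "integrable lborel ?F"
  proof -
    have refl: "(\<lambda>\<xi>. H (- \<xi>)) \<in> test_fun" using test_fun_affine[OF H, of "-1" 0] by simp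
    have "mult_kernel (\<lambda>\<xi>. H (- \<xi>)) (x - v) = ?h v" for v
      using mult_kernel_reflect[OF H, of "x - v"] by simp
    then show ?thesis
      using conv_integrable[OF g mult_kernel_schwartz[OF refl], of x] by (simp add: mult.commute)
  qed
  have eq: "filtered (\<lambda>\<xi>. \<eta> \<xi> * H \<xi>) T x = (LINT v|lborel. ?F v)" by (rule filtered_mult[OF T \<eta> H])
  have le: "norm (filtered (\<lambda>\<xi>. \<eta> \<xi> * H \<xi>) T x) \<le> (LINT v|lborel. norm (?F v))"
    unfolding eq by (rule integral_norm_bound)
  have le': "ennreal (norm (filtered (\<lambda>\<xi>. \<eta> \<xi> * H \<xi>) T x) powr p) \<le> ennreal ((LINT v|lborel. norm (?F v)) powr p)"
    using le p by (intro ennreal_leI powr_mono2) auto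
  show ?thesis
  proof (cases "p < 1")
    case True
    have sup: "norm (?F z) \<le> S * (LINT v|lborel. norm (?F v))" for z
    proof -
      have "norm (?F z) = norm (LINT v|lborel. (mult_kernel \<Theta> (v - z) * ?h v) * ?g v)"
        using filtered_reproduce_product[OF T \<eta> H \<Theta> one, of z x] by simp
      also have "\<dots> \<le> (LINT v|lborel. S * norm (?F v))"
      proof (rule Bochner_Integration.integral_norm_bound_integral)
        show SF: "integrable lborel (\<lambda>v. S * norm (?F v))" using Fint by auto
        show le: "norm ((mult_kernel \<Theta> (v - z) * ?h v) * ?g v) \<le> S * norm (?F v)" for v
          unfolding mult.assoc norm_mult[of "mult_kernel \<Theta> _"] by (intro mult_right_mono S) auto
        have [measurable]: "mult_kernel \<Theta> \<in> borel_measurable borel"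
          by (intro schwartz_measurable mult_kernel_schwartz \<Theta>)
        show "integrable lborel (\<lambda>v. (mult_kernel \<Theta> (v - z) * ?h v) * ?g v)"
          by (rule Bochner_Integration.integrable_bound[OF SF], measurable)
            (rule AE_I2, rule order_trans[OF le], simp)
      qed
      finally show ?thesis by simp
    qed
    have "ennreal ((LINT v|lborel. norm (?F v)) powr p) \<le>
        ennreal (S powr (1 - p)) * (\<integral>\<^sup>+v. ennreal (norm (?F v) powr p) \<partial>lborel)"
      by (rule nn_integral_powr_le_small_exponent[OF Fint S(2) sup]) (use p True in auto)
    then show ?thesis
      using order_trans[OF le'] True p by (simp add: norm_mult powr_mult ennreal_mult)
  next
    case False
    have "ennreal ((LINT v|lborel. norm (?h v) * norm (?g v)) powr p) \<le>
       ennreal (M powr (p - 1)) * (\<integral>\<^sup>+v. ennreal (norm (?h v) * norm (?g v) powr p) \<partial>lborel)"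
    proof (rule nn_integral_powr_le_large_exponent)
      show "integrable lborel (\<lambda>v. norm (?h v))" by (intro integrable_norm schwartz_integrable HS)
      show "integrable lborel (\<lambda>v. norm (?h v) * norm (?g v))" using integrable_norm[OF Fint] by (simp add: norm_mult)
      have "(LINT v|lborel. norm (?h v)) = (LINT v|lborel. norm (mult_kernel H v))"
        using lborel_integral_translate(1)[of "\<lambda>v. norm (mult_kernel H v)" "- x"] by simp
      then show "(LINT v|lborel. norm (?h v)) \<le> M" using M by simp
    qed (use M False in auto)
    then show ?thesis
      using order_trans[OF le'] False p by (simp add: norm_mult ennreal_mult)
  qed
qed

text \<open>Morrey bounds are translation invariant, hence preserved under convolution with an integrable kernel.\<close>
lemma nn_integral_ball_conv_le:
  fixes h G :: "'a::euclidean_space \<Rightarrow> ennreal"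
  assumes [measurable]: "h \<in> borel_measurable borel" "G \<in> borel_measurable borel"
    and G: "\<And>y. (\<integral>\<^sup>+v\<in>ball y R. G v \<partial>lborel) \<le> A"
  shows "(\<integral>\<^sup>+x\<in>ball y R. (\<integral>\<^sup>+v. h (v - x) * G v \<partial>lborel) \<partial>lborel) \<le> (\<integral>\<^sup>+w. h w \<partial>lborel) * A"
proof -
  have ball[measurable]: "ball y R \<in> sets borel" for y :: 'a by simp
  have shift: "(\<integral>\<^sup>+v. f v \<partial>lborel) = (\<integral>\<^sup>+w. f (x + w) \<partial>lborel)" if [measurable]: "f \<in> borel_measurable borel"
    for f :: "'a \<Rightarrow> ennreal" and x
    using nn_integral_lborel_scale[OF that, of 1 x] by simp
  have "(\<integral>\<^sup>+x\<in>ball y R. (\<integral>\<^sup>+v. h (v - x) * G v \<partial>lborel) \<partial>lborel) =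
     (\<integral>\<^sup>+x. (\<integral>\<^sup>+w. h w * G (x + w) \<partial>lborel) * indicator (ball y R) x \<partial>lborel)"
  proof -
    have "(\<integral>\<^sup>+v. h (v - x) * G v \<partial>lborel) = (\<integral>\<^sup>+w. h w * G (x + w) \<partial>lborel)" for x
      using shift[of "\<lambda>v. h (v - x) * G v" x] by simp
    then show ?thesis by simp
  qed
  also have "\<dots> = (\<integral>\<^sup>+x. (\<integral>\<^sup>+w. h w * (G (x + w) * indicator (ball y R) x) \<partial>lborel) \<partial>lborel)"
    by (subst nn_integral_multc[symmetric]) (auto simp: mult.assoc)
  also have "\<dots> = (\<integral>\<^sup>+w. (\<integral>\<^sup>+x. h w * (G (x + w) * indicator (ball y R) x) \<partial>lborel) \<partial>lborel)"
    by (rule lborel_pair.Fubini') measurable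
  also have "\<dots> = (\<integral>\<^sup>+w. h w * (\<integral>\<^sup>+x. G (x + w) * indicator (ball y R) x \<partial>lborel) \<partial>lborel)"
    by (intro nn_integral_cong nn_integral_cmult) measurable
  also have "\<dots> \<le> (\<integral>\<^sup>+w. h w * A \<partial>lborel)"
  proof (intro nn_integral_mono mult_left_mono)
    fix w
    have "(\<integral>\<^sup>+x. G (x + w) * indicator (ball y R) x \<partial>lborel) = (\<integral>\<^sup>+x. G x * indicator (ball (y + w) R) x \<partial>lborel)"
      by (subst shift[of "\<lambda>x. G x * indicator (ball (y + w) R) x" w])
        (auto simp: add.commute indicator_def dist_norm intro!: nn_integral_cong)
    also have "\<dots> \<le> A" by (rule G)
    finally show "(\<integral>\<^sup>+x. G (x + w) * indicator (ball y R) x \<partial>lborel) \<le> A" .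
  qed simp
  also have "\<dots> = (\<integral>\<^sup>+w. h w \<partial>lborel) * A" by (rule nn_integral_multc) measurable
  finally show ?thesis .
qed

section \<open>Morrey quasi-norms\<close>

lemma ennreal_powr_ennreal [simp]: "x \<ge> 0 \<Longrightarrow> ennreal_powr (ennreal x) r = ennreal (x powr r)"
  by (simp add: ennreal_powr_def)

lemma ennreal_powr_top [simp]: "ennreal_powr top r = top"
  by (simp add: ennreal_powr_def)

lemma ennreal_powr_0 [simp]: "ennreal_powr 0 r = 0"
  using ennreal_powr_ennreal[of 0 r] by simp

lemma ennreal_powr_mono: "r > 0 \<Longrightarrow> x \<le> y \<Longrightarrow> ennreal_powr x r \<le> ennreal_powr y r"
  by (cases x; cases y) (auto intro!: ennreal_leI powr_mono2 simp: top_unique)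

lemma ennreal_powr_powr: "r > 0 \<Longrightarrow> s > 0 \<Longrightarrow> ennreal_powr (ennreal_powr x r) s = ennreal_powr x (r * s)"
  by (cases x) (auto simp: powr_powr)

lemma ennreal_powr_1 [simp]: "ennreal_powr x 1 = x"
  by (cases x) auto

lemma ennreal_powr_cmult:
  "c \<ge> 0 \<Longrightarrow> r > 0 \<Longrightarrow> ennreal_powr (ennreal c * x) r = ennreal (c powr r) * ennreal_powr x r"
  by (cases x; cases "c = 0") (auto simp: powr_mult ennreal_mult_top simp flip: ennreal_mult)

lemma ennreal_powr_add_le:
  assumes "r > 0"
  shows "ennreal_powr (x + y) r \<le> ennreal (2 powr r) * (ennreal_powr x r + ennreal_powr y r)"
proof -
  have "x + y \<le> ennreal 2 * max x y"
    by (metis add_mono ennreal_numeral max.cobounded1 max.cobounded2 mult_2 zero_le_numeral)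
  then have "ennreal_powr (x + y) r \<le> ennreal (2 powr r) * ennreal_powr (max x y) r"
    using ennreal_powr_mono[OF assms] assms by (metis ennreal_powr_cmult zero_le_numeral)
  also have "ennreal_powr (max x y) r \<le> ennreal_powr x r + ennreal_powr y r"
    by (simp add: max_def)
  finally show ?thesis by (simp add: mult_left_mono)
qed

lemma ennreal_powr_measurable [measurable]:
  assumes [measurable]: "f \<in> borel_measurable M"
  shows "(\<lambda>x. ennreal_powr (f x) r) \<in> borel_measurable M"
  unfolding ennreal_powr_def by measurable

lemma measure_ball_pos: "R > 0 \<Longrightarrow> measure lebesgue (ball (y::'a::euclidean_space) R) > 0"
  by (simp add: content_ball_pos)

text \<open>Removes the root and the negative power of the volume: for a finite bound the quasi-norm
  estimate is a family of plain integral estimates on balls, to which linearity and Fubini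
  apply.\<close>

lemma morrey_norm_le_iff:
  fixes g :: "'a::euclidean_space \<Rightarrow> ennreal"
  assumes p: "0 < p" and u: "0 < u" and A: "A \<ge> 0"
  shows "morrey_norm u p g \<le> ennreal A \<longleftrightarrow>
    (\<forall>y R. R > 0 \<longrightarrow> (\<integral>\<^sup>+x\<in>ball y R. ennreal_powr (g x) p \<partial>lebesgue) \<le>
      ennreal (A powr p * measure lebesgue (ball y R) powr (1 - p / u)))"
proof -
  have cancel: "x powr p \<le> y powr p \<longleftrightarrow> x \<le> y" if "x \<ge> 0" "y \<ge> 0" for x y
    using p that powr_mono2[of p x y] powr_less_mono2[of p y x] by (meson less_imp_le not_le)
  have "ennreal (m powr (1 / u - 1 / p)) * ennreal_powr I (1 / p) \<le> ennreal A \<longleftrightarrow> I \<le> ennreal (A powr p * m powr (1 - p / u))"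
    if m: "m > 0" for m I
  proof (cases I)
    case top
    then show ?thesis using m by (auto simp: ennreal_mult_top top_unique)
  next
    case (real i)
    have exp: "(m powr (1 / u - 1 / p)) powr p = m powr (p / u - 1)"
      using p by (simp add: powr_powr diff_divide_distrib left_diff_distrib)
    have "ennreal (m powr (1 / u - 1 / p)) * ennreal_powr I (1 / p) \<le> ennreal A \<longleftrightarrow>
        m powr (1 / u - 1 / p) * i powr (1 / p) \<le> A"
      using real A by (simp add: ennreal_mult[symmetric])
    also have "\<dots> \<longleftrightarrow> (m powr (1 / u - 1 / p) * i powr (1 / p)) powr p \<le> A powr p"
      using cancel[of "m powr (1 / u - 1 / p) * i powr (1 / p)" A] A by simp
    also have "(m powr (1 / u - 1 / p) * i powr (1 / p)) powr p = m powr (p / u - 1) * i"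
      using p real exp by (simp add: powr_mult powr_powr[of i])
    also have "m powr (p / u - 1) * i \<le> A powr p \<longleftrightarrow> i \<le> A powr p * m powr (1 - p / u)"
    proof -
      have eq: "m powr (p / u - 1) = inverse (m powr (1 - p / u))" by (simp add: powr_minus[symmetric])
      have gen: "inverse c * i \<le> a \<longleftrightarrow> i \<le> a * c" if "c > 0" for a c :: real
        using that by (simp add: field_simps)
      show ?thesis unfolding eq by (rule gen) (use m in simp)
    qed
    finally show ?thesis using real by simp
  qed
  then show ?thesis unfolding morrey_norm_def SUP_le_iff using measure_ball_pos by auto
qed

text \<open>Valid for every \<open>p > 0\<close> through \<open>x + y <= 2 * max x y\<close>. The
  constant is the \<open>p\<close>-th root of \<open>2 powr p * 2\<close>, the first factor from
  this pointwise step and the second from estimating \<open>A powr p\<close> and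
  \<open>B powr p\<close> each by \<open>(A + B) powr p\<close>.\<close>

lemma morrey_norm_quasi_triangle:
  fixes g h1 h2 :: "'a::euclidean_space \<Rightarrow> ennreal"
  assumes p: "0 < p" and u: "0 < u" and C: "C > 0"
    and [measurable]: "h1 \<in> borel_measurable lebesgue" "h2 \<in> borel_measurable lebesgue"
    and le: "AE x in lebesgue. g x \<le> ennreal C * (h1 x + h2 x)"
  shows "morrey_norm u p g \<le> ennreal (C * 2 powr (1 + 1 / p)) * (morrey_norm u p h1 + morrey_norm u p h2)"
proof (cases "morrey_norm u p h1 = top \<or> morrey_norm u p h2 = top")
  case True
  have "C * 2 powr (1 + 1 / p) > 0" using C by simp
  then show ?thesis using True by (auto simp: ennreal_mult_top)
next
  case False
  obtain A B where A: "A \<ge> 0" "morrey_norm u p h1 = ennreal A" and B: "B \<ge> 0" "morrey_norm u p h2 = ennreal B"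
    using False by (cases "morrey_norm u p h1"; cases "morrey_norm u p h2") auto
  let ?D = "C * 2 powr (1 + 1 / p) * (A + B)"
  have D: "?D powr p = C powr p * 2 powr p * 2 * (A + B) powr p"
    using C A B p by (simp add: powr_mult powr_powr distrib_right powr_add)
  have "morrey_norm u p g \<le> ennreal ?D"
    unfolding morrey_norm_le_iff[OF p u, of ?D g, OF mult_nonneg_nonneg[OF less_imp_le[OF mult_pos_pos[OF C powr_gt_zero[THEN iffD2, of 2]]] add_nonneg_nonneg[OF A(1) B(1)], simplified]]
  proof (intro allI impI)
    fix y :: 'a and R :: real assume R: "R > 0"
    let ?m = "measure lebesgue (ball y R) powr (1 - p / u)"
    have [measurable]: "ball y R \<in> sets lebesgue" by simp
    have "(\<integral>\<^sup>+x\<in>ball y R. ennreal_powr (g x) p \<partial>lebesgue) \<le>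
        (\<integral>\<^sup>+x. ennreal (C powr p * 2 powr p) * (ennreal_powr (h1 x) p * indicator (ball y R) x + ennreal_powr (h2 x) p * indicator (ball y R) x) \<partial>lebesgue)"
    proof (rule nn_integral_mono_AE, use le in eventually_elim)
      case (elim x)
      have "ennreal_powr (g x) p \<le> ennreal (C powr p) * ennreal_powr (h1 x + h2 x) p"
        using ennreal_powr_mono[OF p elim] C p by (simp add: ennreal_powr_cmult)
      also have "\<dots> \<le> ennreal (C powr p) * (ennreal (2 powr p) * (ennreal_powr (h1 x) p + ennreal_powr (h2 x) p))"
        by (intro mult_left_mono ennreal_powr_add_le p) simp
      finally show ?case by (auto simp: indicator_def ennreal_mult mult.assoc)
    qed
    also have "\<dots> = ennreal (C powr p * 2 powr p) * ((\<integral>\<^sup>+x\<in>ball y R. ennreal_powr (h1 x) p \<partial>lebesgue) + (\<integral>\<^sup>+x\<in>ball y R. ennreal_powr (h2 x) p \<partial>lebesgue))"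
      by (subst nn_integral_cmult, measurable) (subst nn_integral_add, measurable)
    also have "\<dots> \<le> ennreal (C powr p * 2 powr p) * (ennreal (A powr p * ?m) + ennreal (B powr p * ?m))"
      using morrey_norm_le_iff[OF p u A(1), of h1] morrey_norm_le_iff[OF p u B(1), of h2] A B R
      by (intro mult_left_mono add_mono) auto
    also have "\<dots> = ennreal (C powr p * 2 powr p * (A powr p * ?m + B powr p * ?m))"
      by (subst ennreal_plus[symmetric]) (auto simp: ennreal_mult[symmetric] simp del: ennreal_plus)
    also have "\<dots> \<le> ennreal (?D powr p * ?m)"
    proof (rule ennreal_leI)
      have "A powr p * ?m + B powr p * ?m \<le> (A + B) powr p * ?m + (A + B) powr p * ?m"
        using A B p by (intro add_mono mult_right_mono powr_mono2) auto
      then have "C powr p * 2 powr p * (A powr p * ?m + B powr p * ?m) \<le> C powr p * 2 powr p * ((A + B) powr p * ?m + (A + B) powr p * ?m)"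
        by (rule mult_left_mono) simp
      then show "C powr p * 2 powr p * (A powr p * ?m + B powr p * ?m) \<le> ?D powr p * ?m"
        unfolding D by (simp add: algebra_simps)
    qed
    finally show "(\<integral>\<^sup>+x\<in>ball y R. ennreal_powr (g x) p \<partial>lebesgue) \<le> ennreal (?D powr p * ?m)" .
  qed
  also have "ennreal ?D = ennreal (C * 2 powr (1 + 1 / p)) * (ennreal A + ennreal B)"
    using A B C by (subst ennreal_mult) auto
  finally show ?thesis using A B by simp
qed

lemma morrey_norm_0 [simp]:
  fixes u p :: real
  assumes "0 < p" "0 < u"
  shows "morrey_norm u p (\<lambda>x::'a::euclidean_space. 0) = 0"
  using morrey_norm_le_iff[OF assms order_refl, of "\<lambda>x::'a. 0"] assms by simp

lemma morrey_norm_mono_AE: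
  fixes g h :: "'a::euclidean_space \<Rightarrow> ennreal"
  assumes "0 < p" "0 < u" "C > 0" "h \<in> borel_measurable lebesgue" "AE x in lebesgue. g x \<le> ennreal C * h x"
  shows "morrey_norm u p g \<le> ennreal (C * 2 powr (1 + 1 / p)) * morrey_norm u p h"
  using morrey_norm_quasi_triangle[OF assms(1-4), of "\<lambda>x. 0" g] assms by simp

section \<open>Weighted sequence norms\<close>

text \<open>An enumeration of the integers reduces these unordered sums to ordinary series of
  extended nonnegative reals, where monotonicity, additivity and interchange with integrals are
  available. Indices outside \<open>I\<close> are padded with 0.\<close>

lemma infsum_int_eq_suminf:
  fixes f :: "int \<Rightarrow> ennreal"
  shows "infsum f I = (\<Sum>n. if int_decode n \<in> I then f (int_decode n) else 0)"
proof -
  let ?g = "\<lambda>k. if k \<in> I then f k else 0"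
  have "infsum f I = infsum ?g UNIV" by (rule infsum_cong_neutral) auto
  also have "\<dots> = infsum (\<lambda>n. ?g (int_decode n)) UNIV"
    by (rule infsum_reindex_bij_betw[symmetric]) (rule bij_int_decode)
  also have "\<dots> = (\<Sum>n. ?g (int_decode n))"
  proof -
    have "((\<lambda>n. ?g (int_decode n)) has_sum infsum (\<lambda>n. ?g (int_decode n)) UNIV) UNIV"
      by (intro has_sum_infsum nonneg_summable_on_complete) auto
    then show ?thesis using has_sum_imp_sums sums_unique by blast
  qed
  finally show ?thesis .
qed

lemma infsum_int_ge:
  fixes f :: "int \<Rightarrow> ennreal"
  assumes "k \<in> I"
  shows "f k \<le> infsum f I"
proof -
  have "f k = (\<Sum>n\<in>{int_encode k}. if int_decode n \<in> I then f (int_decode n) else 0)" using assms by simp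
  also have "\<dots> \<le> infsum f I" unfolding infsum_int_eq_suminf by (rule sum_le_suminf) auto
  finally show ?thesis .
qed

lemma infsum_int_mono:
  fixes f g :: "int \<Rightarrow> ennreal"
  assumes "\<And>k. k \<in> I \<Longrightarrow> f k \<le> g k" "I \<subseteq> J"
  shows "infsum f I \<le> infsum g J"
  unfolding infsum_int_eq_suminf by (intro suminf_le) (use assms in auto)

lemma infsum_int_cmult:
  fixes f :: "int \<Rightarrow> ennreal"
  shows "infsum (\<lambda>k. c * f k) I = c * infsum f I"
  unfolding infsum_int_eq_suminf ennreal_suminf_cmult[symmetric] by (intro suminf_cong) simp

lemma infsum_int_add:
  fixes f g :: "int \<Rightarrow> ennreal"
  shows "infsum f (I \<union> J) \<le> infsum f I + infsum f J"
  unfolding infsum_int_eq_suminf suminf_add[OF summableI summableI] by (intro suminf_le) auto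

lemma nn_integral_infsum_int:
  fixes f :: "int \<Rightarrow> 'a \<Rightarrow> ennreal"
  assumes [measurable]: "\<And>k. f k \<in> borel_measurable M"
  shows "(\<integral>\<^sup>+x. infsum (\<lambda>k. f k x) I \<partial>M) = infsum (\<lambda>k. \<integral>\<^sup>+x. f k x \<partial>M) I"
  unfolding infsum_int_eq_suminf by (subst nn_integral_suminf) (auto intro!: suminf_cong)

lemma borel_measurable_infsum_int [measurable]:
  fixes f :: "int \<Rightarrow> 'a \<Rightarrow> ennreal"
  assumes [measurable]: "\<And>k. f k \<in> borel_measurable M"
  shows "(\<lambda>x. infsum (\<lambda>k. f k x) I) \<in> borel_measurable M"
  unfolding infsum_int_eq_suminf by measurable

lemma infsum_powr_geometric_nonpos:
  assumes "e > 0"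
  shows "infsum (\<lambda>k::int. ennreal (2 powr (of_int k * e))) {..0} < \<top>"
proof -
  have "infsum (\<lambda>k::int. ennreal (2 powr (of_int k * e))) {..0} = infsum (\<lambda>n::nat. ennreal (2 powr (of_int (- int n) * e))) UNIV"
    by (rule infsum_reindex_bij_betw[symmetric], rule bij_betwI[where g="\<lambda>k. nat (- k)"]) auto
  also have "\<dots> = (\<Sum>n. ennreal (2 powr (of_int (- int n) * e)))"
  proof -
    have "((\<lambda>n::nat. ennreal (2 powr (of_int (- int n) * e))) has_sum infsum (\<lambda>n::nat. ennreal (2 powr (of_int (- int n) * e))) UNIV) UNIV"
      by (intro has_sum_infsum nonneg_summable_on_complete) auto
    then show ?thesis using has_sum_imp_sums sums_unique by blast
  qed
  also have "\<dots> = (\<Sum>n. ennreal ((2 powr (- e)) ^ n))"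
    by (simp add: powr_realpow[symmetric] powr_powr mult.commute)
  also have "\<dots> = ennreal (1 / (1 - 2 powr (- e)))"
    by (rule suminf_ennreal_eq) (use assms in \<open>auto intro!: geometric_sums simp: powr_less_one\<close>)
  finally show ?thesis by simp
qed

lemma weighted_lq_ge:
  assumes "k \<in> I" "0 < q"
  shows "ennreal (2 powr (of_int k * s) * cmod (c k)) \<le> weighted_lq s q I c"
proof (cases "q = \<infinity>")
  case True
  then show ?thesis using assms by (auto simp: weighted_lq_def intro!: SUP_upper2[of k])
next
  case False
  define r where "r = real_of_ereal q"
  have r: "r > 0" using assms False by (cases q) (auto simp: r_def)
  have "ennreal (2 powr (of_int k * s) * cmod (c k)) = ennreal_powr (ennreal (2 powr (of_int k * s * r) * cmod (c k) powr r)) (1 / r)"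
    using r by (simp add: powr_mult powr_powr)
  also have "\<dots> \<le> weighted_lq s q I c"
    unfolding weighted_lq_def r_def[symmetric] if_not_P[OF False]
    using r by (intro ennreal_powr_mono infsum_int_ge[OF assms(1)]) auto
  finally show ?thesis .
qed

lemma weighted_lq_mono:
  assumes "I \<subseteq> J" "0 < q" "\<And>k. k \<in> I \<Longrightarrow> c k = d k"
  shows "weighted_lq s q I c \<le> weighted_lq s q J d"
proof (cases "q = \<infinity>")
  case True
  then show ?thesis using assms by (auto simp: weighted_lq_def intro!: SUP_subset_mono)
next
  case False
  have "real_of_ereal q > 0" using assms False by (cases q) auto
  then show ?thesis using assms False
    by (auto simp: weighted_lq_def intro!: ennreal_powr_mono infsum_int_mono)
qed

lemma weighted_lq_union:
  assumes "0 < q"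
  obtains C where "C > 0" "\<And>I J s c. weighted_lq s q (I \<union> J) c \<le> ennreal C * (weighted_lq s q I c + weighted_lq s q J c)"
proof (cases "q = \<infinity>")
  case True
  have "weighted_lq s q (I \<union> J) c \<le> ennreal 1 * (weighted_lq s q I c + weighted_lq s q J c)" for I J s c
  proof -
    have "weighted_lq s q (I \<union> J) c \<le> sup (weighted_lq s q I c) (weighted_lq s q J c)"
      using True by (simp add: weighted_lq_def SUP_union)
    also have "\<dots> \<le> weighted_lq s q I c + weighted_lq s q J c" by (simp add: add_increasing add_increasing2)
    finally show ?thesis by simp
  qed
  then show ?thesis using that[of 1] by simp
next
  case False
  define r where "r = real_of_ereal q"
  have r: "r > 0" using assms False by (cases q) (auto simp: r_def)
  have "weighted_lq s q (I \<union> J) c \<le> ennreal (2 powr (1 / r)) * (weighted_lq s q I c + weighted_lq s q J c)" for I J s c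
    using False r unfolding weighted_lq_def r_def[symmetric]
    by (auto intro!: order_trans[OF ennreal_powr_mono[OF _ infsum_int_add] ennreal_powr_add_le])
  then show ?thesis using that[of "2 powr (1 / r)"] by simp
qed

lemma weighted_lq_singleton_0: "0 < q \<Longrightarrow> weighted_lq s q {0} c = ennreal (cmod (c 0))"
  by (cases q) (auto simp: weighted_lq_def powr_powr)

lemma weighted_lq_measurable [measurable]:
  assumes [measurable]: "\<And>k. c k \<in> borel_measurable M"
  shows "(\<lambda>x. weighted_lq s q I (\<lambda>k. c k x)) \<in> borel_measurable M"
proof (cases "q = \<infinity>")
  case True
  have "countable I" by (rule countableI_type)
  then show ?thesis using True by (simp add: weighted_lq_def)
next
  case False
  then show ?thesis by (simp add: weighted_lq_def) measurable
qed

text \<open>Lowering the smoothness from \<open>s\<close> to \<open>s'\<close> pays for replacing \<open>q\<close> by \<open>p\<close> on non-positive indices.\<close>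
lemma weighted_lq_nonpos_le:
  assumes "0 < q" "s' < s" "0 < p"
  obtains C where "C > 0" "\<And>I c. I \<subseteq> {..0} \<Longrightarrow> weighted_lq s q I c \<le>
     ennreal C * ennreal_powr (infsum (\<lambda>k. ennreal (2 powr (of_int k * s' * p) * cmod (c k) powr p)) I) (1 / p)"
proof -
  let ?Z = "\<lambda>I c. ennreal_powr (infsum (\<lambda>k. ennreal (2 powr (of_int k * s' * p) * cmod (c k) powr p)) I) (1 / p)"
  have Z: "ennreal (2 powr (of_int k * s') * cmod (c k)) \<le> ?Z I c" if "k \<in> I" for k I c
  proof -
    have "ennreal (2 powr (of_int k * s') * cmod (c k)) = ennreal_powr (ennreal (2 powr (of_int k * s' * p) * cmod (c k) powr p)) (1 / p)"
      using assms by (simp add: powr_mult powr_powr)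
    also have "\<dots> \<le> ?Z I c" using assms by (intro ennreal_powr_mono infsum_int_ge[OF that]) auto
    finally show ?thesis .
  qed
  show ?thesis
  proof (cases "q = \<infinity>")
    case True
    have "weighted_lq s q I c \<le> ennreal 1 * ?Z I c" if I: "I \<subseteq> {..0}" for I c
    proof -
      have "ennreal (2 powr (of_int k * s) * cmod (c k)) \<le> ?Z I c" if k: "k \<in> I" for k
      proof -
        have "of_int k * s \<le> of_int k * s'" using I k assms by (intro mult_left_mono_neg) auto
        then have "2 powr (of_int k * s) * cmod (c k) \<le> 2 powr (of_int k * s') * cmod (c k)"
          by (intro mult_right_mono powr_mono) auto
        then show ?thesis using Z[OF k, of c] by (meson ennreal_leI order_trans)
      qed
      then show ?thesis using True by (auto simp: weighted_lq_def intro!: SUP_least)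
    qed
    then show ?thesis using that[of 1] by simp
  next
    case False
    define r where "r = real_of_ereal q"
    have r: "r > 0" using assms False by (cases q) (auto simp: r_def)
    \<comment> \<open>Each term is at most the \<ell>_p quantity \<open>?Z\<close> times a power of
      two with exponent \<open>k * (s - s')\<close>. The leftover powers form this geometric sum,
      convergent because \<open>k\<close> is nonpositive and \<open>s' < s\<close>.\<close>
    define D where "D = enn2real (infsum (\<lambda>k::int. ennreal (2 powr (of_int k * ((s - s') * r)))) {..0})"
    have D: "infsum (\<lambda>k::int. ennreal (2 powr (of_int k * ((s - s') * r)))) {..0} = ennreal D"
      unfolding D_def using infsum_powr_geometric_nonpos[of "(s - s') * r"] assms r by (simp add: less_top)
    have D0: "D \<ge> 0" by (simp add: D_def)
    have "weighted_lq s q I c \<le> ennreal ((D + 1) powr (1 / r)) * ?Z I c" if I: "I \<subseteq> {..0}" for I c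
    proof -
      have "infsum (\<lambda>k. ennreal (2 powr (of_int k * s * r) * cmod (c k) powr r)) I \<le>
          infsum (\<lambda>k. ennreal_powr (?Z I c) r * ennreal (2 powr (of_int k * ((s - s') * r)))) {..0}"
      proof (rule infsum_int_mono[OF _ I])
        fix k assume k: "k \<in> I"
        have "ennreal (2 powr (of_int k * s * r) * cmod (c k) powr r) =
           ennreal_powr (ennreal (2 powr (of_int k * s') * cmod (c k))) r * ennreal (2 powr (of_int k * ((s - s') * r)))"
        proof -
          have "2 powr (of_int k * s * r) = (2 powr (of_int k * s' * r)) * 2 powr (of_int k * ((s - s') * r))"
            unfolding powr_add[symmetric] by (simp add: algebra_simps)
          then show ?thesis by (simp add: powr_mult powr_powr ennreal_mult[symmetric] mult_ac)
        qed
        also have "\<dots> \<le> ennreal_powr (?Z I c) r * ennreal (2 powr (of_int k * ((s - s') * r)))"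
          by (intro mult_right_mono ennreal_powr_mono r Z k) simp
        finally show "ennreal (2 powr (of_int k * s * r) * cmod (c k) powr r) \<le>
          ennreal_powr (?Z I c) r * ennreal (2 powr (of_int k * ((s - s') * r)))" .
      qed
      also have "\<dots> = ennreal_powr (?Z I c) r * ennreal D"
        unfolding infsum_int_cmult D ..
      also have "\<dots> \<le> ennreal (D + 1) * ennreal_powr (?Z I c) r"
        using D0 by (subst mult.commute) (intro mult_right_mono ennreal_leI, auto)
      finally have "weighted_lq s q I c \<le> ennreal_powr (ennreal (D + 1) * ennreal_powr (?Z I c) r) (1 / r)"
        unfolding weighted_lq_def r_def[symmetric] using False r by (auto intro!: ennreal_powr_mono)
      also have "\<dots> = ennreal ((D + 1) powr (1 / r)) * ?Z I c"
        using r D0 by (subst ennreal_powr_cmult) (auto simp: ennreal_powr_powr)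
      finally show ?thesis .
    qed
    then show ?thesis using that[of "(D + 1) powr (1 / r)"] D0 by simp
  qed
qed

text \<open>Every single term is at most the weighted norm divided by \<open>2 powr (k * s)\<close>,
  and the resulting geometric series converges for \<open>s > 0\<close>.\<close>

lemma weighted_lq_sum_le:
  fixes m :: nat
  assumes "0 < q" "s > 0"
  shows "(\<Sum>n. ennreal (cmod (c (int (n + m))))) \<le> ennreal (1 / (1 - 2 powr (- s))) * weighted_lq s q {int m..} c"
proof -
  let ?W = "weighted_lq s q {int m..} c"
  have q: "2 powr (- s) < 1" using assms by (simp add: powr_less_one)
  have "ennreal (cmod (c (int (n + m)))) \<le> ennreal ((2 powr (- s)) ^ n) * ?W" for n
  proof -
    have "ennreal (2 powr (of_int (int (n + m)) * s) * cmod (c (int (n + m)))) \<le> ?W"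
      by (rule weighted_lq_ge) (use assms in auto)
    then have le1: "ennreal (2 powr (- (of_int (int (n + m)) * s))) * ennreal (2 powr (of_int (int (n + m)) * s) * cmod (c (int (n + m)))) \<le>
       ennreal (2 powr (- (of_int (int (n + m)) * s))) * ?W" by (rule mult_left_mono) simp
    have eq1: "ennreal (2 powr (- (of_int (int (n + m)) * s))) * ennreal (2 powr (of_int (int (n + m)) * s) * cmod (c (int (n + m)))) =
      ennreal (cmod (c (int (n + m))))"
      by (simp add: ennreal_mult[symmetric] mult.assoc[symmetric] powr_add[symmetric])
    \<comment> \<open>The gain from the shift \<open>m\<close> is given away, so that the same
      constant serves for sums starting at 0 and at 1.\<close>
    have le2: "2 powr (- (of_int (int (n + m)) * s)) \<le> (2 powr (- s)) ^ n"
    proof -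
      have "(2 powr (- s)) ^ n = 2 powr (- (of_int (int n) * s))"
        by (simp add: powr_realpow[symmetric] powr_powr mult.commute)
      moreover have "- (of_int (int (n + m)) * s) \<le> - (of_int (int n) * s)" using assms by (simp add: distrib_right)
      ultimately show ?thesis by (simp only: powr_mono)
    qed
    show ?thesis
      by (rule order_trans[OF le1[unfolded eq1]]) (rule mult_right_mono[OF ennreal_leI[OF le2] zero_le])
  qed
  then have "(\<Sum>n. ennreal (cmod (c (int (n + m))))) \<le> (\<Sum>n. ennreal ((2 powr (- s)) ^ n) * ?W)"
    by (intro suminf_le) auto
  also have "\<dots> = (\<Sum>n. ennreal ((2 powr (- s)) ^ n)) * ?W" by simp
  also have "(\<Sum>n. ennreal ((2 powr (- s)) ^ n)) = ennreal (1 / (1 - 2 powr (- s)))"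
    by (rule suminf_ennreal_eq) (use q in \<open>auto intro!: geometric_sums\<close>)
  finally show ?thesis .
qed

section \<open>Estimates for the dyadic pieces\<close>

text \<open>Decay of order at least \<open>N / r\<close> before taking the power leaves order
  \<open>N\<close> afterwards, so powers of kernels with exponent below 1 remain integrable.\<close>

lemma schwartz_powr_decay:
  assumes "k \<in> schwartz" "r > 0"
  obtains C where "C > 0" "\<And>v. norm (k v) powr r \<le> C * (1 / (1 + norm v) ^ N)"
proof -
  define M where "M = nat \<lceil>real N / r\<rceil>"
  have M: "real N \<le> real M * r"
  proof -
    have "real N / r \<le> real M" unfolding M_def by (rule real_nat_ceiling_ge)
    then show ?thesis using assms(2) by (simp add: field_simps)
  qed
  obtain C where C: "C > 0" "\<And>v. (1 + norm v) ^ M * norm (k v) \<le> C" using schwartz_rapid[OF assms(1)] by metis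
  have "norm (k v) powr r \<le> C powr r * (1 / (1 + norm v) ^ N)" for v
  proof -
    have pos: "1 + norm v > 0" by (simp add: add_pos_nonneg)
    have "(1 + norm v) ^ N * norm (k v) powr r = (1 + norm v) powr real N * norm (k v) powr r"
      using pos by (simp add: powr_realpow)
    also have "\<dots> \<le> (1 + norm v) powr (real M * r) * norm (k v) powr r"
      using M by (intro mult_right_mono powr_mono) auto
    also have "\<dots> = ((1 + norm v) ^ M * norm (k v)) powr r"
      using pos by (simp add: powr_mult powr_powr powr_realpow[symmetric])
    also have "\<dots> \<le> C powr r"
      using C assms(2) by (intro powr_mono2) auto
    finally show ?thesis using pos by (simp add: field_simps)
  qed
  then show ?thesis using that[of "C powr r"] C by simp
qed

lemma schwartz_powr_nn_integral_finite:
  fixes k :: "'a::euclidean_space \<Rightarrow> complex"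
  assumes "k \<in> schwartz" "r > 0"
  shows "(\<integral>\<^sup>+v. ennreal (norm (k v) powr r) \<partial>lborel) < \<top>"
proof -
  obtain C where C: "C > 0" "\<And>v. norm (k v) powr r \<le> C * (1 / (1 + norm v) ^ Suc (DIM('a)))"
    using schwartz_powr_decay[OF assms, of "Suc (DIM('a))"] by metis
  have "(\<integral>\<^sup>+v. ennreal (norm (k v) powr r) \<partial>lborel) \<le> (\<integral>\<^sup>+v. ennreal (C * (1 / (1 + norm (v::'a)) ^ Suc (DIM('a)))) \<partial>lborel)"
    by (intro nn_integral_mono ennreal_leI C)
  also have "\<dots> = ennreal (LINT v|lborel. C * (1 / (1 + norm (v::'a)) ^ Suc (DIM('a))))"
  proof (rule nn_integral_eq_integral)
    show "integrable lborel (\<lambda>v::'a. C * (1 / (1 + norm v) ^ Suc (DIM('a))))"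
      by (rule integrable_mult_right, rule integrable_poly_decay) simp
  qed (use C in auto)
  finally show ?thesis by (simp add: le_less_trans)
qed

context smooth_cutoff
begin

lemma mult_kernel_psi:
  "mult_kernel (\<lambda>\<xi>. complex_of_real (psi \<phi>\<^sub>0 k \<xi>)) v =
    of_real ((2 powi k) ^ DIM('a)) * mult_kernel (\<lambda>\<xi>. complex_of_real (psi \<phi>\<^sub>0 0 \<xi>)) (2 powi k *\<^sub>R v)"
proof -
  have "psi \<phi>\<^sub>0 k \<xi> = psi \<phi>\<^sub>0 0 (inverse (2 powi k) *\<^sub>R \<xi>)" for \<xi>
    by (simp add: psi_def Let_def power_int_minus)
  then show ?thesis using mult_kernel_scale[OF psi_test, of "2 powi k" 0 v] by simp
qed

text \<open>The kernel at level \<open>k\<close> is \<open>2 ^ (k * d)\<close> times the dilate of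
  the kernel at level 0. Raising to the power \<open>r\<close> and substituting leaves the exponent
  \<open>d * (r - 1)\<close>. For \<open>r = min 1 p\<close> this is the origin of \<sigma>, as
  \<open>d * (1 - p) = p * \<sigma>\<close> when \<open>p < 1\<close>.\<close>

lemma nn_integral_mult_kernel_psi:
  assumes "r > 0"
  shows "(\<integral>\<^sup>+v. ennreal (norm (mult_kernel (\<lambda>\<xi>. complex_of_real (psi \<phi>\<^sub>0 k \<xi>)) (v::'a)) powr r) \<partial>lborel) =
    ennreal (2 powr (of_int k * (real DIM('a) * (r - 1)))) *
    (\<integral>\<^sup>+v. ennreal (norm (mult_kernel (\<lambda>\<xi>. complex_of_real (psi \<phi>\<^sub>0 0 \<xi>)) (v::'a)) powr r) \<partial>lborel)"
proof -
  let ?t = "2 powi k :: real" and ?d = "DIM('a)"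
  let ?f = "\<lambda>v::'a. ennreal (norm (mult_kernel (\<lambda>\<xi>. complex_of_real (psi \<phi>\<^sub>0 0 \<xi>)) v) powr r)"
  have [measurable]: "mult_kernel (\<lambda>\<xi>::'a. complex_of_real (psi \<phi>\<^sub>0 0 \<xi>)) \<in> borel_measurable borel"
    by (intro schwartz_measurable mult_kernel_schwartz psi_test)
  have t: "?t = 2 powr of_int k" "?t > 0" by (simp_all add: powr_real_of_int')
  have "(\<integral>\<^sup>+v. ?f v \<partial>lborel) = ennreal (?t ^ ?d) * (\<integral>\<^sup>+v. ?f (?t *\<^sub>R v) \<partial>lborel)"
    using nn_integral_lborel_scale[of ?f ?t 0] t(2) by simp
  then have "ennreal (2 powr (of_int k * (real ?d * (r - 1)))) * (\<integral>\<^sup>+v. ?f v \<partial>lborel) =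
      ennreal (2 powr (of_int k * (real ?d * (r - 1))) * ?t ^ ?d) * (\<integral>\<^sup>+v. ?f (?t *\<^sub>R v) \<partial>lborel)"
    by (simp add: ennreal_mult mult.assoc)
  also have "2 powr (of_int k * (real ?d * (r - 1))) * ?t ^ ?d = (?t ^ ?d) powr r"
    unfolding t(1) by (simp add: powr_power powr_powr powr_add[symmetric] algebra_simps)
  also have "ennreal ((?t ^ ?d) powr r) * (\<integral>\<^sup>+v. ?f (?t *\<^sub>R v) \<partial>lborel) = (\<integral>\<^sup>+v. ennreal ((?t ^ ?d) powr r) * ?f (?t *\<^sub>R v) \<partial>lborel)"
    by (rule nn_integral_cmult[symmetric]) measurable
  also have "\<dots> = (\<integral>\<^sup>+v. ennreal (norm (mult_kernel (\<lambda>\<xi>. complex_of_real (psi \<phi>\<^sub>0 k \<xi>)) (v::'a)) powr r) \<partial>lborel)"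
  proof (rule nn_integral_cong)
    fix v :: 'a
    have "norm (mult_kernel (\<lambda>\<xi>. complex_of_real (psi \<phi>\<^sub>0 k \<xi>)) v) =
       ?t ^ ?d * norm (mult_kernel (\<lambda>\<xi>. complex_of_real (psi \<phi>\<^sub>0 0 \<xi>)) (?t *\<^sub>R v))"
      unfolding mult_kernel_psi[of k] norm_mult norm_of_real using t(2) by simp
    then show "ennreal ((?t ^ ?d) powr r) * ?f (?t *\<^sub>R v) =
       ennreal (norm (mult_kernel (\<lambda>\<xi>. complex_of_real (psi \<phi>\<^sub>0 k \<xi>)) v) powr r)"
      using t(2) by (simp add: powr_mult ennreal_mult)
  qed
  finally show ?thesis by simp
qed

lemma integral_mult_kernel_psi:
  "(LINT v|lborel. norm (mult_kernel (\<lambda>\<xi>. complex_of_real (psi \<phi>\<^sub>0 k \<xi>)) (v::'a))) =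
   (LINT v|lborel. norm (mult_kernel (\<lambda>\<xi>. complex_of_real (psi \<phi>\<^sub>0 0 \<xi>)) (v::'a)))"
proof -
  have "(LINT v|lborel. norm (mult_kernel (\<lambda>\<xi>. complex_of_real (psi \<phi>\<^sub>0 j \<xi>)) (v::'a))) =
    enn2real (\<integral>\<^sup>+v. ennreal (norm (mult_kernel (\<lambda>\<xi>. complex_of_real (psi \<phi>\<^sub>0 j \<xi>)) (v::'a)) powr 1) \<partial>lborel)" for j
    using schwartz_measurable[OF mult_kernel_schwartz[OF psi_test]] by (subst integral_eq_nn_integral) auto
  then show ?thesis using nn_integral_mult_kernel_psi[of 1 k] by simp
qed

text \<open>The pointwise estimate with power \<open>p\<close> dominates the piece by a convolution
  of \<open>|filtered (cut 2) T| powr p\<close> with the kernel to the power \<open>min 1 p\<close>.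
  Morrey bounds survive this at the cost of the mass of that power, which carries the whole
  dependence on \<open>k\<close>.\<close>

lemma piece_low_estimate:
  assumes p: "p > 0"
  obtains C where "C > 0" "\<And>T k R X y. T \<in> tempered \<Longrightarrow> k \<le> 0 \<Longrightarrow>
     (\<forall>y. (\<integral>\<^sup>+v\<in>ball y R. ennreal (norm (filtered (cut 2) T v) powr p) \<partial>lborel) \<le> X) \<Longrightarrow>
     (\<integral>\<^sup>+x\<in>ball y R. ennreal (norm (piece T k x) powr p) \<partial>lborel) \<le>
       ennreal (C * 2 powr (of_int k * (real DIM('a) * (min 1 p - 1)))) * X"
proof -
  let ?K = "\<lambda>k. mult_kernel (\<lambda>\<xi>::'a. complex_of_real (psi \<phi>\<^sub>0 k \<xi>))"
  define r where "r = min 1 p"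
  have r: "r > 0" using p by (simp add: r_def)
  \<comment> \<open>For \<open>k <= 0\<close> the symbol of the piece lives in the ball of radius 2,
    where \<open>cut 2\<close> is 1; \<open>cut 2\<close> itself lives in the ball of radius 4.
    Differences of frequencies stay in the ball of radius 6, where \<open>cut 6\<close> is 1. These
    radii do not depend on \<open>k\<close>, hence neither does \<open>S\<close>.\<close>
  have c6: "cut 6 \<in> test_fun" and c2: "cut 2 \<in> test_fun" by (auto intro: cut_test)
  obtain S where S: "S > 0" "\<And>y. norm (mult_kernel (cut 6) y) \<le> S"
    using schwartz_rapid[OF mult_kernel_schwartz[OF c6], of 0] by auto
  define M where "M = (LINT v|lborel. norm (?K 0 v)) + 1"
  have M0: "(LINT v|lborel. norm (?K k v)) + 1 = M" for k
    unfolding M_def by (subst integral_mult_kernel_psi[of k]) (rule refl)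
  have M: "M > 0" "\<And>k. (LINT v|lborel. norm (?K k v)) \<le> M"
    subgoal unfolding M_def by (rule add_nonneg_pos) auto
    subgoal for k using M0[of k] by linarith
    done
  define E where "E = (if p < 1 then S powr (1 - p) else M powr (p - 1))"
  have E: "E > 0" using S M by (simp add: E_def)
  define i where "i = enn2real (\<integral>\<^sup>+v. ennreal (norm (?K 0 v) powr r) \<partial>lborel)"
  have i: "(\<integral>\<^sup>+v. ennreal (norm (?K 0 v) powr r) \<partial>lborel) = ennreal i" "i \<ge> 0"
    unfolding i_def using schwartz_powr_nn_integral_finite[OF mult_kernel_schwartz[OF psi_test] r] by (auto simp: less_top)
  have est: "(\<integral>\<^sup>+x\<in>ball y R. ennreal (norm (piece T k x) powr p) \<partial>lborel) \<le>
       ennreal ((E * i + 1) * 2 powr (of_int k * (real DIM('a) * (min 1 p - 1)))) * X"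
    if T: "T \<in> tempered" and k: "k \<le> 0" and X: "\<forall>y. (\<integral>\<^sup>+v\<in>ball y R. ennreal (norm (filtered (cut 2) T v) powr p) \<partial>lborel) \<le> X"
    for T k R X y
  proof -
    let ?g = "filtered (cut 2) T"
    have [measurable]: "?g \<in> borel_measurable borel" "?K k \<in> borel_measurable borel"
      by (auto intro: filtered_borel T c2 schwartz_measurable mult_kernel_schwartz psi_test)
    have k1: "(2::real) powi k \<le> 1" using power_int_increasing[of k 0 "2::real"] k by simp
    have eq: "piece T k = filtered (\<lambda>\<xi>. cut 2 \<xi> * complex_of_real (psi \<phi>\<^sub>0 k \<xi>)) T"
    proof -
      have mul: "cut 2 \<xi> * complex_of_real (psi \<phi>\<^sub>0 k \<xi>) = complex_of_real (psi \<phi>\<^sub>0 k \<xi>)" for \<xi>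
      proof (cases "complex_of_real (psi \<phi>\<^sub>0 k \<xi>) = 0")
        case False
        then have "norm \<xi> \<le> 2" using psi_support[OF False] k1 by linarith
        then show ?thesis by (simp add: cut_one)
      qed simp
      show ?thesis unfolding piece_def mul ..
    qed
    have pw: "ennreal (norm (piece T k x) powr p) \<le> ennreal E *
        (\<integral>\<^sup>+v. ennreal (norm (?K k (v - x)) powr r) * ennreal (norm (?g v) powr p) \<partial>lborel)" for x
      unfolding eq E_def r_def
    proof (rule filtered_mult_powr_le[OF T c2 psi_test c6 _ S(2) S(1) M(2) M(1) p])
      fix \<xi> \<zeta> :: 'a assume *: "cut 2 \<xi> \<noteq> 0" "complex_of_real (psi \<phi>\<^sub>0 k \<zeta>) \<noteq> 0"
      have "norm \<xi> \<le> 4" using cut_zero[of 2 \<xi>] *(1) by force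
      moreover have "norm \<zeta> \<le> 2" using psi_support[OF *(2)] k1 by linarith
      ultimately have "norm (\<xi> - \<zeta>) \<le> 6" using norm_triangle_ineq4[of \<xi> \<zeta>] by linarith
      then show "cut 6 (\<xi> - \<zeta>) = 1" by (simp add: cut_one)
    qed
    have [measurable]: "ball y R \<in> sets borel" by simp
    have "(\<integral>\<^sup>+x\<in>ball y R. ennreal (norm (piece T k x) powr p) \<partial>lborel) \<le>
       (\<integral>\<^sup>+x. ennreal E * ((\<integral>\<^sup>+v. ennreal (norm (?K k (v - x)) powr r) * ennreal (norm (?g v) powr p) \<partial>lborel) * indicator (ball y R) x) \<partial>lborel)"
      unfolding mult.assoc[symmetric] by (intro nn_integral_mono mult_right_mono pw) simp
    also have "\<dots> = ennreal E * (\<integral>\<^sup>+x\<in>ball y R. (\<integral>\<^sup>+v. ennreal (norm (?K k (v - x)) powr r) * ennreal (norm (?g v) powr p) \<partial>lborel) \<partial>lborel)"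
      by (rule nn_integral_cmult) measurable
    also have "\<dots> \<le> ennreal E * ((\<integral>\<^sup>+w. ennreal (norm (?K k w) powr r) \<partial>lborel) * X)"
      by (intro mult_left_mono nn_integral_ball_conv_le) (use X in auto)
    also have "\<dots> = ennreal (E * 2 powr (of_int k * (real DIM('a) * (r - 1))) * i) * X"
      unfolding nn_integral_mult_kernel_psi[OF r, of k] i(1) using E i(2) by (simp add: ennreal_mult mult.assoc)
    also have "\<dots> \<le> ennreal ((E * i + 1) * 2 powr (of_int k * (real DIM('a) * (r - 1)))) * X"
      by (intro mult_right_mono ennreal_leI) (auto simp: algebra_simps)
    finally show ?thesis unfolding r_def .
  qed
  have "E * i + 1 > 0" using E i(2) by (intro add_nonneg_pos) auto
  then show ?thesis using that est by blast
qed

text \<open>Nikolskij's inequality in Morrey form. A function with frequencies up to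
  \<open>2 * t\<close> is reproduced by a kernel at scale \<open>1 / t\<close>; the Plancherel-Polya
  estimate brings in its \<open>p\<close>-th power, whose weighted average is controlled by the
  growth of order \<delta> on balls.\<close>

lemma filtered_sup_estimate:
  assumes p: "0 < p" "p < 1" and \<delta>: "\<delta> \<le> real DIM('a)"
  obtains C where "C > 0" "\<And>T \<eta> t A x. T \<in> tempered \<Longrightarrow> \<eta> \<in> test_fun \<Longrightarrow> t > 0 \<Longrightarrow>
     (\<forall>\<xi>. \<eta> \<xi> \<noteq> 0 \<longrightarrow> norm \<xi> \<le> 2 * t) \<Longrightarrow> A \<ge> 0 \<Longrightarrow>
     (\<forall>y R. R > 0 \<longrightarrow> (\<integral>\<^sup>+v\<in>ball y R. ennreal (norm (filtered \<eta> T v) powr p) \<partial>lborel) \<le> ennreal (A * R powr \<delta>)) \<Longrightarrow>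
     norm (filtered \<eta> T (x::'a)) powr p \<le> C * A * t powr (real DIM('a) - \<delta>)"
proof -
  define d where "d = DIM('a)"
  let ?K = "mult_kernel (cut 1)"
  have KS: "?K \<in> schwartz" by (intro mult_kernel_schwartz cut_test) simp
  obtain S where S: "S > 0" "\<And>y. norm (?K y) \<le> S"
    using schwartz_rapid[OF KS, of 0] by auto
  \<comment> \<open>Decay beyond the dimension, and hence beyond \<delta>, makes the dyadic series
    in the weighted integral converge.\<close>
  define N where "N = Suc d"
  obtain C1 where C1: "C1 > 0" "\<And>v. norm (?K v) powr p \<le> C1 * (1 / (1 + norm v) ^ N)"
    using schwartz_powr_decay[OF KS p(1)] by metis
  define Q where "Q = 1 - 2 powr (\<delta> - real N)"
  have Q: "Q > 0" using \<delta> by (simp add: Q_def powr_less_one N_def d_def)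
  define C where "C = (6 ^ d * S) powr (1 - p) * ((2 ^ d) powr p * (C1 * (2 ^ N * 2 powr (- \<delta>) / Q)))"
  have C: "C > 0" using S C1 Q by (simp add: C_def)
  have "norm (filtered \<eta> T x) powr p \<le> C * A * t powr (real d - \<delta>)"
    if T: "T \<in> tempered" and \<eta>: "\<eta> \<in> test_fun" and t: "t > 0" and supp: "\<forall>\<xi>. \<eta> \<xi> \<noteq> 0 \<longrightarrow> norm \<xi> \<le> 2 * t" and A: "A \<ge> 0" and
     le: "\<forall>y R. R > 0 \<longrightarrow> (\<integral>\<^sup>+v\<in>ball y R. ennreal (norm (filtered \<eta> T v) powr p) \<partial>lborel) \<le> ennreal (A * R powr \<delta>)"
    for T \<eta> t A and x :: 'a
  proof -
    let ?g = "filtered \<eta> T"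
    have [measurable]: "?g \<in> borel_measurable borel" by (rule filtered_borel[OF T \<eta>])
    \<comment> \<open>\<open>cut (2 * t)\<close> is 1 on the band of \<eta> and lives in radius
      \<open>4 * t\<close>; together with the band this gives differences of at most
      \<open>6 * t\<close>.\<close>
    have H: "cut (2 * t) \<in> test_fun" and \<Theta>: "cut (6 * t) \<in> test_fun" using t by (auto intro: cut_test)
    have eq: "(\<lambda>\<xi>. \<eta> \<xi> * cut (2 * t) \<xi>) = \<eta>"
    proof
      fix \<xi> show "\<eta> \<xi> * cut (2 * t) \<xi> = \<eta> \<xi>" using supp cut_one[of "2 * t" \<xi>] t by (cases "\<eta> \<xi> = 0") auto
    qed
    have sup: "norm (mult_kernel (cut (6 * t)) y) \<le> (6 * t) ^ d * S" for y
    proof -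
      have "norm (mult_kernel (cut (6 * t)) y) = (6 * t) ^ d * norm (?K ((6 * t) *\<^sub>R y))"
        by (subst mult_kernel_cut) (use t in \<open>simp_all add: norm_mult norm_power d_def\<close>)
      then show ?thesis using t S(2)[of "(6 * t) *\<^sub>R y"] by (simp add: mult_left_mono)
    qed
    define M where "M = (LINT v|lborel. norm (mult_kernel (cut (2 * t)) (v::'a))) + 1"
    have M: "M > 0" "(LINT v|lborel. norm (mult_kernel (cut (2 * t)) (v::'a))) \<le> M"
      unfolding M_def by (auto intro: add_nonneg_pos)
    have kern: "norm (mult_kernel (cut (2 * t)) (v - x)) powr p \<le> ((2 * t) ^ d) powr p * C1 * (1 / (1 + 2 * t * norm (v - x)) ^ N)" for v
    proof -
      have "norm (mult_kernel (cut (2 * t)) (v - x)) powr p = ((2 * t) ^ d) powr p * norm (?K ((2 * t) *\<^sub>R (v - x))) powr p"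
        by (subst mult_kernel_cut) (use t in \<open>simp_all add: norm_mult norm_power d_def powr_mult\<close>)
      also have "\<dots> \<le> ((2 * t) ^ d) powr p * (C1 * (1 / (1 + norm ((2 * t) *\<^sub>R (v - x))) ^ N))"
        by (intro mult_left_mono C1) simp
      finally show ?thesis using t by simp
    qed
    have "ennreal (norm (filtered (\<lambda>\<xi>. \<eta> \<xi> * cut (2 * t) \<xi>) T x) powr p) \<le>
       ennreal (if p < 1 then ((6 * t) ^ d * S) powr (1 - p) else M powr (p - 1)) *
       (\<integral>\<^sup>+v. ennreal (norm (mult_kernel (cut (2 * t)) (v - x)) powr (min 1 p)) * ennreal (norm (?g v) powr p) \<partial>lborel)"
    proof (rule filtered_mult_powr_le[OF T \<eta> H \<Theta> _ sup _ M(2) M(1) p(1)])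
      fix \<xi> \<zeta> :: 'a assume *: "\<eta> \<xi> \<noteq> 0" "cut (2 * t) \<zeta> \<noteq> 0"
      have "norm \<xi> \<le> 2 * t" using supp * by blast
      moreover have "norm \<zeta> \<le> 4 * t" using cut_zero[of "2 * t" \<zeta>] *(2) t by force
      ultimately have "norm (\<xi> - \<zeta>) \<le> 6 * t" using norm_triangle_ineq4[of \<xi> \<zeta>] by linarith
      then show "cut (6 * t) (\<xi> - \<zeta>) = 1" using t by (simp add: cut_one)
    qed (use t S in auto)
    also have "\<dots> = ennreal (((6 * t) ^ d * S) powr (1 - p)) *
       (\<integral>\<^sup>+v. ennreal (norm (mult_kernel (cut (2 * t)) (v - x)) powr p) * ennreal (norm (?g v) powr p) \<partial>lborel)"
      using p by simp
    also have "\<dots> \<le> ennreal (((6 * t) ^ d * S) powr (1 - p)) *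
       (\<integral>\<^sup>+v. ennreal (((2 * t) ^ d) powr p * C1) * (ennreal (1 / (1 + 2 * t * norm (v - x)) ^ N) * ennreal (norm (?g v) powr p)) \<partial>lborel)"
      unfolding mult.assoc[symmetric]
      by (intro mult_left_mono nn_integral_mono mult_right_mono)
        (use kern C1(1) t in \<open>auto simp: ennreal_mult[symmetric]\<close>)
    also have "(\<integral>\<^sup>+v. ennreal (((2 * t) ^ d) powr p * C1) * (ennreal (1 / (1 + 2 * t * norm (v - x)) ^ N) * ennreal (norm (?g v) powr p)) \<partial>lborel) =
       ennreal (((2 * t) ^ d) powr p * C1) * (\<integral>\<^sup>+v. ennreal (1 / (1 + 2 * t * norm (v - x)) ^ N) * ennreal (norm (?g v) powr p) \<partial>lborel)"
      by (rule nn_integral_cmult) measurable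
    also have "(\<integral>\<^sup>+v. ennreal (1 / (1 + 2 * t * norm (v - x)) ^ N) * ennreal (norm (?g v) powr p) \<partial>lborel) \<le>
       ennreal (2 ^ N * A * (2 * t) powr (- \<delta>) / (1 - 2 powr (\<delta> - N)))"
      by (rule nn_integral_radial_weight) (use le A t \<delta> in \<open>auto simp: N_def d_def\<close>)
    finally have "ennreal (norm (?g x) powr p) \<le> ennreal (((6 * t) ^ d * S) powr (1 - p)) *
       (ennreal (((2 * t) ^ d) powr p * C1) * ennreal (2 ^ N * A * (2 * t) powr (- \<delta>) / Q))"
      unfolding eq Q_def by (simp add: mult_left_mono)
    also have "\<dots> = ennreal (((6 * t) ^ d * S) powr (1 - p) * (((2 * t) ^ d) powr p * C1 * (2 ^ N * A * (2 * t) powr (- \<delta>) / Q)))"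
      using C1 A Q by (simp add: ennreal_mult[symmetric])
    also have "((6 * t) ^ d * S) powr (1 - p) * (((2 * t) ^ d) powr p * C1 * (2 ^ N * A * (2 * t) powr (- \<delta>) / Q)) = C * A * t powr (real d - \<delta>)"
    \<comment> \<open>Collecting powers of \<open>t\<close>: the supremum of the reproducing kernel
      gives \<open>(t ^ d) powr (1 - p)\<close>, the kernel to the power \<open>p\<close> gives
      \<open>(t ^ d) powr p\<close>, and the weighted integral gives
      \<open>t powr (- \<delta>)\<close>.\<close>
    proof -
      have 1: "((6 * t) ^ d * S) powr (1 - p) = (6 ^ d * S) powr (1 - p) * (t ^ d) powr (1 - p)"
        using t S by (simp add: power_mult_distrib powr_mult[symmetric] mult_ac)
      have 2: "((2 * t) ^ d) powr p = (2 ^ d) powr p * (t ^ d) powr p"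
        using t by (simp add: power_mult_distrib powr_mult)
      have 3: "(2 * t) powr (- \<delta>) = 2 powr (- \<delta>) * t powr (- \<delta>)" using t by (simp add: powr_mult)
      have 4: "(t ^ d) powr (1 - p) * ((t ^ d) powr p * t powr (- \<delta>)) = t powr (real d - \<delta>)"
        using t by (simp add: powr_realpow[symmetric] powr_powr powr_add[symmetric] algebra_simps)
      show ?thesis unfolding 1 2 3 C_def 4[symmetric] by simp
    qed
    finally show ?thesis using C A by simp
  qed
  then show ?thesis using that C unfolding d_def by blast
qed

section \<open>Regularity of the distribution\<close>

text \<open>The partial sums of the pieces are \<open>filtered (cut (2 ^ n)) T\<close>, which
  converge to \<open>T\<close> against test functions. The sum of the moduli is locally integrable
  and dominates all of them, so the limit may be taken under the integral and identifies the
  pointwise sum with \<open>T\<close>.\<close>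

lemma represents_sum_of_pieces:
  fixes T :: "('a \<Rightarrow> complex) \<Rightarrow> complex"
  assumes T: "T \<in> tempered"
    and fin: "\<And>R. R > 0 \<Longrightarrow> (\<integral>\<^sup>+x\<in>ball 0 R. (\<Sum>n. ennreal (norm (fourier_mult (phi \<phi>\<^sub>0 (int n)) T x))) \<partial>lborel) < \<top>"
  shows "represents (\<lambda>x. \<Sum>n. fourier_mult (phi \<phi>\<^sub>0 (int n)) T x) T"
    and "AE x in lebesgue. (\<Sum>n. ennreal (norm (fourier_mult (phi \<phi>\<^sub>0 (int n)) T x))) < \<top>"
proof -
  let ?P = "\<lambda>n. fourier_mult (phi \<phi>\<^sub>0 (int n)) T"
  let ?F = "\<lambda>x. \<Sum>n. ?P n x"
  define G where "G x = (\<Sum>n. ennreal (norm (?P n x)))" for x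
  have [measurable]: "?P n \<in> borel_measurable borel" for n
    using filtered_borel[OF T] cut_test psi_test by (auto simp: fourier_mult_phi[OF T] piece_def)
  have [measurable]: "ball (0::'a) R \<in> sets borel" for R by simp
  have Gm[measurable]: "G \<in> borel_measurable borel" unfolding G_def[abs_def] by measurable
  have Gint: "(\<integral>\<^sup>+x. G x * indicator (ball 0 R) x \<partial>lborel) < \<top>" if "R > 0" for R
    using fin[OF that] by (simp add: G_def)
  have AE_G: "AE x in lborel. G x < \<top>"
  proof -
    have "AE x in lborel. G x * indicator (ball 0 (real (Suc n))) x \<noteq> \<infinity>" for n
      by (rule nn_integral_PInf_AE) (use Gint[of "real (Suc n)"] in auto)
    then have "AE x in lborel. \<forall>n. G x * indicator (ball 0 (real (Suc n))) x \<noteq> \<infinity>" by (simp add: AE_all_countable)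
    then show ?thesis
    proof eventually_elim
      case (elim x)
      obtain n where "norm x < real n" using reals_Archimedean2 by blast
      then show ?case using elim[rule_format, of n] by (auto simp: less_top)
    qed
  qed
  then show "AE x in lebesgue. (\<Sum>n. ennreal (norm (?P n x))) < \<top>"
    unfolding G_def by (rule AE_completion)
  have summ: "summable (\<lambda>n. norm (?P n x))" if "G x < \<top>" for x
    using that unfolding G_def by (intro summable_suminf_not_top) auto
  have FG: "ennreal (norm (?F x)) \<le> G x" for x
  proof (cases "G x < \<top>")
    case True
    have "norm (?F x) \<le> (\<Sum>n. norm (?P n x))" by (rule summable_norm[OF summ[OF True]])
    then show ?thesis unfolding G_def by (subst suminf_ennreal2[OF _ summ[OF True]]) (auto intro: ennreal_leI)
  qed (simp add: less_top[symmetric])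
  have Gr: "ennreal (enn2real (G x)) \<le> G x" for x by (cases "G x") auto
  have [measurable]: "?F \<in> borel_measurable borel" by measurable
  show "represents ?F T"
    unfolding represents_def
  proof (intro conjI allI impI ballI)
    fix C :: "'a set" assume C: "compact C"
    then have [measurable]: "C \<in> sets borel" by (auto intro: borel_closed compact_imp_closed)
    obtain R where R: "R > 0" "C \<subseteq> ball 0 R"
      using bounded_subset_ballD[OF compact_imp_bounded[OF C], of 0] by auto
    have "integrable lborel (\<lambda>x. indicator C x *\<^sub>R ?F x)"
    proof (rule integrableI_bounded)
      have "(\<integral>\<^sup>+x. ennreal (norm (indicator C x *\<^sub>R ?F x)) \<partial>lborel) \<le> (\<integral>\<^sup>+x. G x * indicator (ball 0 R) x \<partial>lborel)"
        by (intro nn_integral_mono) (use R FG in \<open>auto simp: indicator_def\<close>)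
      then show "(\<integral>\<^sup>+x. ennreal (norm (indicator C x *\<^sub>R ?F x)) \<partial>lborel) < \<infinity>"
        using Gint[OF R(1)] by (simp add: le_less_trans)
    qed measurable
    then show "set_integrable lebesgue C ?F" unfolding set_integrable_def by (subst integrable_completion) auto
  next
    fix \<phi> :: "'a \<Rightarrow> complex" assume \<phi>: "\<phi> \<in> test_fun"
    have [measurable]: "\<phi> \<in> borel_measurable borel" by (rule test_fun_measurable[OF \<phi>])
    obtain R where R: "R > 0" "\<And>x. norm x > R \<Longrightarrow> \<phi> x = 0" using test_fun_bounded_support[OF \<phi>] by metis
    obtain M where M: "M > 0" "\<And>x. norm (\<phi> x) \<le> M" using schwartz_rapid[OF test_fun_schwartz[OF \<phi>], of 0] by auto
    \<comment> \<open>The support of \<phi> is only known to lie in the closed ball of radius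
      \<open>R\<close>; the open ball of radius \<open>R + 1\<close> contains it.\<close>
    let ?w = "\<lambda>x. M * enn2real (G x) * indicator (ball 0 (R + 1)) x"
    have phi_le: "norm (\<phi> x) \<le> M * indicator (ball 0 (R + 1)) x" for x
      using M R(2)[of x] by (cases "norm x > R") (auto simp: indicator_def)
    have "(\<lambda>n. LINT v|lborel. \<phi> v * filtered (cut (2 ^ n)) T v) \<longlonglongrightarrow> (LINT v|lborel. \<phi> v * ?F v)"
    proof (rule integral_dominated_convergence[where w="?w"])
      show "(\<lambda>v. \<phi> v * filtered (cut (2 ^ n)) T v) \<in> borel_measurable lborel" for n
        using filtered_borel[OF T cut_test, of "2 ^ n"] by simp
      show "integrable lborel ?w"
      proof (rule integrableI_bounded)
        have "(\<integral>\<^sup>+x. ennreal (norm (?w x)) \<partial>lborel) \<le> (\<integral>\<^sup>+x. ennreal M * (G x * indicator (ball 0 (R + 1)) x) \<partial>lborel)"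
          by (intro nn_integral_mono)
            (use M Gr in \<open>auto simp: indicator_def abs_mult ennreal_mult intro!: mult_left_mono\<close>)
        also have "\<dots> = ennreal M * (\<integral>\<^sup>+x. G x * indicator (ball 0 (R + 1)) x \<partial>lborel)"
          by (rule nn_integral_cmult) measurable
        also have "\<dots> < \<infinity>" using Gint[of "R + 1"] R by (simp add: ennreal_mult_less_top)
        finally show "(\<integral>\<^sup>+x. ennreal (norm (?w x)) \<partial>lborel) < \<infinity>" .
      qed measurable
      show "AE x in lborel. (\<lambda>n. \<phi> x * filtered (cut (2 ^ n)) T x) \<longlonglongrightarrow> \<phi> x * ?F x"
        using AE_G
      proof eventually_elim
        case (elim x)
        have "summable (\<lambda>n. ?P n x)" by (rule summable_norm_cancel[OF summ[OF elim]])
        then show ?case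
          unfolding filtered_cut_sum[OF T] by (intro tendsto_mult tendsto_const summable_LIMSEQ')
      qed
      show "AE x in lborel. norm (\<phi> x * filtered (cut (2 ^ n)) T x) \<le> ?w x" for n
        using AE_G
      proof eventually_elim
        case (elim x)
        have "norm (filtered (cut (2 ^ n)) T x) \<le> (\<Sum>k\<le>n. norm (?P k x))"
          unfolding filtered_cut_sum[OF T] by (rule norm_sum)
        also have "\<dots> \<le> (\<Sum>k. norm (?P k x))" by (rule sum_le_suminf[OF summ[OF elim]]) auto
        also have "\<dots> = enn2real (G x)"
        proof -
          have "G x = ennreal (\<Sum>k. norm (?P k x))"
            unfolding G_def by (rule suminf_ennreal2[OF _ summ[OF elim]]) simp
          then show ?thesis using suminf_nonneg[OF summ[OF elim]] by simp
        qed
        finally have "norm (\<phi> x) * norm (filtered (cut (2 ^ n)) T x) \<le> (M * indicator (ball 0 (R + 1)) x) * enn2real (G x)"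
          by (intro mult_mono phi_le) (use M in auto)
        then show ?case by (simp add: norm_mult mult_ac)
      qed
    qed measurable
    then have "T \<phi> = (LINT v|lborel. \<phi> v * ?F v)"
      using filtered_cut_tendsto[OF T \<phi>] LIMSEQ_unique by blast
    then show "T \<phi> = (LINT v|lebesgue. ?F v * \<phi> v)"
      by (subst integral_completion) (auto simp: mult.commute)
  qed
qed

end

section \<open>Equivalence of the quasi-norms\<close>

lemma morrey_norm_cong_AE:
  assumes "AE x in lebesgue. g x = h x"
  shows "morrey_norm u p g = morrey_norm u p h"
proof -
  have "(\<integral>\<^sup>+x\<in>ball y R. ennreal_powr (g x) p \<partial>lebesgue) = (\<integral>\<^sup>+x\<in>ball y R. ennreal_powr (h x) p \<partial>lebesgue)" for y R
    by (rule nn_integral_cong_AE, use assms in eventually_elim) simp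
  then show ?thesis by (simp add: morrey_norm_def)
qed

locale tlm_params = smooth_cutoff \<phi>\<^sub>0 for \<phi>\<^sub>0 :: "'a::euclidean_space \<Rightarrow> real" +
  fixes s u p :: real and q :: ereal
  assumes p_pos: "0 < p" and p_le_u: "p \<le> u" and q_pos: "0 < q"
    and s_gt: "p / u * sigma_idx DIM('a) p < s"
begin

lemma u_pos: "0 < u" using p_pos p_le_u by simp

lemma s_pos: "0 < s"
proof -
  have "0 \<le> p / u * sigma_idx DIM('a) p" using p_pos u_pos by (simp add: sigma_idx_def)
  then show ?thesis using s_gt by simp
qed

abbreviation block :: "(('a \<Rightarrow> complex) \<Rightarrow> complex) \<Rightarrow> int \<Rightarrow> 'a \<Rightarrow> complex" where
  "block f k \<equiv> fourier_mult (phi \<phi>\<^sub>0 k) f"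

definition W :: "(('a \<Rightarrow> complex) \<Rightarrow> complex) \<Rightarrow> 'a \<Rightarrow> ennreal" where
  "W f x = weighted_lq s q {0..} (\<lambda>k. block f k x)"

lemma tlm_norm_eq: "tlm_norm \<phi>\<^sub>0 s u p q f = morrey_norm u p (W f)"
  by (simp add: tlm_norm_def W_def[abs_def])

lemma piece_measurable: "f \<in> tempered \<Longrightarrow> piece f k \<in> borel_measurable borel"
  by (simp add: piece_def filtered_borel psi_test)

lemma block_measurable: "f \<in> tempered \<Longrightarrow> block f k \<in> borel_measurable borel"
  using filtered_borel cut_test[of 1] piece_measurable by (auto simp: fourier_mult_phi)

lemma W_measurable: "f \<in> tempered \<Longrightarrow> W f \<in> borel_measurable borel"
  unfolding W_def[abs_def] using block_measurable by measurable

lemma measure_ball: "R > 0 \<Longrightarrow> measure lebesgue (ball (y::'a) R) = unit_ball_vol (DIM('a)) * R ^ DIM('a)"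
  by (simp add: content_ball)

section \<open>Local integrability of the series of blocks\<close>

lemma W_ball_bound:
  assumes f: "f \<in> tempered" and N: "morrey_norm u p (W f) \<le> ennreal N" "N \<ge> 0" and R: "R > 0"
  shows "(\<integral>\<^sup>+x\<in>ball y R. ennreal_powr (W f x) p \<partial>lborel) \<le>
    ennreal (N powr p * (unit_ball_vol (DIM('a)) * R ^ DIM('a)) powr (1 - p / u))"
proof -
  have "\<forall>y R. R > 0 \<longrightarrow> (\<integral>\<^sup>+x\<in>ball y R. ennreal_powr (W f x) p \<partial>lborel) \<le>
      ennreal (N powr p * measure lebesgue (ball y R) powr (1 - p / u))"
    using N(1) unfolding morrey_norm_le_iff[OF p_pos u_pos N(2)] nn_integral_completion .
  from this[rule_format, OF R, of y] show ?thesis unfolding measure_ball[OF R] .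
qed

lemma block_le_W:
  assumes "k \<ge> 0"
  shows "ennreal (2 powr (of_int k * s) * norm (block f k x)) \<le> W f x"
  unfolding W_def by (rule weighted_lq_ge) (use assms q_pos in auto)

lemma block_powr_le_W:
  assumes "k \<ge> 0"
  shows "ennreal (norm (block f k x) powr p) \<le> ennreal (2 powr (- (of_int k * s * p))) * ennreal_powr (W f x) p"
proof -
  have "ennreal ((2 powr (of_int k * s) * norm (block f k x)) powr p) \<le> ennreal_powr (W f x) p"
    using ennreal_powr_mono[OF p_pos block_le_W[OF assms, of f x]] by simp
  then have "ennreal (2 powr (- (of_int k * s * p))) * ennreal ((2 powr (of_int k * s) * norm (block f k x)) powr p) \<le>
     ennreal (2 powr (- (of_int k * s * p))) * ennreal_powr (W f x) p" by (rule mult_left_mono) simp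
  moreover have "ennreal (2 powr (- (of_int k * s * p))) * ennreal ((2 powr (of_int k * s) * norm (block f k x)) powr p) =
     ennreal (norm (block f k x) powr p)"
    by (simp add: ennreal_mult[symmetric] powr_mult powr_powr mult.assoc[symmetric] powr_add[symmetric])
  ultimately show ?thesis by simp
qed

text \<open>The sum of the moduli is at most a constant times \<open>W\<close>, and for
  \<open>p >= 1\<close> one has \<open>W <= 1 + W powr p\<close>, whose integral over a ball is
  finite.\<close>

lemma block_local_integrable_large:
  assumes f: "f \<in> tempered" and N: "morrey_norm u p (W f) \<le> ennreal N" "N \<ge> 0" and R: "R > 0" and p: "p \<ge> 1"
  shows "(\<integral>\<^sup>+x\<in>ball 0 R. (\<Sum>n. ennreal (norm (block f (int n) x))) \<partial>lborel) < \<top>"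
proof -
  define c where "c = 1 / (1 - 2 powr (- s))"
  have c: "c > 0" using s_pos by (simp add: c_def powr_less_one)
  note [measurable] = W_measurable[OF f]
  have [measurable]: "ball (0::'a) R \<in> sets borel" by simp
  have W1: "W f x \<le> 1 + ennreal_powr (W f x) p" for x
  proof (cases "W f x")
    case (real w)
    have "w \<le> 1 + w powr p"
    proof (cases "w \<le> 1")
      case False
      then have "w powr 1 \<le> w powr p" using p by (intro powr_mono) auto
      then show ?thesis using False by simp
    qed (use powr_ge_zero[of w p] in linarith)
    then have "ennreal w \<le> ennreal (1 + w powr p)" by (rule ennreal_leI)
    also have "\<dots> = 1 + ennreal (w powr p)" by (subst ennreal_plus) auto
    finally show ?thesis using real by simp
  qed simp
  have pw: "(\<Sum>n. ennreal (norm (block f (int n) x))) \<le> ennreal c * (1 + ennreal_powr (W f x) p)" for x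
  proof -
    have "(\<Sum>n. ennreal (norm (block f (int (n + 0)) x))) \<le> ennreal c * weighted_lq s q {int 0..} (\<lambda>k. block f k x)"
      unfolding c_def by (rule weighted_lq_sum_le[OF q_pos s_pos])
    also have "\<dots> \<le> ennreal c * (1 + ennreal_powr (W f x) p)"
      using W1[of x] by (intro mult_left_mono) (auto simp: W_def)
    finally show ?thesis by simp
  qed
  have "(\<integral>\<^sup>+x\<in>ball 0 R. (\<Sum>n. ennreal (norm (block f (int n) x))) \<partial>lborel) \<le>
      (\<integral>\<^sup>+x. ennreal c * (indicator (ball 0 R) x + ennreal_powr (W f x) p * indicator (ball 0 R) x) \<partial>lborel)"
  proof (rule nn_integral_mono)
    fix x
    show "(\<Sum>n. ennreal (norm (block f (int n) x))) * indicator (ball 0 R) x \<le>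
      ennreal c * (indicator (ball 0 R) x + ennreal_powr (W f x) p * indicator (ball 0 R) x)"
    proof (cases "x \<in> ball 0 R")
      case True
      show ?thesis using pw[of x] by (simp only: indicator_simps(1)[OF True] mult_1_right)
    next
      case False
      show ?thesis by (simp only: indicator_simps(2)[OF False] mult_zero_right zero_le)
    qed
  qed
  also have "\<dots> = ennreal c * (emeasure lborel (ball (0::'a) R) + (\<integral>\<^sup>+x\<in>ball 0 R. ennreal_powr (W f x) p \<partial>lborel))"
    by (subst nn_integral_cmult, measurable) (subst nn_integral_add, auto)
  also have "\<dots> < \<top>"
    using W_ball_bound[OF f N R, of 0] emeasure_lborel_ball_finite[of "0::'a" R]
    by (auto simp: ennreal_mult_less_top intro: le_less_trans)
  finally show ?thesis .
qed

text \<open>For each block the integral of the modulus is at most its supremum to the power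
  \<open>1 - p\<close> times the integral of its \<open>p\<close>-th power. Nikolskij's inequality
  bounds the supremum, and both factors together decay geometrically in \<open>n\<close>.\<close>

lemma block_local_integrable_small:
  assumes f: "f \<in> tempered" and N: "morrey_norm u p (W f) \<le> ennreal N" "N \<ge> 0" and R: "R > 0" and p: "p < 1"
  shows "(\<integral>\<^sup>+x\<in>ball 0 R. (\<Sum>n. ennreal (norm (block f (int n) x))) \<partial>lborel) < \<top>"
proof -
  define d where "d = real DIM('a)"
  define \<delta> where "\<delta> = d * (1 - p / u)"
  define \<omega> where "\<omega> = unit_ball_vol (real DIM('a)) powr (1 - p / u)"
  have \<delta>: "\<delta> \<le> d" using p_pos u_pos by (simp add: \<delta>_def d_def algebra_simps)
  note [measurable] = W_measurable[OF f] block_measurable[OF f]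
  have [measurable]: "ball y r \<in> sets borel" for y :: 'a and r by simp
  define A where "A n = 2 powr (- (real n * s * p)) * N powr p * \<omega>" for n :: nat
  have A: "A n \<ge> 0" for n by (simp add: A_def \<omega>_def)
  have vol: "(unit_ball_vol (real DIM('a)) * r ^ DIM('a)) powr (1 - p / u) = \<omega> * r powr \<delta>" if "r > 0" for r
    using that by (simp add: \<omega>_def \<delta>_def d_def powr_mult powr_realpow[symmetric] powr_powr)
  have le: "(\<integral>\<^sup>+v\<in>ball y r. ennreal (norm (block f (int n) v) powr p) \<partial>lborel) \<le> ennreal (A n * r powr \<delta>)"
    if "r > 0" for n y r
  proof -
    have "(\<integral>\<^sup>+v\<in>ball y r. ennreal (norm (block f (int n) v) powr p) \<partial>lborel) \<le>
      (\<integral>\<^sup>+v. ennreal (2 powr (- (of_int (int n) * s * p))) * (ennreal_powr (W f v) p * indicator (ball y r) v) \<partial>lborel)"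
      unfolding mult.assoc[symmetric] by (intro nn_integral_mono mult_right_mono block_powr_le_W) auto
    also have "\<dots> = ennreal (2 powr (- (of_int (int n) * s * p))) * (\<integral>\<^sup>+v\<in>ball y r. ennreal_powr (W f v) p \<partial>lborel)"
      by (rule nn_integral_cmult) measurable
    also have "\<dots> \<le> ennreal (2 powr (- (of_int (int n) * s * p))) * ennreal (N powr p * (\<omega> * r powr \<delta>))"
      using W_ball_bound[OF f N that, of y] unfolding vol[OF that] by (rule mult_left_mono) simp
    finally show ?thesis by (simp add: A_def ennreal_mult[symmetric] mult_ac \<omega>_def)
  qed
  obtain C where C: "C > 0" "\<And>T \<eta> t A x. T \<in> tempered \<Longrightarrow> \<eta> \<in> test_fun \<Longrightarrow> t > 0 \<Longrightarrow>
     (\<forall>\<xi>. \<eta> \<xi> \<noteq> 0 \<longrightarrow> norm \<xi> \<le> 2 * t) \<Longrightarrow> A \<ge> 0 \<Longrightarrow>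
     (\<forall>y R. R > 0 \<longrightarrow> (\<integral>\<^sup>+v\<in>ball y R. ennreal (norm (filtered \<eta> T v) powr p) \<partial>lborel) \<le> ennreal (A * R powr \<delta>)) \<Longrightarrow>
     norm (filtered \<eta> T (x::'a)) powr p \<le> C * A * t powr (d - \<delta>)"
    using filtered_sup_estimate[OF p_pos p, of \<delta>] \<delta> unfolding d_def by blast
  \<comment> \<open>The bound for the \<open>p\<close>-th power of the supremum. With
    \<open>d - \<delta> = d * p / u\<close> it is of order
    \<open>2 powr (n * p * (d / u - s))\<close>, so it may well grow with \<open>n\<close>.\<close>
  define B where "B n = C * A n * (2 ^ n) powr (d - \<delta>)" for n :: nat
  have sup: "norm (block f (int n) x) powr p \<le> B n" for n x
  proof -
    obtain \<eta> where \<eta>: "\<eta> \<in> test_fun" "block f (int n) = filtered \<eta> f" "\<forall>\<xi>. \<eta> \<xi> \<noteq> 0 \<longrightarrow> norm \<xi> \<le> 2 * 2 ^ n"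
    proof (cases "n = 0")
      case True
      have "\<forall>\<xi>. cut 1 \<xi> \<noteq> 0 \<longrightarrow> norm \<xi> \<le> 2 * 2 ^ n" using True cut_zero[of 1] by force
      then show ?thesis using that[of "cut 1"] True by (simp add: cut_test fourier_mult_phi[OF f])
    next
      case False
      then show ?thesis
        using that[of "\<lambda>\<xi>. complex_of_real (psi \<phi>\<^sub>0 (int n) \<xi>)"] psi_support[of "int n"] psi_test
        by (simp add: fourier_mult_phi[OF f] piece_def)
    qed
    show ?thesis unfolding B_def \<eta>(2)
      by (rule C(2)[OF f \<eta>(1) _ \<eta>(3) A]) (use le[of _ n, unfolded \<eta>(2)] in auto)
  qed
  \<comment> \<open>The net exponent: \<open>(d / u - s) * (1 - p)\<close> from the supremum and
    \<open>- s * p\<close> from the integral of the \<open>p\<close>-th power. It is negative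
    exactly because \<open>s\<close> exceeds \<open>p / u\<close> times \<sigma>.\<close>
  define e where "e = d * (1 - p) / u - s"
  have e: "e < 0"
  proof -
    have "max 0 (1 / p - 1) = 1 / p - 1" using p_pos p by (simp add: max_def field_simps)
    then have "sigma_idx DIM('a) p = d * (1 / p - 1)" by (simp only: sigma_idx_def d_def)
    then have "p * sigma_idx DIM('a) p = d * (1 - p)" using p_pos by (simp add: field_simps)
    then have "p / u * sigma_idx DIM('a) p = d * (1 - p) / u" by simp
    then show ?thesis using s_gt unfolding e_def by linarith
  qed
  define K where "K = (C * N powr p * \<omega>) powr ((1 - p) / p) * N powr p * \<omega> * R powr \<delta>"
  have K: "K \<ge> 0" by (simp add: K_def \<omega>_def)
  have trm: "(\<integral>\<^sup>+x\<in>ball 0 R. ennreal (norm (block f (int n) x)) \<partial>lborel) \<le> ennreal (K * (2 powr e) ^ n)" for n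
  proof -
    have pw: "norm (block f (int n) x) \<le> B n powr ((1 - p) / p) * norm (block f (int n) x) powr p" for x
    proof -
      have "norm (block f (int n) x) = (norm (block f (int n) x) powr p) powr ((1 - p) / p) * norm (block f (int n) x) powr p"
        using p_pos by (simp add: powr_powr powr_add[symmetric])
      also have "\<dots> \<le> B n powr ((1 - p) / p) * norm (block f (int n) x) powr p"
        using sup p_pos p by (intro mult_right_mono powr_mono2) auto
      finally show ?thesis .
    qed
    have "(\<integral>\<^sup>+x\<in>ball 0 R. ennreal (norm (block f (int n) x)) \<partial>lborel) \<le>
       (\<integral>\<^sup>+x. ennreal (B n powr ((1 - p) / p)) * (ennreal (norm (block f (int n) x) powr p) * indicator (ball 0 R) x) \<partial>lborel)"
      unfolding mult.assoc[symmetric]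
      by (intro nn_integral_mono mult_right_mono) (use pw in \<open>auto simp: ennreal_mult[symmetric] intro!: ennreal_leI\<close>)
    also have "\<dots> = ennreal (B n powr ((1 - p) / p)) * (\<integral>\<^sup>+x\<in>ball 0 R. ennreal (norm (block f (int n) x) powr p) \<partial>lborel)"
      by (rule nn_integral_cmult) measurable
    also have "\<dots> \<le> ennreal (B n powr ((1 - p) / p)) * ennreal (A n * R powr \<delta>)"
      by (intro mult_left_mono le R) simp
    also have "\<dots> = ennreal (B n powr ((1 - p) / p) * (A n * R powr \<delta>))"
      using A by (simp add: ennreal_mult)
    also have "B n powr ((1 - p) / p) * (A n * R powr \<delta>) = K * (2 powr e) ^ n"
    proof -
      have "B n = (C * N powr p * \<omega>) * 2 powr (real n * (d - \<delta> - s * p))"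
      proof -
        have "2 powr (- (real n * s * p)) * (2 ^ n) powr (d - \<delta>) = 2 powr (real n * (d - \<delta> - s * p))"
          by (simp add: powr_realpow[symmetric] powr_powr powr_add[symmetric] algebra_simps)
        then show ?thesis unfolding B_def A_def by (metis (no_types, opaque_lifting) mult.assoc mult.commute)
      qed
      then have 1: "B n powr ((1 - p) / p) = (C * N powr p * \<omega>) powr ((1 - p) / p) * 2 powr (real n * (d - \<delta> - s * p) * ((1 - p) / p))"
        using C(1) by (simp add: powr_mult powr_powr \<omega>_def)
      have "real n * (d - \<delta> - s * p) * ((1 - p) / p) + - (real n * s * p) = real n * e"
      proof -
        have "(d - \<delta> - s * p) * ((1 - p) / p) - s * p = e"
          using p_pos u_pos by (simp add: \<delta>_def e_def field_simps)
        then show ?thesis by (metis (no_types, lifting) add.commute mult.assoc mult_minus_right right_diff_distrib uminus_add_conv_diff)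
      qed
      then have 2: "2 powr (real n * (d - \<delta> - s * p) * ((1 - p) / p)) * 2 powr (- (real n * s * p)) = (2 powr e) ^ n"
        by (simp add: powr_add[symmetric] powr_realpow[symmetric] powr_powr mult.commute)
      show ?thesis unfolding 1 A_def K_def 2[symmetric] by (simp only: mult_ac)
    qed
    finally show ?thesis .
  qed
  have "(\<integral>\<^sup>+x\<in>ball 0 R. (\<Sum>n. ennreal (norm (block f (int n) x))) \<partial>lborel) =
     (\<Sum>n. \<integral>\<^sup>+x\<in>ball 0 R. ennreal (norm (block f (int n) x)) \<partial>lborel)"
    unfolding ennreal_suminf_multc[symmetric] by (rule nn_integral_suminf) measurable
  also have "\<dots> \<le> (\<Sum>n. ennreal (K * (2 powr e) ^ n))"
    by (intro suminf_le trm) auto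
  also have "\<dots> = ennreal (K * (1 / (1 - 2 powr e)))"
  proof (rule suminf_ennreal_eq)
    show "(\<lambda>n. K * (2 powr e) ^ n) sums (K * (1 / (1 - 2 powr e)))"
      by (intro sums_mult geometric_sums) (use e in \<open>simp add: powr_less_one\<close>)
  qed (use K in simp)
  also have "\<dots> < \<top>" by simp
  finally show ?thesis .
qed

text \<open>An explicit representative of \<open>f\<close> that can be estimated block by block, in
  place of the abstractly chosen \<open>fun_of_dist f\<close>. The unspecified value of a divergent
  series affects only a null set.\<close>

definition realization :: "(('a \<Rightarrow> complex) \<Rightarrow> complex) \<Rightarrow> 'a \<Rightarrow> complex" where
  "realization f x = (\<Sum>n. block f (int n) x)"

lemma space_tempered: "f \<in> tlm_space \<phi>\<^sub>0 s u p q \<Longrightarrow> f \<in> tempered"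
  by (simp add: tlm_space_def)

lemma space_norm:
  assumes "f \<in> tlm_space \<phi>\<^sub>0 s u p q"
  obtains N where "N \<ge> 0" "morrey_norm u p (W f) = ennreal N"
  using assms unfolding tlm_space_def tlm_norm_eq by (cases "morrey_norm u p (W f)") auto

lemma realization_properties:
  assumes f: "f \<in> tlm_space \<phi>\<^sub>0 s u p q"
  shows "represents (realization f) f"
    and "AE x in lebesgue. (\<Sum>n. ennreal (norm (block f (int n) x))) < \<top>"
proof -
  obtain N where N: "N \<ge> 0" "morrey_norm u p (W f) = ennreal N" using space_norm[OF f] .
  have "(\<integral>\<^sup>+x\<in>ball 0 R. (\<Sum>n. ennreal (norm (block f (int n) x))) \<partial>lborel) < \<top>" if "R > 0" for R
  proof (cases "p < 1")
    case True
    show ?thesis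
      by (rule block_local_integrable_small[OF space_tempered[OF f] eq_refl[OF N(2)] N(1) that True])
  next
    case False
    then have "1 \<le> p" by simp
    then show ?thesis
      by (rule block_local_integrable_large[OF space_tempered[OF f] eq_refl[OF N(2)] N(1) that])
  qed
  note sum = represents_sum_of_pieces[OF space_tempered[OF f] this]
  show "represents (realization f) f" using sum(1) unfolding realization_def[abs_def] .
  show "AE x in lebesgue. (\<Sum>n. ennreal (norm (block f (int n) x))) < \<top>" by (rule sum(2))
qed

lemma morrey_norm_dist_eq:
  assumes f: "f \<in> tlm_space \<phi>\<^sub>0 s u p q"
  shows "morrey_norm_dist u p f = morrey_norm u p (\<lambda>x. ennreal (norm (realization f x)))"
proof -
  have "represents (fun_of_dist f) f"
    unfolding fun_of_dist_def by (rule someI[of _ "realization f"]) (rule realization_properties(1)[OF f])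
  from represents_unique[OF this realization_properties(1)[OF f]]
  show ?thesis unfolding morrey_norm_dist_def by (intro morrey_norm_cong_AE) (auto elim: eventually_mono)
qed

lemma realization_measurable: "f \<in> tempered \<Longrightarrow> realization f \<in> borel_measurable borel"
  unfolding realization_def[abs_def] using block_measurable by measurable

lemma block_summable:
  assumes "(\<Sum>n. ennreal (norm (block f (int n) x))) < \<top>"
  shows "summable (\<lambda>n. norm (block f (int n) x))"
  using assms by (intro summable_suminf_not_top) auto

lemma realization_le_W:
  assumes "(\<Sum>n. ennreal (norm (block f (int n) x))) < \<top>"
  shows "ennreal (norm (realization f x)) \<le> ennreal (1 / (1 - 2 powr (- s))) * W f x"
proof -
  note summ = block_summable[OF assms]
  have "ennreal (norm (realization f x)) \<le> ennreal (\<Sum>n. norm (block f (int n) x))"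
    unfolding realization_def by (intro ennreal_leI summable_norm summ)
  also have "\<dots> = (\<Sum>n. ennreal (norm (block f (int (n + 0)) x)))"
    by (simp only: add_0_right suminf_ennreal2[OF norm_ge_zero summ])
  also have "\<dots> \<le> ennreal (1 / (1 - 2 powr (- s))) * weighted_lq s q {int 0..} (\<lambda>k. block f k x)"
    by (rule weighted_lq_sum_le[OF q_pos s_pos])
  finally show ?thesis by (simp add: W_def)
qed

lemma block_0_le:
  assumes "(\<Sum>n. ennreal (norm (block f (int n) x))) < \<top>"
  shows "ennreal (norm (block f 0 x)) \<le> ennreal (norm (realization f x)) +
    ennreal (1 / (1 - 2 powr (- s))) * weighted_lq s q {1..} (\<lambda>k. block f k x)"
proof -
  note summ = block_summable[OF assms]
  have summ1: "summable (\<lambda>n. norm (block f (int (n + 1)) x))" using summ by (subst summable_iff_shift[of _ 1])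
  have "realization f x = (\<Sum>n. block f (int (n + 1)) x) + block f 0 x"
    unfolding realization_def using suminf_split_initial_segment[OF summable_norm_cancel[OF summ], of 1] by simp
  then have "norm (block f 0 x) \<le> norm (realization f x) + norm (\<Sum>n. block f (int (n + 1)) x)"
    by (metis add_diff_cancel_left' norm_triangle_ineq4)
  also have "norm (\<Sum>n. block f (int (n + 1)) x) \<le> (\<Sum>n. norm (block f (int (n + 1)) x))"
    by (rule summable_norm[OF summ1])
  finally have "ennreal (norm (block f 0 x)) \<le> ennreal (norm (realization f x) + (\<Sum>n. norm (block f (int (n + 1)) x)))"
    by (rule ennreal_leI) simp
  also have "\<dots> = ennreal (norm (realization f x)) + (\<Sum>n. ennreal (norm (block f (int (n + 1)) x)))"
    using suminf_nonneg[OF summ1] by (subst suminf_ennreal2[OF _ summ1]) auto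
  also have "(\<Sum>n. ennreal (norm (block f (int (n + 1)) x))) \<le>
      ennreal (1 / (1 - 2 powr (- s))) * weighted_lq s q {int 1..} (\<lambda>k. block f k x)"
    by (rule weighted_lq_sum_le[OF q_pos s_pos])
  finally show ?thesis by (simp add: add_left_mono)
qed

section \<open>The two inequalities between the quasi-norms\<close>

lemma morrey_norm_dist_le:
  obtains c where "c > 0" "\<And>f. f \<in> tlm_space \<phi>\<^sub>0 s u p q \<Longrightarrow> morrey_norm_dist u p f \<le> ennreal c * tlm_norm \<phi>\<^sub>0 s u p q f"
proof -
  define c where "c = 1 / (1 - 2 powr (- s))"
  have c: "c > 0" using s_pos by (simp add: c_def powr_less_one)
  have "morrey_norm_dist u p f \<le> ennreal (c * 2 powr (1 + 1 / p)) * tlm_norm \<phi>\<^sub>0 s u p q f"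
    if f: "f \<in> tlm_space \<phi>\<^sub>0 s u p q" for f
    unfolding morrey_norm_dist_eq[OF f] tlm_norm_eq
  proof (rule morrey_norm_mono_AE[OF p_pos u_pos c])
    show "W f \<in> borel_measurable lebesgue"
      using W_measurable[OF space_tempered[OF f]] by (simp add: measurable_completion)
    show "AE x in lebesgue. ennreal (norm (realization f x)) \<le> ennreal c * W f x"
      using realization_properties(2)[OF f] by eventually_elim (simp add: c_def realization_le_W)
  qed
  then show ?thesis using that[of "c * 2 powr (1 + 1 / p)"] c by simp
qed

lemma weighted_lq_phi_psi:
  assumes "f \<in> tempered" "I \<subseteq> {1..}" "I \<subseteq> J"
  shows "weighted_lq s q I (\<lambda>k. block f k x) \<le> weighted_lq s q J (\<lambda>k. fourier_mult (psi \<phi>\<^sub>0 k) f x)"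
    and "weighted_lq s q I (\<lambda>k. fourier_mult (psi \<phi>\<^sub>0 k) f x) \<le> weighted_lq s q J (\<lambda>k. block f k x)"
  by (rule weighted_lq_mono[OF assms(3) q_pos]; use assms in \<open>auto simp: phi_def\<close>)+

lemma tlm_norm_le_spade:
  obtains c where "c > 0" "\<And>f K. f \<in> tlm_space \<phi>\<^sub>0 s u p q \<Longrightarrow> -1 \<le> K \<Longrightarrow>
    tlm_norm \<phi>\<^sub>0 s u p q f \<le> ennreal c * tlm_norm_spade \<phi>\<^sub>0 s u p q K f"
proof -
  define c0 where "c0 = 1 / (1 - 2 powr (- s))"
  have c0: "c0 > 0" using s_pos by (simp add: c0_def powr_less_one)
  obtain C where C: "C > 0" "\<And>I J s c. weighted_lq s q (I \<union> J) c \<le> ennreal C * (weighted_lq s q I c + weighted_lq s q J c)"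
    by (rule weighted_lq_union[OF q_pos]) blast
  have "tlm_norm \<phi>\<^sub>0 s u p q f \<le> ennreal ((C * (c0 + 1)) * 2 powr (1 + 1 / p)) * tlm_norm_spade \<phi>\<^sub>0 s u p q K f"
    if f: "f \<in> tlm_space \<phi>\<^sub>0 s u p q" and K: "-1 \<le> K" for f K
    unfolding tlm_norm_eq tlm_norm_spade_def morrey_norm_dist_eq[OF f] tlm_seminorm_def
  proof (rule morrey_norm_quasi_triangle[OF p_pos u_pos])
    let ?I = "{k. - K \<le> ereal (of_int k)}"
    let ?V = "\<lambda>x. weighted_lq s q ?I (\<lambda>k. fourier_mult (psi \<phi>\<^sub>0 k) f x)"
    note tf = space_tempered[OF f]
    \<comment> \<open>\<open>K = -1\<close> is the extreme case, in which the index set is exactly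
      \<open>{1..}\<close>.\<close>
    have I: "{1..} \<subseteq> ?I"
    proof
      fix k :: int assume "k \<in> {1..}"
      then have k: "(1::ereal) \<le> ereal (of_int k)" by (simp add: one_ereal_def)
      have "- K \<le> 1" using K by (metis ereal_minus_le_minus ereal_uminus_uminus)
      from order_trans[OF this k] show "k \<in> ?I" by simp
    qed
    show "0 < C * (c0 + 1)" using C c0 by simp
    show "(\<lambda>x. ennreal (norm (realization f x))) \<in> borel_measurable lebesgue"
      using realization_measurable[OF tf] by (intro measurable_completion) measurable
    show "?V \<in> borel_measurable lebesgue"
      using piece_measurable[OF tf] by (intro measurable_completion) (simp add: fourier_mult_psi[OF tf])
    show "AE x in lebesgue. W f x \<le> ennreal (C * (c0 + 1)) * (ennreal (norm (realization f x)) + ?V x)"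
      using realization_properties(2)[OF f]
    proof eventually_elim
      case (elim x)
      let ?w = "weighted_lq s q {1..} (\<lambda>k. block f k x)"
      have "{0..} = {0} \<union> {1::int..}" by auto
      then have "W f x \<le> ennreal C * (weighted_lq s q {0} (\<lambda>k. block f k x) + ?w)"
        unfolding W_def using C(2)[of s "{0}" "{1..}"] by simp
      also have "\<dots> = ennreal C * (ennreal (norm (block f 0 x)) + ?w)"
        by (simp add: weighted_lq_singleton_0[OF q_pos])
      also have "\<dots> \<le> ennreal C * ((ennreal (norm (realization f x)) + ennreal c0 * ?w) + ?w)"
        using block_0_le[OF elim] unfolding c0_def by (intro mult_left_mono add_right_mono) auto
      also have "\<dots> = ennreal C * (ennreal (norm (realization f x)) + ennreal (c0 + 1) * ?w)"
        using c0 by (simp add: distrib_right add.assoc)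
      also have "\<dots> \<le> ennreal C * (ennreal (c0 + 1) * ennreal (norm (realization f x)) + ennreal (c0 + 1) * ?V x)"
      proof (intro mult_left_mono add_mono)
        have "ennreal 1 * ennreal (norm (realization f x)) \<le> ennreal (c0 + 1) * ennreal (norm (realization f x))"
          using c0 by (intro mult_right_mono ennreal_leI) auto
        then show "ennreal (norm (realization f x)) \<le> ennreal (c0 + 1) * ennreal (norm (realization f x))" by simp
        show "?w \<le> ?V x" by (rule weighted_lq_phi_psi(1)[OF tf order_refl I])
      qed auto
      also have "\<dots> = ennreal (C * (c0 + 1)) * (ennreal (norm (realization f x)) + ?V x)"
        using C c0 by (simp only: ennreal_mult less_imp_le add_nonneg_nonneg zero_le_one distrib_left[symmetric] mult.assoc)
      finally show ?case .
    qed
  qed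
  then show ?thesis using that[of "(C * (c0 + 1)) * 2 powr (1 + 1 / p)"] C c0 by simp
qed

text \<open>The symbol \<open>cut 2\<close> is the sum of the first two Littlewood-Paley symbols,
  and each of the two blocks is at most \<open>W\<close> because the weights
  \<open>2 powr (k * s)\<close> are at least 1 for \<open>k >= 0\<close>.\<close>

lemma filtered_cut_2_bound:
  assumes f: "f \<in> tempered" and N: "morrey_norm u p (W f) \<le> ennreal N" "N \<ge> 0" and R: "R > 0"
  shows "(\<integral>\<^sup>+v\<in>ball y R. ennreal (norm (filtered (cut 2) f v) powr p) \<partial>lborel) \<le>
    ennreal (2 powr p * N powr p * (unit_ball_vol (DIM('a)) * R ^ DIM('a)) powr (1 - p / u))"
proof -
  note [measurable] = W_measurable[OF f]
  have [measurable]: "ball y R \<in> sets borel" by simp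
  have pw: "ennreal (norm (filtered (cut 2) f v) powr p) \<le> ennreal (2 powr p) * ennreal_powr (W f v) p" for v
  proof -
    have "filtered (cut 2) f v = block f 0 v + block f 1 v"
      using filtered_cut_sum[OF f, of 1 v] by simp
    then have "ennreal (norm (filtered (cut 2) f v)) \<le> ennreal (norm (block f 0 v) + norm (block f 1 v))"
      by (simp add: norm_triangle_ineq ennreal_leI del: ennreal_plus)
    also have "\<dots> \<le> W f v + W f v"
    proof -
      have "norm (block f 1 v) \<le> 2 powr s * norm (block f 1 v)"
        using s_pos by (simp add: mult_le_cancel_right1 ge_one_powr_ge_zero)
      then have "ennreal (norm (block f 1 v)) \<le> W f v"
        using block_le_W[of 1 f v] by (auto intro: order_trans[OF ennreal_leI])
      moreover have "ennreal (norm (block f 0 v)) \<le> W f v" using block_le_W[of 0 f v] by simp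
      ultimately show ?thesis by (simp add: add_mono)
    qed
    also have "\<dots> = ennreal 2 * W f v" by (metis ennreal_numeral mult_2 zero_le_numeral)
    finally show ?thesis
      using ennreal_powr_mono[OF p_pos, of "ennreal (norm (filtered (cut 2) f v))" "ennreal 2 * W f v"] p_pos
      by (simp add: ennreal_powr_cmult del: ennreal_numeral)
  qed
  have "(\<integral>\<^sup>+v\<in>ball y R. ennreal (norm (filtered (cut 2) f v) powr p) \<partial>lborel) \<le>
     (\<integral>\<^sup>+v. ennreal (2 powr p) * (ennreal_powr (W f v) p * indicator (ball y R) v) \<partial>lborel)"
    unfolding mult.assoc[symmetric] by (intro nn_integral_mono mult_right_mono pw) simp
  also have "\<dots> = ennreal (2 powr p) * (\<integral>\<^sup>+v\<in>ball y R. ennreal_powr (W f v) p \<partial>lborel)"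
    by (rule nn_integral_cmult) measurable
  also have "\<dots> \<le> ennreal (2 powr p) * ennreal (N powr p * (unit_ball_vol (DIM('a)) * R ^ DIM('a)) powr (1 - p / u))"
    by (intro mult_left_mono W_ball_bound f N R) simp
  finally show ?thesis by (simp add: ennreal_mult[symmetric] mult.assoc)
qed

text \<open>The parameters \<open>J\<close> and \<open>s'\<close> let one argument serve both parts
  of the theorem: \<open>J\<close> is finite for a fixed \<open>K\<close> and all of
  \<open>{..0}\<close> for the uniform statement. Indices above 0 are compared with \<open>W\<close>
  directly, and the summability assumption concerns only the nonpositive ones.\<close>

lemma low_pieces_bound:
  assumes J: "J \<subseteq> {..0}" and s': "s' < s"
    and fin: "infsum (\<lambda>k::int. ennreal (2 powr (of_int k * (s' * p + real DIM('a) * (min 1 p - 1))))) J < \<top>"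
  obtains c where "c > 0" "\<And>f I. f \<in> tlm_space \<phi>\<^sub>0 s u p q \<Longrightarrow> I \<inter> {..0} \<subseteq> J \<Longrightarrow>
    morrey_norm u p (\<lambda>x. weighted_lq s q I (\<lambda>k. fourier_mult (psi \<phi>\<^sub>0 k) f x)) \<le> ennreal c * tlm_norm \<phi>\<^sub>0 s u p q f"
proof -
  let ?b = "real DIM('a) * (min 1 p - 1)"
  obtain D where D: "D \<ge> 0" "infsum (\<lambda>k::int. ennreal (2 powr (of_int k * (s' * p + ?b)))) J = ennreal D"
    using fin by (cases "infsum (\<lambda>k::int. ennreal (2 powr (of_int k * (s' * p + ?b)))) J") auto
  obtain C where C: "C > 0" "\<And>T k R X y. T \<in> tempered \<Longrightarrow> k \<le> 0 \<Longrightarrow>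
     (\<forall>y. (\<integral>\<^sup>+v\<in>ball y R. ennreal (norm (filtered (cut 2) T v) powr p) \<partial>lborel) \<le> X) \<Longrightarrow>
     (\<integral>\<^sup>+x\<in>ball y R. ennreal (norm (piece T k x) powr p) \<partial>lborel) \<le> ennreal (C * 2 powr (of_int k * ?b)) * X"
    by (rule piece_low_estimate[OF p_pos]) blast
  obtain C4 where C4: "C4 > 0" "\<And>I c. I \<subseteq> {..0} \<Longrightarrow> weighted_lq s q I c \<le>
     ennreal C4 * ennreal_powr (infsum (\<lambda>k. ennreal (2 powr (of_int k * s' * p) * cmod (c k) powr p)) I) (1 / p)"
    by (rule weighted_lq_nonpos_le[OF q_pos s' p_pos]) blast
  obtain Cu where Cu: "Cu > 0" "\<And>I J s c. weighted_lq s q (I \<union> J) c \<le> ennreal Cu * (weighted_lq s q I c + weighted_lq s q J c)"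
    by (rule weighted_lq_union[OF q_pos]) blast
  define c1 where "c1 = Cu * (C4 + 1)"
  \<comment> \<open>The \<open>p\<close>-th root of \<open>C * D * 2 powr p\<close>:
    \<open>C\<close> from the estimate of a single piece, \<open>D\<close> from the sum over
    \<open>J\<close>, and \<open>2 powr p\<close> from bounding two blocks by
    \<open>W\<close>.\<close>
  define c2 where "c2 = (C * D) powr (1 / p) * 2"
  have c1: "c1 > 0" using Cu C4 by (simp add: c1_def)
  have c2: "c2 \<ge> 0" by (simp add: c2_def)
  have "morrey_norm u p (\<lambda>x. weighted_lq s q I (\<lambda>k. fourier_mult (psi \<phi>\<^sub>0 k) f x)) \<le>
     ennreal (c1 * 2 powr (1 + 1 / p) * (c2 + 1)) * tlm_norm \<phi>\<^sub>0 s u p q f"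
    if f: "f \<in> tlm_space \<phi>\<^sub>0 s u p q" and I: "I \<inter> {..0} \<subseteq> J" for f I
  proof -
    note tf = space_tempered[OF f]
    note [measurable] = piece_measurable[OF tf]
    have [measurable]: "ball y R \<in> sets borel" for y :: 'a and R by simp
    obtain N where N: "N \<ge> 0" "morrey_norm u p (W f) = ennreal N" using space_norm[OF f] .
    \<comment> \<open>With \<ell>_p in place of \<ell>_q the integral over a ball can be taken term
      by term, so bounds for the individual pieces suffice.\<close>
    define Z where "Z x = infsum (\<lambda>k. ennreal (2 powr (of_int k * s' * p) * norm (piece f k x) powr p)) J" for x
    have [measurable]: "Z \<in> borel_measurable borel" unfolding Z_def[abs_def] by measurable
    let ?h = "\<lambda>x. ennreal_powr (Z x) (1 / p)"
    have Z: "(\<integral>\<^sup>+x\<in>ball y R. Z x \<partial>lborel) \<le> ennreal (C * D * (2 powr p * N powr p * (unit_ball_vol (DIM('a)) * R ^ DIM('a)) powr (1 - p / u)))"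
      if R: "R > 0" for y R
    proof -
      define X where "X = 2 powr p * N powr p * (unit_ball_vol (DIM('a)) * R ^ DIM('a)) powr (1 - p / u)"
      have X: "X \<ge> 0" by (simp add: X_def)
      have "(\<integral>\<^sup>+x\<in>ball y R. Z x \<partial>lborel) = (\<integral>\<^sup>+x. infsum (\<lambda>k. ennreal (2 powr (of_int k * s' * p)) * (ennreal (norm (piece f k x) powr p) * indicator (ball y R) x)) J \<partial>lborel)"
      proof (rule nn_integral_cong)
        fix x
        have "Z x * indicator (ball y R) x = infsum (\<lambda>k. indicator (ball y R) x * ennreal (2 powr (of_int k * s' * p) * norm (piece f k x) powr p)) J"
          unfolding Z_def infsum_int_cmult by (rule mult.commute)
        also have "\<dots> = infsum (\<lambda>k. ennreal (2 powr (of_int k * s' * p)) * (ennreal (norm (piece f k x) powr p) * indicator (ball y R) x)) J"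
          by (intro infsum_cong) (simp add: ennreal_mult mult_ac)
        finally show "Z x * indicator (ball y R) x = infsum (\<lambda>k. ennreal (2 powr (of_int k * s' * p)) * (ennreal (norm (piece f k x) powr p) * indicator (ball y R) x)) J" .
      qed
      also have "\<dots> = infsum (\<lambda>k. \<integral>\<^sup>+x. ennreal (2 powr (of_int k * s' * p)) * (ennreal (norm (piece f k x) powr p) * indicator (ball y R) x) \<partial>lborel) J"
        by (rule nn_integral_infsum_int) measurable
      also have "\<dots> \<le> infsum (\<lambda>k. ennreal (C * X) * ennreal (2 powr (of_int k * (s' * p + ?b)))) J"
      proof (rule infsum_int_mono[OF _ order_refl])
        fix k assume k: "k \<in> J"
        have "(\<integral>\<^sup>+x. ennreal (2 powr (of_int k * s' * p)) * (ennreal (norm (piece f k x) powr p) * indicator (ball y R) x) \<partial>lborel) =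
           ennreal (2 powr (of_int k * s' * p)) * (\<integral>\<^sup>+x\<in>ball y R. ennreal (norm (piece f k x) powr p) \<partial>lborel)"
          by (rule nn_integral_cmult) measurable
        also have "\<dots> \<le> ennreal (2 powr (of_int k * s' * p)) * (ennreal (C * 2 powr (of_int k * ?b)) * ennreal X)"
        proof (intro mult_left_mono C(2)[OF tf])
          show "k \<le> 0" using J k by auto
          show "\<forall>y. (\<integral>\<^sup>+v\<in>ball y R. ennreal (norm (filtered (cut 2) f v) powr p) \<partial>lborel) \<le> ennreal X"
            unfolding X_def using filtered_cut_2_bound[OF tf _ N(1) R] N(2) by simp
        qed simp
        also have "\<dots> = ennreal (C * X * (2 powr (of_int k * s' * p) * 2 powr (of_int k * ?b)))"
          using C X by (simp add: ennreal_mult[symmetric] mult_ac)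
        also have "2 powr (of_int k * s' * p) * 2 powr (of_int k * ?b) = 2 powr (of_int k * (s' * p + ?b))"
          unfolding powr_add[symmetric] by (simp add: distrib_left mult.assoc)
        also have "ennreal (C * X * 2 powr (of_int k * (s' * p + ?b))) = ennreal (C * X) * ennreal (2 powr (of_int k * (s' * p + ?b)))"
          using C X by (simp add: ennreal_mult)
        finally show "(\<integral>\<^sup>+x. ennreal (2 powr (of_int k * s' * p)) * (ennreal (norm (piece f k x) powr p) * indicator (ball y R) x) \<partial>lborel) \<le>
           ennreal (C * X) * ennreal (2 powr (of_int k * (s' * p + ?b)))" .
      qed
      also have "\<dots> = ennreal (C * D * X)"
        unfolding infsum_int_cmult D(2) using C X D(1) by (simp add: ennreal_mult[symmetric] mult_ac)
      finally show ?thesis unfolding X_def .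
    qed
    have h: "morrey_norm u p ?h \<le> ennreal (c2 * N)"
      unfolding morrey_norm_le_iff[OF p_pos u_pos mult_nonneg_nonneg[OF c2 N(1)]]
    proof (intro allI impI)
      fix y :: 'a and R :: real assume R: "R > 0"
      have "(c2 * N) powr p = C * D * (2 powr p * N powr p)"
        using C D N p_pos by (simp add: c2_def powr_mult powr_powr)
      then show "(\<integral>\<^sup>+x\<in>ball y R. ennreal_powr (?h x) p \<partial>lebesgue) \<le> ennreal ((c2 * N) powr p * measure lebesgue (ball y R) powr (1 - p / u))"
        using Z[OF R, of y] p_pos unfolding measure_ball[OF R] nn_integral_completion
        by (simp add: ennreal_powr_powr mult.assoc)
    qed
    have "morrey_norm u p (\<lambda>x. weighted_lq s q I (\<lambda>k. fourier_mult (psi \<phi>\<^sub>0 k) f x)) \<le>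
       ennreal (c1 * 2 powr (1 + 1 / p)) * (morrey_norm u p ?h + morrey_norm u p (W f))"
    proof (rule morrey_norm_quasi_triangle[OF p_pos u_pos c1])
      show "?h \<in> borel_measurable lebesgue" by (intro measurable_completion) measurable
      show "W f \<in> borel_measurable lebesgue" using W_measurable[OF tf] by (simp add: measurable_completion)
      show "AE x in lebesgue. weighted_lq s q I (\<lambda>k. fourier_mult (psi \<phi>\<^sub>0 k) f x) \<le> ennreal c1 * (?h x + W f x)"
      proof (rule AE_I2)
        fix x
        let ?c = "\<lambda>k. fourier_mult (psi \<phi>\<^sub>0 k) f x"
        have "I = (I \<inter> {..0}) \<union> (I \<inter> {1..})" by auto
        then have "weighted_lq s q I ?c \<le> ennreal Cu * (weighted_lq s q (I \<inter> {..0}) ?c + weighted_lq s q (I \<inter> {1..}) ?c)"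
          using Cu(2)[of s "I \<inter> {..0}" "I \<inter> {1..}" ?c] by simp
        also have "\<dots> \<le> ennreal Cu * (ennreal (C4 + 1) * ?h x + ennreal (C4 + 1) * W f x)"
        proof (intro mult_left_mono add_mono)
          have "weighted_lq s q (I \<inter> {..0}) ?c \<le> weighted_lq s q J ?c" by (rule weighted_lq_mono[OF I q_pos refl])
          also have "\<dots> \<le> ennreal C4 * ?h x" using C4(2)[OF J, of ?c] by (simp add: Z_def fourier_mult_psi[OF tf])
          also have "\<dots> \<le> ennreal (C4 + 1) * ?h x" by (intro mult_right_mono ennreal_leI) auto
          finally show "weighted_lq s q (I \<inter> {..0}) ?c \<le> ennreal (C4 + 1) * ?h x" .
          have "weighted_lq s q (I \<inter> {1..}) ?c \<le> W f x"
            unfolding W_def by (rule weighted_lq_phi_psi(2)[OF tf]) auto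
          also have "\<dots> = ennreal 1 * W f x" by simp
          also have "\<dots> \<le> ennreal (C4 + 1) * W f x" using C4(1) by (intro mult_right_mono ennreal_leI) auto
          finally show "weighted_lq s q (I \<inter> {1..}) ?c \<le> ennreal (C4 + 1) * W f x" .
        qed simp
        also have "\<dots> = ennreal c1 * (?h x + W f x)"
          unfolding c1_def using Cu(1) C4(1)
          by (simp only: ennreal_mult less_imp_le add_nonneg_nonneg zero_le_one distrib_left[symmetric] mult.assoc)
        finally show "weighted_lq s q I ?c \<le> ennreal c1 * (?h x + W f x)" .
      qed
    qed
    also have "\<dots> \<le> ennreal (c1 * 2 powr (1 + 1 / p)) * (ennreal (c2 * N) + ennreal N)"
      using h N(2) by (intro mult_left_mono add_mono) auto
    also have "\<dots> = ennreal (c1 * 2 powr (1 + 1 / p) * (c2 + 1)) * ennreal N"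
      using c1 c2 N(1) by (simp add: ennreal_mult[symmetric] ennreal_plus[symmetric] distrib_right distrib_left mult.assoc del: ennreal_plus)
    finally show ?thesis unfolding tlm_norm_eq N(2) .
  qed
  moreover have "c1 * 2 powr (1 + 1 / p) * (c2 + 1) > 0" using c1 c2 by (intro mult_pos_pos) auto
  ultimately show ?thesis using that by blast
qed

lemma spade_le_tlm_norm:
  assumes J: "J \<subseteq> {..0}" and s': "s' < s"
    and fin: "infsum (\<lambda>k::int. ennreal (2 powr (of_int k * (s' * p + real DIM('a) * (min 1 p - 1))))) J < \<top>"
  obtains c where "c > 0" "\<And>f K. f \<in> tlm_space \<phi>\<^sub>0 s u p q \<Longrightarrow> {k. - K \<le> ereal (of_int k)} \<inter> {..0} \<subseteq> J \<Longrightarrow>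
    tlm_norm_spade \<phi>\<^sub>0 s u p q K f \<le> ennreal c * tlm_norm \<phi>\<^sub>0 s u p q f"
proof -
  obtain c1 where c1: "c1 > 0" "\<And>f. f \<in> tlm_space \<phi>\<^sub>0 s u p q \<Longrightarrow> morrey_norm_dist u p f \<le> ennreal c1 * tlm_norm \<phi>\<^sub>0 s u p q f"
    by (rule morrey_norm_dist_le) blast
  obtain c2 where c2: "c2 > 0" "\<And>f I. f \<in> tlm_space \<phi>\<^sub>0 s u p q \<Longrightarrow> I \<inter> {..0} \<subseteq> J \<Longrightarrow>
    morrey_norm u p (\<lambda>x. weighted_lq s q I (\<lambda>k. fourier_mult (psi \<phi>\<^sub>0 k) f x)) \<le> ennreal c2 * tlm_norm \<phi>\<^sub>0 s u p q f"
    by (rule low_pieces_bound[OF assms]) blast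
  have "tlm_norm_spade \<phi>\<^sub>0 s u p q K f \<le> ennreal (c1 + c2) * tlm_norm \<phi>\<^sub>0 s u p q f"
    if "f \<in> tlm_space \<phi>\<^sub>0 s u p q" "{k. - K \<le> ereal (of_int k)} \<inter> {..0} \<subseteq> J" for f K
    using add_mono[OF c1(2)[OF that(1)] c2(2)[OF that]] c1(1) c2(1)
    by (simp add: tlm_norm_spade_def tlm_seminorm_def distrib_right)
  then show ?thesis using that[of "c1 + c2"] c1(1) c2(1) by simp
qed

lemma equivalence_fixed:
  assumes K: "K \<in> {-1} \<union> range (\<lambda>n::nat. ereal (real n))"
  shows "\<exists>c::real. c > 0 \<and> (\<forall>f \<in> tlm_space \<phi>\<^sub>0 s u p q.
      tlm_norm \<phi>\<^sub>0 s u p q f \<le> ennreal c * tlm_norm_spade \<phi>\<^sub>0 s u p q K f \<and>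
      tlm_norm_spade \<phi>\<^sub>0 s u p q K f \<le> ennreal c * tlm_norm \<phi>\<^sub>0 s u p q f)"
proof -
  obtain m :: int where m: "K = ereal (of_int m)" "- 1 \<le> m"
  proof -
    have "\<exists>m::int. K = ereal (of_int m) \<and> - 1 \<le> m"
    proof (cases "K = -1")
      case True
      then show ?thesis by (intro exI[of _ "-1"]) (simp add: one_ereal_def)
    next
      case False
      then obtain n :: nat where "K = ereal (real n)" using K by auto
      then show ?thesis by (intro exI[of _ "int n"]) simp
    qed
    then show ?thesis using that by blast
  qed
  have K1: "-1 \<le> K" using m by (simp add: one_ereal_def)
  \<comment> \<open>A finite set, empty for \<open>m = -1\<close>, so the summability condition
    holds for any \<open>s'\<close>; \<open>s - 1\<close> is an arbitrary choice below
    \<open>s\<close>.\<close>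
  let ?J = "{- m..0}"
  have fin: "infsum (\<lambda>k::int. ennreal (2 powr (of_int k * ((s - 1) * p + real DIM('a) * (min 1 p - 1))))) ?J < \<top>"
    by simp
  obtain c1 where c1: "c1 > 0" "\<And>f K. f \<in> tlm_space \<phi>\<^sub>0 s u p q \<Longrightarrow> {k. - K \<le> ereal (of_int k)} \<inter> {..0} \<subseteq> ?J \<Longrightarrow>
    tlm_norm_spade \<phi>\<^sub>0 s u p q K f \<le> ennreal c1 * tlm_norm \<phi>\<^sub>0 s u p q f"
    by (rule spade_le_tlm_norm[OF _ _ fin]) auto
  obtain c2 where c2: "c2 > 0" "\<And>f K. f \<in> tlm_space \<phi>\<^sub>0 s u p q \<Longrightarrow> -1 \<le> K \<Longrightarrow>
    tlm_norm \<phi>\<^sub>0 s u p q f \<le> ennreal c2 * tlm_norm_spade \<phi>\<^sub>0 s u p q K f"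
    by (rule tlm_norm_le_spade) blast
  have sub: "{k. - K \<le> ereal (of_int k)} \<inter> {..0} \<subseteq> ?J" using m by auto
  have grow: "ennreal c1 * x \<le> ennreal (c1 + c2) * x" "ennreal c2 * x \<le> ennreal (c1 + c2) * x" for x
    using c1(1) c2(1) by (auto intro!: mult_right_mono ennreal_leI simp del: ennreal_plus)
  show ?thesis
    using c1(1) c2(1) order_trans[OF c1(2)[OF _ sub] grow(1)] order_trans[OF c2(2)[OF _ K1] grow(2)]
    by (intro exI[of _ "c1 + c2"]) (auto simp del: ennreal_plus)
qed

lemma equivalence_uniform:
  assumes s: "s > sigma_idx DIM('a) p"
  shows "\<exists>c::real. c > 0 \<and> (\<forall>K \<in> {-1, \<infinity>} \<union> range (\<lambda>n::nat. ereal (real n)). \<forall>f \<in> tlm_space \<phi>\<^sub>0 s u p q.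
      tlm_norm \<phi>\<^sub>0 s u p q f \<le> ennreal c * tlm_norm_spade \<phi>\<^sub>0 s u p q K f \<and>
      tlm_norm_spade \<phi>\<^sub>0 s u p q K f \<le> ennreal c * tlm_norm \<phi>\<^sub>0 s u p q f)"
proof -
  \<comment> \<open>The midpoint leaves room on both sides: below \<open>s\<close> for the change
    from \<open>q\<close> to \<open>p\<close>, above \<sigma> for the sum over all nonpositive
    \<open>k\<close>.\<close>
  define s' where "s' = (s + sigma_idx DIM('a) p) / 2"
  have s': "s' < s" "sigma_idx DIM('a) p < s'" using s by (auto simp: s'_def)
  \<comment> \<open>The scaling exponent of the kernels is \<sigma> up to the factor
    \<open>- p\<close>, so \<open>s' > \<sigma>\<close> makes the exponent of the geometric sum
    positive.\<close>
  have "sigma_idx DIM('a) p * p = - (real DIM('a) * (min 1 p - 1))"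
    using p_pos by (cases "p < 1") (auto simp: sigma_idx_def max_def min_def field_simps)
  then have "0 < s' * p + real DIM('a) * (min 1 p - 1)"
    using mult_strict_right_mono[OF s'(2) p_pos] by linarith
  note fin = infsum_powr_geometric_nonpos[OF this]
  obtain c1 where c1: "c1 > 0" "\<And>f K. f \<in> tlm_space \<phi>\<^sub>0 s u p q \<Longrightarrow> {k. - K \<le> ereal (of_int k)} \<inter> {..0} \<subseteq> {..0::int} \<Longrightarrow>
    tlm_norm_spade \<phi>\<^sub>0 s u p q K f \<le> ennreal c1 * tlm_norm \<phi>\<^sub>0 s u p q f"
    by (rule spade_le_tlm_norm[OF order_refl s'(1) fin]) blast
  obtain c2 where c2: "c2 > 0" "\<And>f K. f \<in> tlm_space \<phi>\<^sub>0 s u p q \<Longrightarrow> -1 \<le> K \<Longrightarrow>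
    tlm_norm \<phi>\<^sub>0 s u p q f \<le> ennreal c2 * tlm_norm_spade \<phi>\<^sub>0 s u p q K f"
    by (rule tlm_norm_le_spade) blast
  have grow: "ennreal c1 * x \<le> ennreal (c1 + c2) * x" "ennreal c2 * x \<le> ennreal (c1 + c2) * x" for x
    using c1(1) c2(1) by (auto intro!: mult_right_mono ennreal_leI simp del: ennreal_plus)
  have K1: "-1 \<le> K" if "K \<in> {-1, \<infinity>} \<union> range (\<lambda>n::nat. ereal (real n))" for K
    using that by (auto simp: one_ereal_def)
  show ?thesis
    using c1(1) c2(1) order_trans[OF c1(2)[OF _ Int_lower2] grow(1)] order_trans[OF c2(2)[OF _ K1] grow(2)]
    by (intro exI[of _ "c1 + c2"]) (auto simp del: ennreal_plus)
qed

end

theorem theorem4p5: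
  fixes \<phi>\<^sub>0 :: "'a::euclidean_space \<Rightarrow> real" and a b s u p :: real and q :: ereal
  assumes "1 \<le> a" "a < b" "b \<le> 2"
    and "\<phi>\<^sub>0 \<in> test_fun" "\<And>x. 0 \<le> \<phi>\<^sub>0 x"
    and "\<And>x. norm x \<le> a \<Longrightarrow> \<phi>\<^sub>0 x = 1" "\<And>x. b \<le> norm x \<Longrightarrow> \<phi>\<^sub>0 x = 0"
    and "0 < p" "p \<le> u" "0 < q"
    and "s > p / u * sigma_idx DIM('a) p"
  shows "(\<forall>K \<in> {-1} \<union> range (\<lambda>n::nat. ereal (real n)). \<exists>c::real. c > 0 \<and>
      (\<forall>f \<in> tlm_space \<phi>\<^sub>0 s u p q.
        tlm_norm \<phi>\<^sub>0 s u p q f \<le> ennreal c * tlm_norm_spade \<phi>\<^sub>0 s u p q K f \<and>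
        tlm_norm_spade \<phi>\<^sub>0 s u p q K f \<le> ennreal c * tlm_norm \<phi>\<^sub>0 s u p q f)) \<and>
    (s > sigma_idx DIM('a) p \<longrightarrow> (\<exists>c::real. c > 0 \<and>
      (\<forall>K \<in> {-1, \<infinity>} \<union> range (\<lambda>n::nat. ereal (real n)). \<forall>f \<in> tlm_space \<phi>\<^sub>0 s u p q.
        tlm_norm \<phi>\<^sub>0 s u p q f \<le> ennreal c * tlm_norm_spade \<phi>\<^sub>0 s u p q K f \<and>
        tlm_norm_spade \<phi>\<^sub>0 s u p q K f \<le> ennreal c * tlm_norm \<phi>\<^sub>0 s u p q f)))"
proof -
  \<comment> \<open>From \<open>1 <= a\<close> and \<open>b <= 2\<close> the cutoff is 1 on the unit
    ball and vanishes outside radius 2, as the locale demands.\<close>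
  interpret tlm_params \<phi>\<^sub>0 s u p q
    using assms by unfold_locales auto
  show ?thesis using equivalence_fixed equivalence_uniform by blast
qed

end
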